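(* There is an absolute constant $K\ge 1$ such that for every $b>1/2$ there is a constant $c$ with the following property. Let $u\in X^{0,b}$ and $v\in Y^{0,b}$ be such that their spatial Fourier transforms $\widehat{u}(\xi_1,t)$ and $\widehat{v}(\xi_2,t)$ are supported in the region $|\xi_2|^2\gg|\xi_1|$, i.e. $|\xi_2|^2\ge K|\xi_1|$ for all frequencies $\xi_1$ in the support of $\widehat u$ and $\xi_2$ in the support of $\widehat v$. Then $$\|u\,D_xv\|_{L^2_{xt}}\le c\,\|u\|_{X^{0,b}}\|v\|_{Y^{0,b}}.$$ The same inequality holds with $u$ on the left-hand side replaced by $\overline{u}$.
   Context: $x,t\in\mathbb{R}$. $\langle\lambda\rangle:=(1+\lambda^2)^{1/2}$, and $\widehat{u}(\xi,\tau)$ is the space-time Fourier transform $\int\int e^{-i(x\xi+t\tau)}u(x,t)\,dx\,dt$ (up to a normalizing constant). $X^{0,b}$ and $Y^{0,b}$ are the completions of the Schwartz space $\mathcal{S}(\mathbb{R}\times\mathbb{R})$ with respect to $$\|u\|_{X^{0,b}}=\|\langle\tau+\xi^2\rangle^b\widehat{u}(\xi,\tau)\|_{L^2_{\xi\tau}},\qquad \|v\|_{Y^{0,b}}=\|\langle\tau-\xi^3\rangle^b\widehat{v}(\xi,\tau)\|_{L^2_{\xi\tau}}.$$ $D_x$ is the Fourier multiplier in $x$ with symbol $|\xi|$. *)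

theory Defs
  imports "HOL-Analysis.Analysis"
begin

section \<open>Schwartz functions and the classical Fourier transform\<close>

definition dir_deriv :: "'a::euclidean_space \<Rightarrow> ('a \<Rightarrow> complex) \<Rightarrow> 'a \<Rightarrow> complex" where
  "dir_deriv e f p = frechet_derivative f (at p) e"

text \<open>All iterated partial derivatives exist, are differentiable and decay rapidly; differentiability
  at every order makes the function smooth.\<close>

definition schwartz :: "('a::euclidean_space \<Rightarrow> complex) \<Rightarrow> bool" where
  "schwartz f \<longleftrightarrow> (\<forall>es\<in>lists Basis.
     (\<forall>p. foldr dir_deriv es f differentiable (at p)) \<and>
     (\<forall>k::nat. \<exists>C. \<forall>p. norm p ^ k * norm (foldr dir_deriv es f p) \<le> C))"

text \<open>Functions on space-time are functions of the pair \<open>(x, t)\<close>, so that the inner product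
  in \<open>fourier\<close> is \<open>x * \<xi> + t * \<tau>\<close>. No normalizing constants are used.\<close>

definition fourier :: "('a::euclidean_space \<Rightarrow> complex) \<Rightarrow> 'a \<Rightarrow> complex" where
  "fourier f \<xi> = (LINT x|lborel. cis (- (x \<bullet> \<xi>)) * f x)"

definition fourier_x :: "(real \<times> real \<Rightarrow> complex) \<Rightarrow> real \<times> real \<Rightarrow> complex" where
  "fourier_x f = (\<lambda>(\<xi>, t). fourier (\<lambda>x. f (x, t)) \<xi>)"

section \<open>Square-integrable functions\<close>

definition sq_integrable :: "('a::euclidean_space \<Rightarrow> complex) \<Rightarrow> bool" where
  "sq_integrable f \<longleftrightarrow>
     f \<in> borel_measurable lborel \<and> integrable lborel (\<lambda>p. (norm (f p))\<^sup>2)"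

text \<open>Meaningful only for square-integrable functions: the Bochner integral of a non-integrable
  function is 0.\<close>

definition L2_norm :: "('a::euclidean_space \<Rightarrow> complex) \<Rightarrow> real" where
  "L2_norm f = sqrt (LINT p|lborel. (norm (f p))\<^sup>2)"

definition L2_tendsto :: "(nat \<Rightarrow> 'a::euclidean_space \<Rightarrow> complex) \<Rightarrow> ('a \<Rightarrow> complex) \<Rightarrow> bool" where
  "L2_tendsto f g \<longleftrightarrow> (\<forall>n. sq_integrable (f n)) \<and> sq_integrable g \<and>
     (\<lambda>n. L2_norm (\<lambda>p. f n p - g p)) \<longlonglongrightarrow> 0"

text \<open>Extension by density of a linear, \<open>L\<^sup>2\<close>-bounded operator from the Schwartz space to
  \<open>L\<^sup>2\<close> (Plancherel); the value is determined almost everywhere.\<close>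

definition L2_ext ::
  "(('a::euclidean_space \<Rightarrow> complex) \<Rightarrow> 'a \<Rightarrow> complex) \<Rightarrow> ('a \<Rightarrow> complex) \<Rightarrow> 'a \<Rightarrow> complex" where
  "L2_ext T u = (SOME U. \<exists>\<phi>. (\<forall>n. schwartz (\<phi> n)) \<and>
     L2_tendsto \<phi> u \<and> L2_tendsto (\<lambda>n. T (\<phi> n)) U)"

section \<open>The spaces X and Y\<close>

definition japanese :: "real \<Rightarrow> real" where
  "japanese s = (1 + s\<^sup>2) powr (1/2)"

definition weighted :: "(real \<times> real \<Rightarrow> real) \<Rightarrow> real \<Rightarrow> (real \<times> real \<Rightarrow> complex)
    \<Rightarrow> real \<times> real \<Rightarrow> complex" where
  "weighted \<sigma> b U p = of_real (japanese (\<sigma> p) powr b) * U p"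

text \<open>For \<open>b \<ge> 0\<close> the weight is at least 1, so the completion of the Schwartz space embeds into
  \<open>L\<^sup>2\<close>: it is realized as the set of \<open>L\<^sup>2\<close> limits of Schwartz sequences that are Cauchy in
  the weighted norm. (For \<open>b < 0\<close> this would not be the completion.) Elements are
  representatives modulo equality almost everywhere.\<close>

definition bourgain_space :: "(real \<times> real \<Rightarrow> real) \<Rightarrow> real \<Rightarrow> (real \<times> real \<Rightarrow> complex) set" where
  "bourgain_space \<sigma> b = {u. \<exists>\<phi>. (\<forall>n. schwartz (\<phi> n)) \<and> L2_tendsto \<phi> u \<and>
     (\<forall>e>0. \<exists>N. \<forall>m\<ge>N. \<forall>n\<ge>N.
        L2_norm (weighted \<sigma> b (fourier (\<lambda>p. \<phi> m p - \<phi> n p))) < e)}"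

definition bourgain_norm :: "(real \<times> real \<Rightarrow> real) \<Rightarrow> real \<Rightarrow> (real \<times> real \<Rightarrow> complex) \<Rightarrow> real" where
  "bourgain_norm \<sigma> b u = L2_norm (weighted \<sigma> b (L2_ext fourier u))"

definition schroedinger_phase :: "real \<times> real \<Rightarrow> real" where
  "schroedinger_phase = (\<lambda>(\<xi>, \<tau>). \<tau> + \<xi>\<^sup>2)"

definition airy_phase :: "real \<times> real \<Rightarrow> real" where
  "airy_phase = (\<lambda>(\<xi>, \<tau>). \<tau> - \<xi> ^ 3)"

abbreviation X_space :: "real \<Rightarrow> (real \<times> real \<Rightarrow> complex) set" where
  "X_space \<equiv> bourgain_space schroedinger_phase"

abbreviation X_norm :: "real \<Rightarrow> (real \<times> real \<Rightarrow> complex) \<Rightarrow> real" where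
  "X_norm \<equiv> bourgain_norm schroedinger_phase"

abbreviation Y_space :: "real \<Rightarrow> (real \<times> real \<Rightarrow> complex) set" where
  "Y_space \<equiv> bourgain_space airy_phase"

abbreviation Y_norm :: "real \<Rightarrow> (real \<times> real \<Rightarrow> complex) \<Rightarrow> real" where
  "Y_norm \<equiv> bourgain_norm airy_phase"

section \<open>Frequency support and the multiplier\<close>

text \<open>Closed support of a function defined only almost everywhere.\<close>

definition ess_support :: "('a::euclidean_space \<Rightarrow> complex) \<Rightarrow> 'a set" where
  "ess_support U = {p. \<forall>S. open S \<longrightarrow> p \<in> S \<longrightarrow> \<not> (AE q in lborel. q \<in> S \<longrightarrow> U q = 0)}"

definition x_frequencies :: "(real \<times> real \<Rightarrow> complex) \<Rightarrow> real set" where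
  "x_frequencies u = fst ` ess_support (L2_ext fourier_x u)"

text \<open>The tempered distribution \<open>D\<^sub>x v\<close> is the one whose Fourier transform is \<open>\<bar>\<xi>\<bar>\<close> times that of
  \<open>v\<close>, where Fourier transforms of distributions are defined by duality. It need not be
  in \<open>L\<^sup>2\<close>. The predicate says that this distribution is the function \<open>w\<close>, which is
  thereby unique almost everywhere.\<close>

definition is_Dx :: "(real \<times> real \<Rightarrow> complex) \<Rightarrow> (real \<times> real \<Rightarrow> complex) \<Rightarrow> bool" where
  "is_Dx v w \<longleftrightarrow> w \<in> borel_measurable lborel \<and>
     (\<forall>\<phi>. schwartz \<phi> \<longrightarrow>
        integrable lborel (\<lambda>p. w p * fourier \<phi> p) \<and>
        (LINT p|lborel. w p * fourier \<phi> p) =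
        (LINT p|lborel. of_real \<bar>fst p\<bar> * L2_ext fourier v p * \<phi> p))"

end

theory Submission
  imports Defs "HOL-Probability.Characteristic_Functions"
begin

text \<open>The estimate is a weighted Cauchy--Schwarz inequality on the Fourier side. Let \<open>U\<close> and \<open>V\<close> be the
  space-time transforms of \<open>u\<close> and \<open>v\<close>. Up to constants, the transform of \<open>u D\<^sub>x v\<close> is the convolution
  of \<open>U\<close> with \<open>\<bar>\<xi>\<^sub>2\<bar> V\<close>. If the weights are pulled out of \<open>U\<close> and \<open>V\<close> and Cauchy--Schwarz is applied
  at each output frequency, only one thing remains to be shown: the integral of \<open>\<xi>\<^sub>2\<^sup>2\<close> times the
  weights \<open>\<langle>\<tau>\<^sub>1 + \<xi>\<^sub>1\<^sup>2\<rangle>\<close> and \<open>\<langle>\<tau>\<^sub>2 - \<xi>\<^sub>2\<^sup>3\<rangle>\<close>, both to the power \<open>- 2 b\<close>, over all pairs of admissible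
  frequencies with a given sum, is bounded uniformly in the sum. Once \<open>\<tau>\<^sub>2\<close> has been shifted by
  \<open>\<xi>\<^sub>2\<^sup>3\<close>, the second weight is independent of \<open>\<xi>\<^sub>2\<close>, and the first one is evaluated at
  \<open>h(\<xi>\<^sub>2) = c - \<xi>\<^sub>2\<^sup>3 + (\<xi> - \<xi>\<^sub>2)\<^sup>2\<close>. Where \<open>\<bar>\<xi>\<^sub>1\<bar> \<le> \<xi>\<^sub>2\<^sup>2\<close>, with \<open>\<xi>\<^sub>1 = \<xi> - \<xi>\<^sub>2\<close>, the derivative
  \<open>- 3 \<xi>\<^sub>2\<^sup>2 - 2 \<xi>\<^sub>1\<close> of \<open>h\<close> has absolute value at least \<open>\<xi>\<^sub>2\<^sup>2\<close>, and \<open>h\<close> is injective on the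
  positive and on the negative frequencies \<open>\<xi>\<^sub>2\<close>. So the loss \<open>\<xi>\<^sub>2\<^sup>2\<close> is paid for by the Jacobian of
  \<open>s = h(\<xi>\<^sub>2)\<close>, and \<open>\<langle>s\<rangle>\<close> to the power \<open>- 2 b\<close> is integrable because \<open>b > 1/2\<close>. This is
  \<open>resonance_integral_le\<close> and \<open>bilinear_weight_integral_le\<close>, and it shows that \<open>K = 1\<close> is enough.

  Since \<open>D\<^sub>x v\<close> need not be square-integrable, that it is a function at all has to be proved. It
  follows from the Kato smoothing effect of the Airy equation: \<open>D\<^sub>x v\<close> is square-integrable in time,
  uniformly in \<open>x\<close>. The proof is the same change of variables, now with the phase \<open>\<tau> - \<xi>\<^sup>3\<close> alone
  (\<open>Kato_smoothing\<close>, \<open>Dx_exists\<close>).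

  These computations need integrable transforms. Hence \<open>U\<close> and \<open>V\<close> are truncated to bounded sets
  of frequencies. Truncation preserves the support condition, which approximation by Schwartz
  functions would destroy. The truncations are inverted by honest integrals, and the estimate
  passes to the limit by Fatou's lemma along a subsequence that converges almost everywhere. What
  is needed from Fourier analysis is Plancherel's theorem, which is derived from the transform of
  the Gaussian, and the independence of the \<open>L\<^sup>2\<close> extensions from the approximating sequence. The
  case of \<open>cnj u\<close> is the same, because only the absolute value of the product matters.\<close>

lemmas integral_eqI = Bochner_Integration.integral_cong[OF refl]
lemmas integrable_dominated = Bochner_Integration.integrable_bound

section \<open>Square integrals and completeness\<close>

text \<open>The squared \<open>L\<^sup>2\<close> norm as an extended nonnegative number: it is meaningful without any
  integrability hypothesis, so that Tonelli's theorem and Fatou's lemma apply directly.\<close>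

definition energy :: "'a measure \<Rightarrow> ('a \<Rightarrow> complex) \<Rightarrow> ennreal" where
  "energy M f = (\<integral>\<^sup>+x. ennreal ((norm (f x))\<^sup>2) \<partial>M)"

abbreviation sq_norm :: "('a::euclidean_space \<Rightarrow> complex) \<Rightarrow> ennreal" where
  "sq_norm \<equiv> energy lborel"

abbreviation sq_dist :: "('a::euclidean_space \<Rightarrow> complex) \<Rightarrow> ('a \<Rightarrow> complex) \<Rightarrow> ennreal" where
  "sq_dist f g \<equiv> sq_norm (\<lambda>x. f x - g x)"

text \<open>A substitute for Minkowski's inequality: the factor 2 is harmless, since it is only used to
  show that energies are finite or tend to 0.\<close>

lemma energy_triangle:
  assumes [measurable]: "f \<in> borel_measurable M" "g \<in> borel_measurable M" "h \<in> borel_measurable M"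
  shows "energy M (\<lambda>x. f x - h x) \<le> 2 * energy M (\<lambda>x. f x - g x) + 2 * energy M (\<lambda>x. g x - h x)"
proof -
  have pt: "ennreal ((norm (f x - h x))\<^sup>2)
      \<le> 2 * ennreal ((norm (f x - g x))\<^sup>2) + 2 * ennreal ((norm (g x - h x))\<^sup>2)" for x
  proof -
    have "norm (f x - h x) \<le> norm (f x - g x) + norm (g x - h x)"
      using norm_triangle_ineq[of "f x - g x" "g x - h x"] by simp
    then have "(norm (f x - h x))\<^sup>2 \<le> (norm (f x - g x) + norm (g x - h x))\<^sup>2"
      by (intro power_mono) auto
    also have "\<dots> \<le> 2 * (norm (f x - g x))\<^sup>2 + 2 * (norm (g x - h x))\<^sup>2"
      using sum_squares_bound[of "norm (f x - g x)" "norm (g x - h x)"]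
      by (simp add: power2_sum)
    finally have "ennreal ((norm (f x - h x))\<^sup>2)
      \<le> ennreal (2 * (norm (f x - g x))\<^sup>2 + 2 * (norm (g x - h x))\<^sup>2)"
      by (rule ennreal_leI)
    also have "\<dots> = 2 * ennreal ((norm (f x - g x))\<^sup>2) + 2 * ennreal ((norm (g x - h x))\<^sup>2)"
      by (simp add: ennreal_plus ennreal_mult')
    finally show ?thesis .
  qed
  show ?thesis
    unfolding energy_def
    by (subst nn_integral_cmult[symmetric], measurable)+
       (auto simp: nn_integral_add[symmetric] intro!: nn_integral_mono pt)
qed

lemma energy_minus_commute: "energy M (\<lambda>x. f x - g x) = energy M (\<lambda>x. g x - f x)"
  unfolding energy_def by (simp add: norm_minus_commute)

lemma energy_cmult:
  assumes [measurable]: "f \<in> borel_measurable M"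
  shows "energy M (\<lambda>x. c * f x) = ennreal ((norm c)\<^sup>2) * energy M f"
  unfolding energy_def
  by (subst nn_integral_cmult[symmetric]) (auto simp: norm_mult power_mult_distrib ennreal_mult)

lemma energy_cong_AE: "AE x in M. f x = g x \<Longrightarrow> energy M f = energy M g"
  unfolding energy_def by (intro nn_integral_cong_AE) auto

lemma energy_mono: "(\<And>x. x \<in> space M \<Longrightarrow> norm (f x) \<le> norm (g x)) \<Longrightarrow> energy M f \<le> energy M g"
  unfolding energy_def by (intro nn_integral_mono ennreal_leI power_mono) auto

lemma energy_zero_iff:
  assumes [measurable]: "f \<in> borel_measurable M"
  shows "energy M f = 0 \<longleftrightarrow> (AE x in M. f x = 0)"
  unfolding energy_def by (subst nn_integral_0_iff_AE) (auto simp: ennreal_eq_0_iff)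

lemma energy_Fatou:
  assumes [measurable]: "\<And>n. f n \<in> borel_measurable M"
    and lim: "AE x in M. (\<lambda>n. f n x) \<longlonglongrightarrow> g x"
    and le: "\<forall>\<^sub>F n in sequentially. energy M (f n) \<le> C"
  shows "energy M g \<le> C"
proof -
  have "energy M g \<le> (\<integral>\<^sup>+x. liminf (\<lambda>n. ennreal ((norm (f n x))\<^sup>2)) \<partial>M)"
    unfolding energy_def
  proof (rule nn_integral_mono_AE, use lim in eventually_elim)
    case (elim x)
    then have "(\<lambda>n. ennreal ((norm (f n x))\<^sup>2)) \<longlonglongrightarrow> ennreal ((norm (g x))\<^sup>2)"
      by (intro tendsto_intros)
    then show ?case using lim_imp_Liminf[OF sequentially_bot] by (metis order_refl)
  qed
  also have "\<dots> \<le> liminf (\<lambda>n. energy M (f n))"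
    unfolding energy_def by (rule nn_integral_liminf) simp
  also have "\<dots> \<le> C"
    using Liminf_le[OF sequentially_bot le] by simp
  finally show ?thesis .
qed

lemma energy_AE_subseq:
  assumes [measurable]: "\<And>n. f n \<in> borel_measurable M" "g \<in> borel_measurable M"
    and fin: "\<And>n. energy M (\<lambda>x. f n x - g x) < \<infinity>"
    and lim: "(\<lambda>n. energy M (\<lambda>x. f n x - g x)) \<longlonglongrightarrow> 0"
  shows "\<exists>r::nat\<Rightarrow>nat. strict_mono r \<and> (AE x in M. (\<lambda>n. f (r n) x) \<longlonglongrightarrow> g x)"
proof -
  let ?u = "\<lambda>n x. (norm (f n x - g x))\<^sup>2"
  have int: "integrable M (?u n)" for n
    using fin[of n] unfolding energy_def by (intro integrableI_bounded) auto
  have eq: "ennreal (\<integral>x. norm (?u n x) \<partial>M) = energy M (\<lambda>x. f n x - g x)" for n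
    unfolding energy_def using int[of n] by (simp add: nn_integral_eq_integral)
  have "(\<lambda>n. \<integral>x. norm (?u n x) \<partial>M) \<longlonglongrightarrow> 0"
    using lim unfolding eq[symmetric] by (subst (asm) tendsto_ennreal_iff[of _ _ 0, simplified]) auto
  from tendsto_L1_AE_subseq[OF int this] obtain r where
    r: "strict_mono r" "AE x in M. (\<lambda>n. ?u (r n) x) \<longlonglongrightarrow> 0" by blast
  have "AE x in M. (\<lambda>n. f (r n) x) \<longlonglongrightarrow> g x"
    using r(2)
  proof eventually_elim
    case (elim x)
    then have "(\<lambda>n. norm (f (r n) x - g x)) \<longlonglongrightarrow> 0"
      using tendsto_real_sqrt[OF elim] by (simp add: real_sqrt_abs)
    then show ?case by (simp add: tendsto_norm_zero_iff LIM_zero_iff)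
  qed
  with r(1) show ?thesis by blast
qed

text \<open>The Riesz--Fischer theorem. A subsequence whose successive differences have energy below
  \<open>4 ^ - k\<close> converges almost everywhere, and Fatou's lemma identifies the limit.\<close>

lemma energy_complete:
  assumes [measurable]: "\<And>n. f n \<in> borel_measurable M"
    and cauchy: "\<And>e. e > 0 \<Longrightarrow> \<exists>N. \<forall>m\<ge>N. \<forall>n\<ge>N. energy M (\<lambda>x. f m x - f n x) < e"
  shows "\<exists>g\<in>borel_measurable M. (\<lambda>n. energy M (\<lambda>x. f n x - g x)) \<longlonglongrightarrow> 0"
proof -
  have "\<exists>r. \<forall>k. (\<forall>m\<ge>r k. \<forall>n\<ge>r k. energy M (\<lambda>x. f m x - f n x) < ennreal ((1/4)^k)) \<and> r k < r (Suc k)"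
  proof (rule dependent_nat_choice)
    show "\<exists>x. \<forall>m\<ge>x. \<forall>n\<ge>x. energy M (\<lambda>x. f m x - f n x) < ennreal ((1/4)^0)"
      using cauchy[of "ennreal ((1/4)^0)"] by simp
    fix x k
    obtain N where N: "\<forall>m\<ge>N. \<forall>n\<ge>N. energy M (\<lambda>x. f m x - f n x) < ennreal ((1/4)^Suc k)"
      using cauchy[of "ennreal ((1/4)^Suc k)"] by auto
    then show "\<exists>y. (\<forall>m\<ge>y. \<forall>n\<ge>y. energy M (\<lambda>x. f m x - f n x) < ennreal ((1/4)^Suc k)) \<and> x < y"
      by (intro exI[of _ "max N (Suc x)"]) auto
  qed
  then obtain r where r: "\<And>k m n. m \<ge> r k \<Longrightarrow> n \<ge> r k \<Longrightarrow> energy M (\<lambda>x. f m x - f n x) < ennreal ((1/4)^k)"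
    and r_Suc: "\<And>k. r k < r (Suc k)" by blast
  have r_mono: "strict_mono r" using r_Suc by (simp add: strict_mono_Suc_iff)
  define d where "d k x = f (r (Suc k)) x - f (r k) x" for k x
  have [measurable]: "d k \<in> borel_measurable M" for k unfolding d_def by simp
  \<comment> \<open>the weights \<open>2 ^ k\<close> make square summability of the differences imply summability\<close>
  have "(\<integral>\<^sup>+x. (\<Sum>k. ennreal (2 ^ k * (norm (d k x))\<^sup>2)) \<partial>M) = (\<Sum>k. ennreal (2^k) * energy M (d k))"
    unfolding energy_def
    by (subst nn_integral_suminf) (auto simp: ennreal_mult nn_integral_cmult)
  also have "\<dots> \<le> (\<Sum>k. ennreal ((1/2)^k))"
  proof (intro suminf_le)
    fix k
    have "ennreal (2^k) * energy M (d k) \<le> ennreal (2^k) * ennreal ((1/4)^k)"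
      unfolding d_def using r[of k "r (Suc k)" "r k"] r_Suc[of k] by (intro mult_left_mono) auto
    also have "\<dots> = ennreal (2 ^ k * (1/4) ^ k)"
      by (simp add: ennreal_mult)
    also have "2 ^ k * (1/4) ^ k = (1/2 :: real) ^ k"
      by (simp add: power_mult_distrib[symmetric])
    finally show "ennreal (2^k) * energy M (d k) \<le> ennreal ((1/2)^k)" .
  qed auto
  also have "\<dots> < \<infinity>"
    by (subst suminf_ennreal2) (auto intro!: summable_geometric)
  finally have "AE x in M. (\<Sum>k. ennreal (2 ^ k * (norm (d k x))\<^sup>2)) \<noteq> \<infinity>"
    by (intro nn_integral_PInf_AE) auto
  then have conv: "AE x in M. convergent (\<lambda>k. f (r k) x)"
  proof eventually_elim
    case (elim x)
    then have s: "summable (\<lambda>k. 2 ^ k * (norm (d k x))\<^sup>2)"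
      by (intro summable_suminf_not_top) auto
    have "summable (\<lambda>k. d k x)"
    proof (rule summable_comparison_test')
      show "summable (\<lambda>k. 2 ^ k * (norm (d k x))\<^sup>2 + (1/2)^k)"
        by (intro summable_add s summable_geometric) auto
      fix k
      have "0 \<le> (2 ^ k * norm (d k x) - 1)\<^sup>2" by simp
      then have "2 * (2 ^ k * norm (d k x)) \<le> (2 ^ k * norm (d k x))\<^sup>2 + 1"
        by (simp add: power2_diff)
      then have "2 ^ k * norm (d k x) \<le> (2 ^ k * norm (d k x))\<^sup>2 + 1"
        by (smt (verit) norm_ge_zero zero_le_mult_iff zero_le_power)
      then have "2 ^ k * norm (d k x) / 2 ^ k \<le> ((2 ^ k * norm (d k x))\<^sup>2 + 1) / 2 ^ k"
        by (intro divide_right_mono) auto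
      also have "\<dots> = 2 ^ k * (norm (d k x))\<^sup>2 + (1/2)^k"
        by (simp add: field_simps power2_eq_square power_divide)
      finally show "norm (d k x) \<le> 2 ^ k * (norm (d k x))\<^sup>2 + (1/2)^k" by simp
    qed
    then have "convergent (\<lambda>n. \<Sum>k<n. d k x)"
      by (simp add: summable_iff_convergent)
    moreover have "(\<Sum>k<n. d k x) = f (r n) x - f (r 0) x" for n
      unfolding d_def by (rule sum_lessThan_telescope)
    ultimately have "convergent (\<lambda>n. (f (r n) x - f (r 0) x) + f (r 0) x)"
      by (intro convergent_add convergent_const) simp
    then show ?case by simp
  qed
  define g where "g x = lim (\<lambda>k. f (r k) x)" for x
  have [measurable]: "g \<in> borel_measurable M"
    unfolding g_def by (rule borel_measurable_lim_metric) auto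
  have lim: "AE x in M. (\<lambda>k. f (r k) x) \<longlonglongrightarrow> g x"
    using conv by eventually_elim (simp add: g_def convergent_LIMSEQ_iff)
  have "(\<lambda>n. energy M (\<lambda>x. f n x - g x)) \<longlonglongrightarrow> 0"
  proof (rule order_tendstoI)
    fix e :: ennreal assume "0 < e"
    then obtain e' where e': "0 < e'" "e' < e" using dense by blast
    from cauchy[OF e'(1)] obtain N where
      N: "\<And>m n. m \<ge> N \<Longrightarrow> n \<ge> N \<Longrightarrow> energy M (\<lambda>x. f m x - f n x) < e'" by blast
    have "energy M (\<lambda>x. f n x - g x) \<le> e'" if "n \<ge> N" for n
    proof (rule energy_Fatou)
      show "AE x in M. (\<lambda>k. f n x - f (r k) x) \<longlonglongrightarrow> f n x - g x"
        using lim by eventually_elim (intro tendsto_intros)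
      show "\<forall>\<^sub>F k in sequentially. energy M (\<lambda>x. f n x - f (r k) x) \<le> e'"
      proof (rule eventually_sequentiallyI)
        fix k assume "N \<le> k"
        then have "N \<le> r k" using seq_suble[OF r_mono, of k] by (rule le_trans)
        then show "energy M (\<lambda>x. f n x - f (r k) x) \<le> e'"
          by (rule less_imp_le[OF N[OF that]])
      qed
    qed simp
    then show "\<forall>\<^sub>F n in sequentially. energy M (\<lambda>x. f n x - g x) < e"
      using e'(2) by (intro eventually_sequentiallyI[of N]) (rule le_less_trans)
  qed simp
  then show ?thesis by (intro bexI[of _ g]) auto
qed

lemma sq_integrable_iff:
  "sq_integrable f \<longleftrightarrow> f \<in> borel_measurable lborel \<and> sq_norm f < \<infinity>"
  unfolding sq_integrable_def energy_def integrable_iff_bounded by auto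

lemma L2_norm_eq:
  assumes [measurable]: "f \<in> borel_measurable lborel"
  shows "L2_norm f = sqrt (enn2real (sq_norm f))"
  unfolding L2_norm_def energy_def by (subst integral_eq_nn_integral) auto

lemma energy_eq_L2_norm:
  assumes "sq_integrable f"
  shows "sq_norm f = ennreal ((L2_norm f)\<^sup>2)"
  using assms by (auto simp: sq_integrable_iff L2_norm_eq)

lemma sq_integrable_diff:
  assumes "sq_integrable f" "sq_integrable g"
  shows "sq_integrable (\<lambda>x. f x - g x)"
proof -
  from assms have [measurable]: "f \<in> borel_measurable lborel" "g \<in> borel_measurable lborel"
    by (auto simp: sq_integrable_iff)
  have "sq_dist f g \<le> 2 * sq_norm (\<lambda>x. f x - 0) + 2 * sq_norm (\<lambda>x. 0 - g x)"
    by (rule energy_triangle) auto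
  also have "\<dots> = 2 * sq_norm f + 2 * sq_norm g"
    by (simp add: energy_def)
  also have "\<dots> < \<infinity>"
    using assms by (auto simp: sq_integrable_iff ennreal_mult_less_top)
  finally show ?thesis by (simp add: sq_integrable_iff)
qed

lemma L2_tendsto_iff:
  "L2_tendsto f g \<longleftrightarrow> (\<forall>n. sq_integrable (f n)) \<and> sq_integrable g \<and>
     (\<lambda>n. sq_dist (f n) g) \<longlonglongrightarrow> 0"
proof -
  have "(\<lambda>n. L2_norm (\<lambda>p. f n p - g p)) \<longlonglongrightarrow> 0 \<longleftrightarrow> (\<lambda>n. sq_dist (f n) g) \<longlonglongrightarrow> 0"
    if "\<forall>n. sq_integrable (f n)" "sq_integrable g"
  proof -
    have "sq_dist (f n) g = ennreal ((L2_norm (\<lambda>p. f n p - g p))\<^sup>2)" for n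
      using that by (intro energy_eq_L2_norm sq_integrable_diff) auto
    then have "(\<lambda>n. sq_dist (f n) g) \<longlonglongrightarrow> 0 \<longleftrightarrow>
        (\<lambda>n. (L2_norm (\<lambda>p. f n p - g p))\<^sup>2) \<longlonglongrightarrow> 0"
      by (simp add: tendsto_ennreal_iff[of _ _ 0, simplified])
    also have "\<dots> \<longleftrightarrow> (\<lambda>n. L2_norm (\<lambda>p. f n p - g p)) \<longlonglongrightarrow> 0"
    proof
      assume "(\<lambda>n. (L2_norm (\<lambda>p. f n p - g p))\<^sup>2) \<longlonglongrightarrow> 0"
      from tendsto_real_sqrt[OF this] show "(\<lambda>n. L2_norm (\<lambda>p. f n p - g p)) \<longlonglongrightarrow> 0"
        by (simp add: L2_norm_def)
    next
      assume "(\<lambda>n. L2_norm (\<lambda>p. f n p - g p)) \<longlonglongrightarrow> 0"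
      from tendsto_power[OF this, of 2] show "(\<lambda>n. (L2_norm (\<lambda>p. f n p - g p))\<^sup>2) \<longlonglongrightarrow> 0"
        by simp
    qed
    finally show ?thesis by simp
  qed
  then show ?thesis unfolding L2_tendsto_def by auto
qed

section \<open>Gaussians and their Fourier transforms\<close>

definition gaussian :: "real \<Rightarrow> 'a::euclidean_space \<Rightarrow> real" where
  "gaussian r z = (\<Prod>b\<in>Basis. normal_density 0 r (z \<bullet> b))"

text \<open>Lebesgue measure is the product of the measures on the coordinate axes.\<close>

lemma integral_lborel_prod:
  fixes f :: "'a::euclidean_space \<Rightarrow> real \<Rightarrow> complex"
  assumes "\<And>b. b \<in> Basis \<Longrightarrow> integrable lborel (f b)"
  shows "integrable lborel (\<lambda>x::'a. \<Prod>b\<in>Basis. f b (x \<bullet> b))"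
    and "(LINT x|lborel. (\<Prod>b\<in>Basis. f b (x \<bullet> b))) = (\<Prod>b\<in>Basis. LINT s|lborel. f b s)"
proof -
  interpret product_sigma_finite "\<lambda>_::'a. lborel :: real measure" ..
  have [measurable]: "b \<in> Basis \<Longrightarrow> f b \<in> borel_measurable borel" for b
    using assms[of b] by auto
  have eq: "(\<Prod>b\<in>Basis. f b ((\<Sum>b'\<in>Basis. x b' *\<^sub>R b') \<bullet> b)) = (\<Prod>b\<in>Basis. f b (x b))" for x
    by (intro prod.cong) (auto simp: inner_sum_left_Basis)
  show "integrable lborel (\<lambda>x::'a. \<Prod>b\<in>Basis. f b (x \<bullet> b))"
    unfolding lborel_eq[where 'a='a]
    by (subst integrable_distr_eq) (auto simp: eq intro!: product_integrable_prod assms)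
  show "(LINT x|lborel. (\<Prod>b\<in>Basis. f b (x \<bullet> b))) = (\<Prod>b\<in>Basis. LINT s|lborel. f b s)"
    unfolding lborel_eq[where 'a='a]
    by (subst integral_distr) (auto simp: eq intro!: product_integral_prod assms)
qed

text \<open>A rescaling of the characteristic function of the standard normal distribution.\<close>

lemma fourier_real_gaussian:
  assumes "r > 0"
  shows "integrable lborel (\<lambda>s::real. cis (- (z * s)) * of_real (exp (- (r\<^sup>2 * s\<^sup>2) / 2)))"
    and "(LINT s|lborel. cis (- (z * s)) * of_real (exp (- (r\<^sup>2 * s\<^sup>2) / 2)))
           = of_real (2 * pi * normal_density 0 r z)"
proof -
  have "complex_of_real (exp (- ((-(z/r))\<^sup>2) / 2)) = char std_normal_distribution (- (z/r))"
    by (simp add: char_std_normal_distribution)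
  also have "\<dots> = (LINT x|lborel. std_normal_density x *\<^sub>R iexp (- (z/r) * x))"
    unfolding char_def by (subst integral_density) (auto simp: mult_ac)
  also have "\<dots> = \<bar>r\<bar> *\<^sub>R (LINT s|lborel. std_normal_density (0 + r * s) *\<^sub>R iexp (- (z/r) * (0 + r * s)))"
    by (rule lborel_integral_real_affine) (use assms in auto)
  also have "(LINT s|lborel. std_normal_density (0 + r * s) *\<^sub>R iexp (- (z/r) * (0 + r * s)))
     = (LINT s|lborel. of_real (1 / sqrt (2 * pi)) * (cis (- (z * s)) * of_real (exp (- (r\<^sup>2 * s\<^sup>2) / 2))))"
    using assms by (intro Bochner_Integration.integral_cong)
      (auto simp: std_normal_density_def cis_conv_exp scaleR_conv_of_real power_mult_distrib mult_ac)
  finally have "complex_of_real (exp (- ((-(z/r))\<^sup>2) / 2)) = of_real (r / sqrt (2 * pi)) *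
     (LINT s|lborel. cis (- (z * s)) * of_real (exp (- (r\<^sup>2 * s\<^sup>2) / 2)))" 
    using assms by (simp add: scaleR_conv_of_real)
  then have "(LINT s|lborel. cis (- (z * s)) * of_real (exp (- (r\<^sup>2 * s\<^sup>2) / 2)))
     = of_real (sqrt (2 * pi) / r * exp (- ((-(z/r))\<^sup>2) / 2))"
    using assms by (simp add: field_simps)
  also have "sqrt (2 * pi) / r * exp (- ((-(z/r))\<^sup>2) / 2) = 2 * pi * normal_density 0 r z"
    using assms by (simp add: normal_density_def real_sqrt_mult power_divide field_simps)
  finally show "(LINT s|lborel. cis (- (z * s)) * of_real (exp (- (r\<^sup>2 * s\<^sup>2) / 2)))
           = of_real (2 * pi * normal_density 0 r z)" .
  have "integrable lborel (\<lambda>s. normal_density 0 (1/r) s * (sqrt (2 * pi) / r))"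
    using assms by (intro integrable_mult_left integrable_normal_density) auto
  then show "integrable lborel (\<lambda>s::real. cis (- (z * s)) * of_real (exp (- (r\<^sup>2 * s\<^sup>2) / 2)))"
    by (rule integrable_dominated)
       (use assms in \<open>auto simp: norm_mult normal_density_def real_sqrt_mult real_sqrt_divide power_divide field_simps cis_conv_exp\<close>)
qed

abbreviation gauss_weight :: "real \<Rightarrow> 'a::euclidean_space \<Rightarrow> real" where
  "gauss_weight r x \<equiv> exp (- (r\<^sup>2 * (norm x)\<^sup>2) / 2)"

lemma fourier_gaussian:
  fixes z :: "'a::euclidean_space"
  assumes "r > 0"
  shows "integrable lborel (\<lambda>\<xi>::'a. cis (- (z \<bullet> \<xi>)) * of_real (gauss_weight r \<xi>))"
    and "(LINT \<xi>|lborel. cis (- (z \<bullet> \<xi>)) * of_real (gauss_weight r \<xi>))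
           = of_real ((2 * pi) ^ DIM('a) * gaussian r z)"
proof -
  define f where "f b s = cis (- (z \<bullet> b * s)) * complex_of_real (exp (- (r\<^sup>2 * s\<^sup>2) / 2))" for b s
  have eq: "cis (- (z \<bullet> \<xi>)) * complex_of_real (gauss_weight r \<xi>) = (\<Prod>b\<in>Basis. f b (\<xi> \<bullet> b))" for \<xi>
  proof -
    have "cis (- (z \<bullet> \<xi>)) = (\<Prod>b\<in>Basis. cis (- (z \<bullet> b * (\<xi> \<bullet> b))))"
      by (subst euclidean_inner) (simp add: cis_conv_exp exp_sum[symmetric] sum_negf sum_distrib_left)
    moreover have "gauss_weight r \<xi> = (\<Prod>b\<in>Basis. exp (- (r\<^sup>2 * (\<xi> \<bullet> b)\<^sup>2) / 2))"
      unfolding power2_norm_eq_inner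
      by (subst euclidean_inner) (simp add: exp_sum[symmetric] sum_negf sum_distrib_left sum_divide_distrib power2_eq_square)
    ultimately show ?thesis unfolding f_def by (simp add: prod.distrib)
  qed
  have int: "integrable lborel (f b)" for b
    unfolding f_def by (rule fourier_real_gaussian(1)[OF assms])
  show "integrable lborel (\<lambda>\<xi>::'a. cis (- (z \<bullet> \<xi>)) * of_real (gauss_weight r \<xi>))"
    unfolding eq by (rule integral_lborel_prod(1)[OF int])
  show "(LINT \<xi>|lborel. cis (- (z \<bullet> \<xi>)) * of_real (gauss_weight r \<xi>))
           = of_real ((2 * pi) ^ DIM('a) * gaussian r z)"
    unfolding eq integral_lborel_prod(2)[OF int]
    unfolding f_def fourier_real_gaussian(2)[OF assms] gaussian_def
    by (simp add: prod.distrib)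
qed

lemma gaussian_nonneg: "0 \<le> gaussian r z"
  unfolding gaussian_def by (intro prod_nonneg) (auto simp: normal_density_nonneg)

lemma gaussian_minus: "gaussian r (x - y) = gaussian r (y - x)"
  unfolding gaussian_def normal_density_def by (simp add: inner_diff_left power2_commute)

lemma gaussian_measurable[measurable]: "gaussian r \<in> borel_measurable borel"
  unfolding gaussian_def by measurable

lemma gaussian_le:
  fixes z :: "'a::euclidean_space"
  assumes "r > 0" shows "gaussian r z \<le> gaussian r (0::'a)"
  unfolding gaussian_def
  by (rule prod_mono) (use assms in \<open>auto simp: normal_density_nonneg normal_density_def divide_simps\<close>)

lemma nn_integral_gaussian:
  assumes "r > 0" shows "(\<integral>\<^sup>+z. ennreal (gaussian r (z::'a::euclidean_space)) \<partial>lborel) = 1"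
proof -
  have "(\<integral>\<^sup>+z. ennreal (gaussian r (z::'a)) \<partial>lborel)
     = (\<integral>\<^sup>+z. (\<Prod>b\<in>Basis. ennreal (normal_density 0 r ((z::'a) \<bullet> b))) \<partial>lborel)"
    unfolding gaussian_def by (simp add: prod_ennreal normal_density_nonneg)
  also have "\<dots> = 1"
    using assms by (subst nn_integral_lborel_prod)
      (auto simp: nn_integral_eq_integral integrable_normal_density integral_normal_density normal_density_nonneg)
  finally show ?thesis .
qed

lemma gaussian_scale:
  fixes z :: "'a::euclidean_space"
  assumes "r > 0" shows "gaussian r (r *\<^sub>R z) = gaussian 1 z / r ^ DIM('a)"
proof -
  have "normal_density 0 r (r * s) = normal_density 0 1 s / r" for s
    using assms by (simp add: normal_density_def real_sqrt_mult power_mult_distrib)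
  then show ?thesis
    unfolding gaussian_def by (simp add: prod_dividef)
qed

section \<open>The theorems of Plancherel and Parseval\<close>

lemma nn_integral_lborel_affine:
  fixes f :: "'a::euclidean_space \<Rightarrow> ennreal"
  assumes [measurable]: "f \<in> borel_measurable borel" and c: "c \<noteq> 0"
  shows "(\<integral>\<^sup>+x. f x \<partial>lborel) = ennreal (\<bar>c\<bar> ^ DIM('a)) * (\<integral>\<^sup>+x. f (t + c *\<^sub>R x) \<partial>lborel)"
  by (subst lborel_affine[OF c, of t])
     (simp add: nn_integral_density nn_integral_distr nn_integral_cmult)

lemma integrable_lborel_affine:
  fixes f :: "'a::euclidean_space \<Rightarrow> complex"
  assumes f: "integrable lborel f" and c: "c \<noteq> 0"
  shows "integrable lborel (\<lambda>x. f (t + c *\<^sub>R x))"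
proof -
  have [measurable]: "f \<in> borel_measurable borel" using f by auto
  have "integrable (density (distr lborel borel (\<lambda>x. t + c *\<^sub>R x)) (\<lambda>x. ennreal (\<bar>c\<bar> ^ DIM('a)))) f"
    using f by (subst lborel_affine[OF c, symmetric])
  then have "integrable lborel (\<lambda>x. (\<bar>c\<bar> ^ DIM('a)) *\<^sub>R f (t + c *\<^sub>R x))"
    by (subst (asm) integrable_density) (auto simp: integrable_distr_eq)
  from integrable_scaleR_right[OF this, of "inverse (\<bar>c\<bar> ^ DIM('a))"] show ?thesis using c by simp
qed

lemma integral_lborel_affine:
  fixes f :: "'a::euclidean_space \<Rightarrow> complex"
  assumes [measurable]: "f \<in> borel_measurable borel" and c: "c \<noteq> 0"
  shows "(LINT x|lborel. f x) = of_real (\<bar>c\<bar> ^ DIM('a)) * (LINT x|lborel. f (t + c *\<^sub>R x))"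
  by (subst lborel_affine[OF c, of t])
     (simp add: integral_density integral_distr scaleR_conv_of_real)

lemma measurable_cis[measurable]:
  "f \<in> borel_measurable M \<Longrightarrow> (\<lambda>x. cis (f x)) \<in> borel_measurable M"
  by (rule measurable_compose[OF _ borel_measurable_continuous_onI[OF continuous_on_cis[OF continuous_on_id]]])

lemma measurable_cnj[measurable]:
  "f \<in> borel_measurable M \<Longrightarrow> (\<lambda>x. cnj (f x)) \<in> borel_measurable M"
  by (rule measurable_compose[OF _ borel_measurable_continuous_onI[OF continuous_on_cnj[OF continuous_on_id]]])

lemma borel_measurable_fst_snd[measurable (raw)]:
  fixes f :: "'c \<Rightarrow> 'a::euclidean_space \<times> 'b::euclidean_space"
  assumes "f \<in> borel_measurable M"
  shows "(\<lambda>x. fst (f x)) \<in> borel_measurable M" "(\<lambda>x. snd (f x)) \<in> borel_measurable M"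
  using assms by (auto intro!: measurable_compose[OF assms] borel_measurable_continuous_onI continuous_intros)

lemma integrable_pair_mult:
  fixes f :: "'a::euclidean_space \<Rightarrow> complex" and g :: "'b::euclidean_space \<Rightarrow> complex"
  assumes f: "integrable lborel f" and g: "integrable lborel g"
  shows "integrable lborel (\<lambda>p. f (fst p) * g (snd p))"
    and "(LINT p|lborel. f (fst p) * g (snd p)) = (LINT x|lborel. f x) * (LINT y|lborel. g y)"
proof -
  have [measurable]: "f \<in> borel_measurable borel" "g \<in> borel_measurable borel"
    using f g by auto
  have int: "integrable (lborel \<Otimes>\<^sub>M lborel) (\<lambda>p. f (fst p) * g (snd p))"
    by (rule lborel_pair.Fubini_integrable) (use f g in \<open>auto simp: norm_mult\<close>)
  then show "integrable lborel (\<lambda>p. f (fst p) * g (snd p))" by (simp add: lborel_prod)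
  have "(LINT p|(lborel \<Otimes>\<^sub>M lborel). f (fst p) * g (snd p)) = (LINT x|lborel. LINT y|lborel. f x * g y)"
    using lborel_pair.integral_fst'[OF int] by simp
  then show "(LINT p|lborel. f (fst p) * g (snd p)) = (LINT x|lborel. f x) * (LINT y|lborel. g y)"
    by (simp add: lborel_prod)
qed

lemma fourier_measurable[measurable (raw)]:
  assumes [measurable]: "f \<in> borel_measurable borel"
  shows "fourier f \<in> borel_measurable borel"
  unfolding fourier_def by measurable

lemma fourier_integrand_integrable:
  assumes "integrable lborel f"
  shows "integrable lborel (\<lambda>x. cis (- (x \<bullet> \<xi>)) * f x)"
  by (rule integrable_dominated[OF assms]) (use assms in \<open>auto simp: norm_mult\<close>)

lemma norm_fourier_le: "norm (fourier f \<xi>) \<le> (LINT x|lborel. norm (f x))"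
proof -
  have "norm (fourier f \<xi>) \<le> (LINT x|lborel. norm (cis (- (x \<bullet> \<xi>)) * f x))"
    unfolding fourier_def by (rule integral_norm_bound)
  then show ?thesis by (simp add: norm_mult)
qed

lemma fourier_diff:
  assumes "integrable lborel f" "integrable lborel g"
  shows "fourier (\<lambda>x. f x - g x) \<xi> = fourier f \<xi> - fourier g \<xi>"
  using assms unfolding fourier_def
  by (simp add: right_diff_distrib Bochner_Integration.integral_diff fourier_integrand_integrable)

lemma fourier_mult_exchange:
  fixes f g :: "'a::euclidean_space \<Rightarrow> complex"
  assumes f: "integrable lborel f" and g: "integrable lborel g"
  shows "(LINT \<xi>|lborel. fourier f \<xi> * g \<xi>) = (LINT x|lborel. f x * fourier g x)"
proof -
  have [measurable]: "f \<in> borel_measurable borel" "g \<in> borel_measurable borel"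
    using f g by auto
  have int: "integrable (lborel \<Otimes>\<^sub>M lborel) (\<lambda>(x, \<xi>). cis (- (x \<bullet> \<xi>)) * f x * g \<xi>)"
    unfolding lborel_prod
    by (rule integrable_dominated[OF integrable_pair_mult(1)[OF f g]])
       (auto simp: norm_mult split_beta')
  have "(LINT \<xi>|lborel. fourier f \<xi> * g \<xi>) = (LINT \<xi>|lborel. LINT x|lborel. cis (- (x \<bullet> \<xi>)) * f x * g \<xi>)"
    unfolding fourier_def by simp
  also have "\<dots> = (LINT x|lborel. LINT \<xi>|lborel. cis (- (x \<bullet> \<xi>)) * f x * g \<xi>)"
    by (rule lborel_pair.Fubini_integral[OF int])
  also have "\<dots> = (LINT x|lborel. f x * fourier g x)"
  proof (rule integral_eqI)
    fix x
    have "(LINT \<xi>|lborel. cis (- (x \<bullet> \<xi>)) * f x * g \<xi>) = (LINT \<xi>|lborel. f x * (cis (- (\<xi> \<bullet> x)) * g \<xi>))"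
      by (simp add: mult_ac inner_commute)
    then show "(LINT \<xi>|lborel. cis (- (x \<bullet> \<xi>)) * f x * g \<xi>) = f x * fourier g x"
      unfolding fourier_def by simp
  qed
  finally show ?thesis .
qed

text \<open>The Gaussian factor makes the triple integral absolutely convergent. Integrating first over \<open>\<xi>\<close>
  turns the factor into an approximate identity in \<open>x - y\<close>.\<close>

lemma Parseval_regularised:
  fixes f g :: "'a::euclidean_space \<Rightarrow> complex"
  assumes f: "integrable lborel f" and g: "integrable lborel g" and r: "r > 0"
  shows "(LINT \<xi>|lborel. fourier f \<xi> * cnj (fourier g \<xi>) * of_real (gauss_weight r \<xi>))
    = of_real ((2 * pi) ^ DIM('a)) *
      (LINT p|lborel. f (fst p) * cnj (g (snd p)) * of_real (gaussian r (fst p - snd p)))"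
proof -
  let ?\<Phi> = "\<lambda>p \<xi>. f (fst p) * cnj (g (snd p)) * (cis (- ((fst p - snd p) \<bullet> \<xi>)) * complex_of_real (gauss_weight r \<xi>))"
  let ?G = "\<lambda>\<xi>::'a. complex_of_real (gauss_weight r \<xi>)"
  have [measurable]: "f \<in> borel_measurable borel" "g \<in> borel_measurable borel"
    using f g by auto
  have G: "integrable lborel ?G"
    using fourier_gaussian(1)[OF r, of "0::'a"] by simp
  have fg: "integrable lborel (\<lambda>p. f (fst p) * cnj (g (snd p)))"
    by (rule integrable_pair_mult(1)[OF f integrable_cnj[OF g]])
  have int: "integrable (lborel \<Otimes>\<^sub>M lborel)
      (\<lambda>(p, \<xi>). ?\<Phi> p \<xi>)"
    unfolding lborel_prod
    by (rule integrable_dominated[OF integrable_pair_mult(1)[OF fg G]])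
       (auto simp: norm_mult split_beta' borel_prod[symmetric])
  have "(LINT \<xi>|lborel. fourier f \<xi> * cnj (fourier g \<xi>) * ?G \<xi>)
     = (LINT \<xi>|lborel. LINT p|lborel. ?\<Phi> p \<xi>)"
  proof (rule integral_eqI)
    fix \<xi> :: 'a
    have "fourier f \<xi> * cnj (fourier g \<xi>) =
        (LINT x|lborel. cis (- (x \<bullet> \<xi>)) * f x) * (LINT x|lborel. cnj (cis (- (x \<bullet> \<xi>)) * g x))"
      unfolding fourier_def by (simp only: Bochner_Integration.integral_cnj)
    also have "\<dots> = (LINT p|lborel. (cis (- (fst p \<bullet> \<xi>)) * f (fst p)) * cnj (cis (- (snd p \<bullet> \<xi>)) * g (snd p)))"
      by (intro integrable_pair_mult(2)[symmetric] integrable_cnj fourier_integrand_integrable f g)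
    also have "\<dots> = (LINT p|lborel. f (fst p) * cnj (g (snd p)) * cis (- ((fst p - snd p) \<bullet> \<xi>)))"
    proof (rule integral_eqI)
      fix p :: "'a \<times> 'a"
      have "cis (- ((fst p - snd p) \<bullet> \<xi>)) = cis (- (fst p \<bullet> \<xi>)) * cnj (cis (- (snd p \<bullet> \<xi>)))"
        by (simp add: cis_cnj cis_mult inner_diff_left)
      then show "(cis (- (fst p \<bullet> \<xi>)) * f (fst p)) * cnj (cis (- (snd p \<bullet> \<xi>)) * g (snd p)) =
         f (fst p) * cnj (g (snd p)) * cis (- ((fst p - snd p) \<bullet> \<xi>))"
        by simp
    qed
    finally show "fourier f \<xi> * cnj (fourier g \<xi>) * ?G \<xi> =
       (LINT p|lborel. ?\<Phi> p \<xi>)"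
      by (simp flip: mult.assoc)
  qed
  also have "\<dots> = (LINT p|lborel. LINT \<xi>|lborel. ?\<Phi> p \<xi>)"
    by (rule lborel_pair.Fubini_integral[OF int])
  also have "\<dots> = (LINT p|lborel. of_real ((2 * pi) ^ DIM('a)) *
       (f (fst p) * cnj (g (snd p)) * of_real (gaussian r (fst p - snd p))))"
    by (rule integral_eqI)
       (simp only: integral_mult_right_zero fourier_gaussian(2)[OF r] of_real_mult, simp add: mult_ac)
  finally show ?thesis by simp
qed

lemma nn_integral_gaussian_shift:
  fixes x y :: "'a::euclidean_space"
  assumes "r > 0"
  shows "(\<integral>\<^sup>+x. ennreal (gaussian r (x - y)) \<partial>lborel) = 1"
    and "(\<integral>\<^sup>+y. ennreal (gaussian r (x - y)) \<partial>lborel) = 1"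
proof -
  have *: "(\<integral>\<^sup>+x. ennreal (gaussian r (x - y)) \<partial>lborel) = 1" for y :: 'a
    by (subst nn_integral_lborel_affine[where c=1 and t=y])
       (auto simp: nn_integral_gaussian[OF assms])
  show "(\<integral>\<^sup>+x. ennreal (gaussian r (x - y)) \<partial>lborel) = 1" by (rule *)
  show "(\<integral>\<^sup>+y. ennreal (gaussian r (x - y)) \<partial>lborel) = 1" 
    by (subst gaussian_minus) (rule *)
qed

text \<open>Young's inequality for the Gaussian kernel: bound the product of two values of \<open>f\<close> by half the
  sum of their squares and integrate out the variable that no longer occurs.\<close>

lemma Plancherel_le_regularised:
  fixes f :: "'a::euclidean_space \<Rightarrow> complex"
  assumes f: "integrable lborel f" and r: "r > 0"
  shows "(\<integral>\<^sup>+\<xi>. ennreal ((norm (fourier f \<xi>))\<^sup>2 * gauss_weight r \<xi>) \<partial>lborel)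
     \<le> ennreal ((2 * pi) ^ DIM('a)) * sq_norm f"
proof -
  let ?A = "\<lambda>p. ennreal ((norm (f (fst p)))\<^sup>2) * ennreal (gaussian r (fst p - snd p))"
  let ?B = "\<lambda>p. ennreal ((norm (f (snd p)))\<^sup>2) * ennreal (gaussian r (fst p - snd p))"
  let ?G = "\<lambda>\<xi>::'a. gauss_weight r \<xi>"
  let ?h = "\<lambda>p. f (fst p) * cnj (f (snd p)) * complex_of_real (gaussian r (fst p - snd p))"
  have [measurable]: "f \<in> borel_measurable borel"
    using f by auto
  have G: "integrable lborel (\<lambda>\<xi>. complex_of_real (?G \<xi>))"
    using fourier_gaussian(1)[OF r, of "0::'a"] by simp
  have "integrable lborel (\<lambda>\<xi>. complex_of_real ((LINT x|lborel. norm (f x))\<^sup>2) * complex_of_real (?G \<xi>))"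
    by (intro integrable_mult_right G)
  then have intG: "integrable lborel (\<lambda>\<xi>. (norm (fourier f \<xi>))\<^sup>2 * ?G \<xi>)"
    by (rule integrable_dominated)
       (auto simp: norm_mult norm_power intro!: mult_right_mono power_mono norm_fourier_le)
  have eq: "complex_of_real ((norm (fourier f \<xi>))\<^sup>2 * ?G \<xi>) = fourier f \<xi> * cnj (fourier f \<xi>) * of_real (?G \<xi>)" for \<xi>
    unfolding of_real_mult complex_norm_square ..
  have inth: "integrable lborel ?h"
  proof (rule integrable_dominated)
    show "integrable lborel (\<lambda>p. (f (fst p) * cnj (f (snd p))) * complex_of_real (gaussian r (0::'a)))"
      by (intro integrable_mult_left integrable_pair_mult(1) integrable_cnj f)
    show "AE x in lborel. norm (?h x) \<le> norm (f (fst x) * cnj (f (snd x)) * complex_of_real (gaussian r (0::'a)))"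
      by (auto simp: norm_mult gaussian_nonneg intro!: mult_left_mono gaussian_le r)
  qed (simp add: borel_prod[symmetric])
  have "(\<integral>\<^sup>+\<xi>. ennreal ((norm (fourier f \<xi>))\<^sup>2 * ?G \<xi>) \<partial>lborel) = ennreal (LINT \<xi>|lborel. (norm (fourier f \<xi>))\<^sup>2 * ?G \<xi>)"
    by (intro nn_integral_eq_integral intG) auto
  also have "(LINT \<xi>|lborel. (norm (fourier f \<xi>))\<^sup>2 * ?G \<xi>) = norm (complex_of_real (LINT \<xi>|lborel. (norm (fourier f \<xi>))\<^sup>2 * ?G \<xi>))"
    by (simp add: integral_nonneg_AE)
  also have "complex_of_real (LINT \<xi>|lborel. (norm (fourier f \<xi>))\<^sup>2 * ?G \<xi>)
      = (LINT \<xi>|lborel. fourier f \<xi> * cnj (fourier f \<xi>) * of_real (?G \<xi>))"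
    by (simp only: integral_complex_of_real[symmetric] eq)
  also have "norm \<dots> = (2 * pi) ^ DIM('a) * norm (LINT p|lborel. ?h p)"
    unfolding Parseval_regularised[OF f f r] by (simp add: norm_mult norm_power)
  also have "ennreal \<dots> \<le> ennreal ((2 * pi) ^ DIM('a)) * (\<integral>\<^sup>+p. ennreal (norm (?h p)) \<partial>lborel)"
    by (subst ennreal_mult) (auto intro!: mult_left_mono integral_norm_bound_ennreal inth)
  also have "(\<integral>\<^sup>+p. ennreal (norm (?h p)) \<partial>lborel) \<le>
     (\<integral>\<^sup>+p. ennreal (1/2) * (?A p
        + ?B p) \<partial>lborel)"
  proof (rule nn_integral_mono)
    fix p :: "'a \<times> 'a"
    have "norm (?h p) = (norm (f (fst p)) * norm (f (snd p))) * gaussian r (fst p - snd p)"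
      by (simp add: norm_mult gaussian_nonneg)
    also have "\<dots> \<le> (1/2 * ((norm (f (fst p)))\<^sup>2 + (norm (f (snd p)))\<^sup>2)) * gaussian r (fst p - snd p)"
      using sum_squares_bound[of "norm (f (fst p))" "norm (f (snd p))"]
      by (intro mult_right_mono) (auto simp: gaussian_nonneg)
    also have "\<dots> = 1/2 * ((norm (f (fst p)))\<^sup>2 * gaussian r (fst p - snd p) + (norm (f (snd p)))\<^sup>2 * gaussian r (fst p - snd p))"
      by (simp add: algebra_simps)
    finally have "ennreal (norm (?h p)) \<le> ennreal (1/2 * ((norm (f (fst p)))\<^sup>2 * gaussian r (fst p - snd p) + (norm (f (snd p)))\<^sup>2 * gaussian r (fst p - snd p)))"
      by (rule ennreal_leI)
    also have "\<dots> = ennreal (1/2) * (ennreal ((norm (f (fst p)))\<^sup>2 * gaussian r (fst p - snd p)) + ennreal ((norm (f (snd p)))\<^sup>2 * gaussian r (fst p - snd p)))"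
      by (subst ennreal_mult, simp, simp add: gaussian_nonneg, subst ennreal_plus) (simp_all add: gaussian_nonneg)
    finally show "ennreal (norm (?h p)) \<le> ennreal (1/2) * (?A p
        + ?B p)"
      by (simp add: ennreal_mult gaussian_nonneg)
  qed
  also have "\<dots> = ennreal (1/2) * ((\<integral>\<^sup>+p. ?A p \<partial>lborel)
     + (\<integral>\<^sup>+p. ?B p \<partial>lborel))"
    by (subst nn_integral_cmult, (simp add: borel_prod[symmetric])[], subst nn_integral_add) (simp_all add: borel_prod[symmetric])
  also have "(\<integral>\<^sup>+p. ?A p \<partial>lborel) = sq_norm f"
    unfolding lborel_prod[symmetric] energy_def
    by (subst lborel.nn_integral_fst[symmetric]) (simp_all add: nn_integral_cmult nn_integral_gaussian_shift[OF r])
  also have "(\<integral>\<^sup>+p. ?B p \<partial>lborel) = sq_norm f"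
    unfolding lborel_prod[symmetric] energy_def
    by (subst lborel_pair.nn_integral_snd[symmetric]) (simp_all add: nn_integral_cmult nn_integral_gaussian_shift[OF r])
  also have "ennreal (1/2) * (sq_norm f + sq_norm f) = sq_norm f"
  proof -
    have "ennreal (1/2) * 2 = ennreal (1/2) * ennreal 2" by simp
    also have "\<dots> = 1" by (subst ennreal_mult[symmetric]) auto
    finally show ?thesis by (simp only: mult_2[symmetric] mult.assoc[symmetric] mult_1_left)
  qed
  finally show ?thesis by (simp add: mult_left_mono)
qed

text \<open>Only the inequality is proved for integrable functions. The reverse inequality is used for Schwartz functions
  only, where it follows from \<open>Parseval\<close>.\<close>

lemma Plancherel_le:
  fixes f :: "'a::euclidean_space \<Rightarrow> complex"
  assumes f: "integrable lborel f"
  shows "sq_norm (fourier f) \<le> ennreal ((2 * pi) ^ DIM('a)) * sq_norm f"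
proof -
  let ?E = "\<lambda>\<xi> e. ennreal ((norm (fourier f \<xi>))\<^sup>2 * gauss_weight e \<xi>)"
  define e where "e n = inverse (real (Suc n))" for n
  have e: "e n > 0" for n unfolding e_def by simp
  have e0: "e \<longlonglongrightarrow> 0" unfolding e_def by (rule LIMSEQ_inverse_real_of_nat)
  have [measurable]: "f \<in> borel_measurable borel"
    using f by auto
  have "sq_norm (fourier f) \<le> (\<integral>\<^sup>+\<xi>. liminf (\<lambda>n. ?E \<xi> (e n)) \<partial>lborel)"
    unfolding energy_def
  proof (rule nn_integral_mono)
    fix \<xi> :: 'a
    have "(\<lambda>n. ?E \<xi> (e n))
        \<longlonglongrightarrow> ?E \<xi> 0"
      by (intro tendsto_intros e0) simp
    then show "ennreal ((norm (fourier f \<xi>))\<^sup>2) \<le> liminf (\<lambda>n. ?E \<xi> (e n))"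
      using lim_imp_Liminf[OF sequentially_bot] by fastforce
  qed
  also have "\<dots> \<le> liminf (\<lambda>n. (\<integral>\<^sup>+\<xi>. ?E \<xi> (e n) \<partial>lborel))"
    by (rule nn_integral_liminf) simp
  also have "\<dots> \<le> ennreal ((2 * pi) ^ DIM('a)) * sq_norm f"
    by (rule Liminf_le[OF sequentially_bot]) (intro always_eventually allI Plancherel_le_regularised f e)
  finally show ?thesis .
qed

lemma Plancherel_le_plane:
  fixes h :: "real \<times> real \<Rightarrow> complex"
  assumes "integrable lborel h"
  shows "sq_norm (fourier h) \<le> ennreal ((2 * pi)\<^sup>2) * sq_norm h"
proof -
  have "DIM(real \<times> real) = 2" by simp
  then show ?thesis using Plancherel_le[OF assms] by metis
qed

lemma integrable_mult_energy:
  assumes [measurable]: "f \<in> borel_measurable M" "g \<in> borel_measurable M"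
    and "energy M f < \<infinity>" "energy M g < \<infinity>"
  shows "integrable M (\<lambda>x. f x * g x)"
proof (rule integrable_dominated)
  show "integrable M (\<lambda>x. (norm (f x))\<^sup>2 + (norm (g x))\<^sup>2)"
    using assms unfolding energy_def
    by (intro Bochner_Integration.integrable_add integrableI_bounded) auto
  show "AE x in M. norm (f x * g x) \<le> norm ((norm (f x))\<^sup>2 + (norm (g x))\<^sup>2)"
  proof (rule AE_I2)
    fix x
    have "2 * norm (f x) * norm (g x) \<le> (norm (f x))\<^sup>2 + (norm (g x))\<^sup>2"
      by (rule sum_squares_bound)
    moreover have "0 \<le> norm (f x) * norm (g x)" by simp
    ultimately have "norm (f x * g x) \<le> (norm (f x))\<^sup>2 + (norm (g x))\<^sup>2"
      unfolding norm_mult by linarith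
    then show "norm (f x * g x) \<le> norm ((norm (f x))\<^sup>2 + (norm (g x))\<^sup>2)"
      by simp
  qed
qed simp

lemma energy_cnj: "energy M (\<lambda>x. cnj (f x)) = energy M f"
  by (simp add: energy_def)

lemma energy_bounded_integrable:
  assumes "integrable M f" "\<And>x. norm (f x) \<le> B"
  shows "energy M f < \<infinity>"
proof -
  have "integrable M (\<lambda>x. (norm (f x))\<^sup>2)"
  proof (rule integrable_dominated)
    show "integrable M (\<lambda>x. B * norm (f x))" using assms(1) by simp
    show "AE x in M. norm ((norm (f x))\<^sup>2) \<le> norm (B * norm (f x))"
    proof (rule AE_I2)
      fix x
      have "norm (f x) * norm (f x) \<le> B * norm (f x)" by (intro mult_right_mono assms(2)) auto
      then show "norm ((norm (f x))\<^sup>2) \<le> norm (B * norm (f x))"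
        by (simp add: power2_eq_square)
    qed
  qed (use assms(1) in simp)
  then show ?thesis unfolding energy_def by (simp add: integrable_iff_bounded)
qed

lemma integral_gaussian:
  "r > 0 \<Longrightarrow> integrable lborel (\<lambda>z::'a::euclidean_space. complex_of_real (gaussian r z))"
  "r > 0 \<Longrightarrow> (LINT z::'a::euclidean_space|lborel. complex_of_real (gaussian r z)) = 1"
proof -
  assume e: "r > 0"
  have i: "integrable lborel (gaussian r :: 'a \<Rightarrow> real)"
    by (rule integrableI_bounded) (auto simp: gaussian_nonneg nn_integral_gaussian[OF e])
  then show "integrable lborel (\<lambda>z::'a. complex_of_real (gaussian r z))" by simp
  have "(LINT z::'a|lborel. gaussian r z) = 1"
    using nn_integral_gaussian[OF e, where 'a='a]
    by (subst (asm) nn_integral_eq_integral[OF i]) (auto simp: gaussian_nonneg)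
  then show "(LINT z::'a::euclidean_space|lborel. complex_of_real (gaussian r z)) = 1"
    by simp
qed

text \<open>Continuity and boundedness of one factor suffice to let the Gaussian shrink to a point mass by
  dominated convergence. The other factor may be a discontinuous truncation.\<close>

lemma Parseval:
  fixes f g :: "'a::euclidean_space \<Rightarrow> complex"
  assumes f: "integrable lborel f" and cont: "continuous_on UNIV f" and bdd: "\<And>x. norm (f x) \<le> B"
    and g: "integrable lborel g" and g2: "sq_norm g < \<infinity>"
  shows "(LINT \<xi>|lborel. fourier f \<xi> * cnj (fourier g \<xi>)) = of_real ((2 * pi) ^ DIM('a)) * (LINT x|lborel. f x * cnj (g x))"
proof -
  define e where "e n = inverse (real (Suc n))" for n
  have e: "e n > 0" for n unfolding e_def by simp
  have e0: "e \<longlonglongrightarrow> 0" unfolding e_def by (rule LIMSEQ_inverse_real_of_nat)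
  have [measurable]: "f \<in> borel_measurable borel" "g \<in> borel_measurable borel"
    using f g by auto
  have fin: "sq_norm (fourier h) < \<infinity>" if "integrable lborel h" "sq_norm h < \<infinity>" for h :: "'a \<Rightarrow> complex"
    by (rule le_less_trans[OF Plancherel_le[OF that(1)]]) (use that in \<open>auto simp: ennreal_mult_less_top\<close>)
  let ?L = "\<lambda>n \<xi>. fourier f \<xi> * cnj (fourier g \<xi>) * complex_of_real (gauss_weight (e n) \<xi>)"
  let ?R = "\<lambda>n p. cnj (g (snd p)) * f (snd p + e n *\<^sub>R fst p) * complex_of_real (gaussian 1 (fst p))"
  have L: "(\<lambda>n. LINT \<xi>|lborel. ?L n \<xi>) \<longlonglongrightarrow> (LINT \<xi>|lborel. fourier f \<xi> * cnj (fourier g \<xi>))"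
  proof (rule integral_dominated_convergence)
    show "integrable lborel (\<lambda>\<xi>. norm (fourier f \<xi> * cnj (fourier g \<xi>)))"
      by (intro integrable_norm integrable_mult_energy)
         (auto simp: energy_cnj intro!: fin[OF f energy_bounded_integrable[OF f bdd], simplified] fin[OF g g2, simplified])
    show "AE x in lborel. (\<lambda>n. ?L n x) \<longlonglongrightarrow> fourier f x * cnj (fourier g x)"
    proof (rule AE_I2)
      fix x
      have "(\<lambda>n. ?L n x) \<longlonglongrightarrow> fourier f x * cnj (fourier g x) * complex_of_real (gauss_weight 0 x)"
        by (intro tendsto_intros e0) simp
      then show "(\<lambda>n. ?L n x) \<longlonglongrightarrow> fourier f x * cnj (fourier g x)" by simp
    qed
  qed (auto simp: norm_mult mult_left_le)
  let ?D = "\<lambda>p::'a\<times>'a. complex_of_real (gaussian 1 (fst p)) * (of_real B * cnj (g (snd p)))"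
  have intD: "integrable lborel ?D"
    by (intro integrable_pair_mult(1) integral_gaussian integrable_mult_right integrable_cnj g) simp
  have R_le: "norm (?R n p) \<le> norm (?D p)" for n p
  proof -
    have "norm (f (snd p + e n *\<^sub>R fst p)) \<le> \<bar>B\<bar>"
      using bdd[of "snd p + e n *\<^sub>R fst p"] by linarith
    then have "norm (g (snd p)) * norm (f (snd p + e n *\<^sub>R fst p)) * \<bar>gaussian 1 (fst p)\<bar> \<le> norm (g (snd p)) * \<bar>B\<bar> * \<bar>gaussian 1 (fst p)\<bar>"
      by (intro mult_right_mono mult_left_mono) auto
    then show ?thesis by (simp add: norm_mult mult_ac)
  qed
  have R: "(\<lambda>n. LINT p|lborel. ?R n p) \<longlonglongrightarrow> (LINT p::'a\<times>'a|lborel. cnj (g (snd p)) * f (snd p) * complex_of_real (gaussian 1 (fst p)))"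
  proof (rule integral_dominated_convergence)
    show "integrable lborel (\<lambda>p. norm (?D p))" by (rule integrable_norm[OF intD])
    show "AE p in lborel. (\<lambda>n. ?R n p) \<longlonglongrightarrow> cnj (g (snd p)) * f (snd p) * complex_of_real (gaussian 1 (fst p))"
    proof (rule AE_I2)
      fix p :: "'a \<times> 'a"
      have "(\<lambda>n. snd p + e n *\<^sub>R fst p) \<longlonglongrightarrow> snd p + 0 *\<^sub>R fst p"
        by (intro tendsto_intros e0)
      then have "(\<lambda>n. f (snd p + e n *\<^sub>R fst p)) \<longlonglongrightarrow> f (snd p)"
        using cont by (intro isCont_tendsto_compose[of _ f]) (auto simp: continuous_on_eq_continuous_at)
      then show "(\<lambda>n. ?R n p) \<longlonglongrightarrow> cnj (g (snd p)) * f (snd p) * complex_of_real (gaussian 1 (fst p))"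
        by (intro tendsto_intros)
    qed
    show "AE p in lborel. norm (?R n p) \<le> norm (?D p)" for n using R_le by (intro AE_I2)
  qed (simp_all add: borel_prod[symmetric])
  have "(LINT \<xi>|lborel. ?L n \<xi>) = of_real ((2 * pi) ^ DIM('a)) * (LINT p|lborel. ?R n p)" for n
  proof -
    let ?S = "\<lambda>p. f (fst p) * cnj (g (snd p)) * complex_of_real (gaussian (e n) (fst p - snd p))"
    have intS: "integrable lborel ?S"
    proof (rule integrable_dominated)
      show "integrable lborel (\<lambda>p. (f (fst p) * cnj (g (snd p))) * complex_of_real (gaussian (e n) (0::'a)))"
        by (intro integrable_mult_left integrable_pair_mult(1) integrable_cnj f g)
      show "AE x in lborel. norm (?S x) \<le> norm (f (fst x) * cnj (g (snd x)) * complex_of_real (gaussian (e n) (0::'a)))"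
        by (auto simp: norm_mult gaussian_nonneg intro!: mult_left_mono gaussian_le e)
    qed (simp add: borel_prod[symmetric])
    have intR: "integrable lborel (?R n)"
      by (rule integrable_dominated[OF intD]) (use R_le in \<open>auto simp: borel_prod[symmetric]\<close>)
    have "(LINT \<xi>|lborel. ?L n \<xi>) = of_real ((2 * pi) ^ DIM('a)) * (LINT p|lborel. ?S p)"
      by (rule Parseval_regularised[OF f g e])
    also have "(LINT p|lborel. ?S p) = (LINT y|lborel. LINT x|lborel. ?S (x, y))"
      using lborel_pair.integral_snd[of "\<lambda>x y. ?S (x, y)"] intS by (simp add: lborel_prod split_beta')
    also have "\<dots> = (LINT y|lborel. LINT z|lborel. ?R n (z, y))"
    proof (rule integral_eqI)
      fix y :: 'a
      have "(LINT x|lborel. ?S (x, y)) = of_real (\<bar>e n\<bar> ^ DIM('a)) * (LINT z|lborel. ?S (y + e n *\<^sub>R z, y))"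
        by (rule integral_lborel_affine) (use e[of n] in auto)
      also have "\<dots> = (LINT z|lborel. of_real (\<bar>e n\<bar> ^ DIM('a)) * ?S (y + e n *\<^sub>R z, y))"
        by simp
      also have "\<dots> = (LINT z|lborel. ?R n (z, y))"
        using e[of n] by (intro Bochner_Integration.integral_cong) (auto simp: gaussian_scale[OF e])
      finally show "(LINT x|lborel. ?S (x, y)) = (LINT z|lborel. ?R n (z, y))" .
    qed
    also have "\<dots> = (LINT p|lborel. ?R n p)"
      using lborel_pair.integral_snd[of "\<lambda>x y. ?R n (x, y)"] intR by (simp add: lborel_prod split_beta')
    finally show ?thesis .
  qed
  with L have "(\<lambda>n. of_real ((2 * pi) ^ DIM('a)) * (LINT p|lborel. ?R n p)) \<longlonglongrightarrow> (LINT \<xi>|lborel. fourier f \<xi> * cnj (fourier g \<xi>))"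
    by simp
  moreover have "(\<lambda>n. of_real ((2 * pi) ^ DIM('a)) * (LINT p|lborel. ?R n p)) \<longlonglongrightarrow>
     of_real ((2 * pi) ^ DIM('a)) * (LINT p::'a\<times>'a|lborel. cnj (g (snd p)) * f (snd p) * complex_of_real (gaussian 1 (fst p)))"
    by (intro tendsto_mult_left R)
  ultimately have "(LINT \<xi>|lborel. fourier f \<xi> * cnj (fourier g \<xi>)) =
     of_real ((2 * pi) ^ DIM('a)) * (LINT p::'a\<times>'a|lborel. cnj (g (snd p)) * f (snd p) * complex_of_real (gaussian 1 (fst p)))"
    by (rule LIMSEQ_unique)
  also have "(LINT p::'a\<times>'a|lborel. cnj (g (snd p)) * f (snd p) * complex_of_real (gaussian 1 (fst p))) =
     (LINT p::'a\<times>'a|lborel. complex_of_real (gaussian 1 (fst p)) * (\<lambda>x. f x * cnj (g x)) (snd p))"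
    by (simp add: mult_ac)
  also have "\<dots> = (LINT z|lborel. complex_of_real (gaussian 1 (z::'a))) * (LINT x|lborel. f x * cnj (g x))"
    by (intro integrable_pair_mult(2) integral_gaussian integrable_mult_energy)
       (auto simp: energy_cnj intro!: g2[simplified] energy_bounded_integrable[OF f bdd, simplified])
  finally show ?thesis unfolding integral_gaussian(2)[OF zero_less_one] by simp
qed

section \<open>Decay of Schwartz functions and of their transforms\<close>

lemma japanese_ge_1: "1 \<le> japanese s"
  unfolding japanese_def by (rule ge_one_powr_ge_zero) auto

lemma japanese_powr: "japanese s powr a = (1 + s\<^sup>2) powr (a / 2)"
  unfolding japanese_def by (simp add: powr_powr)

lemma japanese_measurable[measurable]: "japanese \<in> borel_measurable borel"
  unfolding japanese_def by measurable

text \<open>This is where \<open>b > 1/2\<close> enters.\<close>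

lemma japanese_nn_integral_finite:
  assumes b: "b > 1/2"
  shows "(\<integral>\<^sup>+s. ennreal (japanese s powr (- 2 * b)) \<partial>lborel) < \<infinity>"
proof -
  define e where "e = - 2 * b"
  have e: "e < -1" using b by (simp add: e_def)
  have tail: "(\<integral>\<^sup>+s. ennreal (indicator {1..} s * s powr e) \<partial>lborel) < \<infinity>"
    by (subst nn_integral_has_integral_lebesgue[OF _ has_integral_powr_to_inf[OF e, of 1]]) auto
  have "(\<integral>\<^sup>+s. ennreal (indicator {1..} s * s powr e) \<partial>lborel)
      = (\<integral>\<^sup>+s. ennreal (indicator {1..} (- s) * (- s) powr e) \<partial>lborel)"
    by (subst nn_integral_lborel_affine[where c="-1" and t=0]) auto
  with tail have tail': "(\<integral>\<^sup>+s. ennreal (indicator {1..} (- s) * (- s) powr e) \<partial>lborel) < \<infinity>"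
    by simp
  have "(\<integral>\<^sup>+s. ennreal (japanese s powr e) \<partial>lborel) \<le>
     (\<integral>\<^sup>+s. indicator {-1..1} s + (ennreal (indicator {1..} s * s powr e) + ennreal (indicator {1..} (- s) * (- s) powr e)) \<partial>lborel)"
  proof (rule nn_integral_mono)
    fix s :: real
    have le1: "japanese s powr e \<le> 1"
      using powr_mono[of "e / 2" 0 "1 + s\<^sup>2"] e by (simp add: japanese_powr split: if_splits)
    have le2: "japanese s powr e \<le> \<bar>s\<bar> powr e" if "\<bar>s\<bar> \<ge> 1"
    proof -
      have "\<bar>s\<bar> powr e = (\<bar>s\<bar> powr 2) powr (e/2)" unfolding powr_powr by simp
      also have "\<bar>s\<bar> powr 2 = s\<^sup>2" using that by (simp add: powr_numeral)
      finally have "\<bar>s\<bar> powr e = (s\<^sup>2) powr (e/2)" .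
      moreover have "(1 + s\<^sup>2) powr (e/2) \<le> (s\<^sup>2) powr (e/2)"
        using e that by (intro powr_mono2') auto
      ultimately show ?thesis by (simp add: japanese_powr)
    qed
    show "ennreal (japanese s powr e) \<le> indicator {-1..1} s + (ennreal (indicator {1..} s * s powr e) + ennreal (indicator {1..} (- s) * (- s) powr e))"
    proof (cases "\<bar>s\<bar> \<le> 1")
      case True
      then have "s \<in> {-1..1}" by auto
      then have "ennreal (japanese s powr e) \<le> indicator {-1..1} s"
        using ennreal_leI[OF le1] by simp
      then show ?thesis by (simp add: add_increasing2)
    next
      case False
      then have "ennreal (japanese s powr e) \<le> ennreal (\<bar>s\<bar> powr e)"
        using le2 by (intro ennreal_leI) auto
      with False show ?thesis by (cases "s \<ge> 0") auto
    qed
  qed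
  also have "\<dots> < \<infinity>"
    by (subst nn_integral_add, simp, simp, subst nn_integral_add, simp, simp) (use tail tail' in auto)
  finally show ?thesis by (simp add: e_def)
qed

abbreviation cauchy :: "real \<Rightarrow> real" where
  "cauchy x \<equiv> 1 / (1 + x\<^sup>2)"

lemma integrable_Cauchy_density: "integrable lborel (\<lambda>x::real. cauchy x)"
proof (rule integrableI_bounded)
  have "norm (cauchy x) = japanese x powr (- 2 * 1)" for x :: real
    by (simp add: japanese_powr powr_minus divide_simps)
  then show "(\<integral>\<^sup>+x. ennreal (norm (cauchy x)) \<partial>(lborel :: real measure)) < \<infinity>"
    using japanese_nn_integral_finite[of 1] by simp
qed simp

text \<open>A class of functions that contains the Schwartz functions, is closed under differences, and in
  which the functions and their slices are integrable.\<close>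

definition biquadratic_decay :: "(real \<times> real \<Rightarrow> complex) \<Rightarrow> bool" where
  "biquadratic_decay f \<longleftrightarrow> f \<in> borel_measurable borel \<and>
     (\<exists>C. \<forall>x t. norm (f (x, t)) \<le> C * (cauchy x) * (cauchy t))"

lemma biquadratic_decay_measurable: "biquadratic_decay f \<Longrightarrow> f \<in> borel_measurable borel"
  unfolding biquadratic_decay_def by simp

lemma biquadratic_decay_E:
  assumes "biquadratic_decay f"
  obtains C where "C \<ge> 0" "\<And>x t. norm (f (x, t)) \<le> C * (cauchy x) * (cauchy t)"
proof -
  from assms obtain C where C: "\<And>x t. norm (f (x, t)) \<le> C * (cauchy x) * (cauchy t)"
    unfolding biquadratic_decay_def by blast
  have "C \<ge> 0" using order_trans[OF norm_ge_zero C[of 0 0]] by simp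
  with C that show thesis by blast
qed

lemma biquadratic_decay_integrable:
  assumes f: "biquadratic_decay f"
  shows "integrable lborel f"
proof -
  obtain C where C: "C \<ge> 0" "\<And>x t. norm (f (x, t)) \<le> C * (cauchy x) * (cauchy t)"
    using biquadratic_decay_E[OF f] by metis
  have i: "integrable lborel (\<lambda>x::real. complex_of_real (cauchy x))"
    by (rule integrable_of_real[OF integrable_Cauchy_density])
  show ?thesis
  proof (rule integrable_dominated)
    show "integrable lborel (\<lambda>p. complex_of_real C * (complex_of_real (cauchy (fst p)) * complex_of_real (cauchy (snd p))))"
      by (intro integrable_mult_right integrable_pair_mult(1) i)
    show "AE p in lborel. norm (f p) \<le> norm (complex_of_real C * (complex_of_real (cauchy (fst p)) * complex_of_real (cauchy (snd p))))"
    proof (rule AE_I2)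
      fix p :: "real \<times> real"
      have "0 \<le> cauchy (fst p)" "0 \<le> cauchy (snd p)" by auto
      then show "norm (f p) \<le> norm (complex_of_real C * (complex_of_real (cauchy (fst p)) * complex_of_real (cauchy (snd p))))"
        using C(1) C(2)[of "fst p" "snd p"] unfolding norm_mult norm_of_real by simp
    qed
  qed (use biquadratic_decay_measurable[OF f] in simp)
qed

lemma inverse_1_plus_square_le_1: "1 / (1 + (x::real)\<^sup>2) \<le> 1"
  by (subst divide_le_eq_1_pos) (auto simp: add_pos_nonneg)

lemma biquadratic_decay_bounded:
  assumes "biquadratic_decay f"
  obtains B where "\<And>p. norm (f p) \<le> B"
proof -
  obtain C where C: "C \<ge> 0" "\<And>x t. norm (f (x, t)) \<le> C * (cauchy x) * (cauchy t)"
    using biquadratic_decay_E[OF assms] by metis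
  have "norm (f p) \<le> C * 1 * 1" for p
  proof -
    have "C * (cauchy (fst p)) * (cauchy (snd p)) \<le> C * 1 * 1"
      using C(1) by (intro mult_mono mult_left_mono inverse_1_plus_square_le_1) auto
    with C(2)[of "fst p" "snd p"] show ?thesis by simp
  qed
  then show thesis by (rule that)
qed

lemma biquadratic_decay_energy:
  assumes f: "biquadratic_decay f"
  shows "sq_norm f < \<infinity>"
  using biquadratic_decay_bounded[OF f] energy_bounded_integrable[OF biquadratic_decay_integrable[OF f]] by metis

lemma biquadratic_decay_diff:
  assumes f: "biquadratic_decay f" and g: "biquadratic_decay g"
  shows "biquadratic_decay (\<lambda>p. f p - g p)"
proof -
  obtain C where C: "C \<ge> 0" "\<And>x t. norm (f (x, t)) \<le> C * (cauchy x) * (cauchy t)"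
    using biquadratic_decay_E[OF f] by metis
  obtain D where D: "D \<ge> 0" "\<And>x t. norm (g (x, t)) \<le> D * (cauchy x) * (cauchy t)"
    using biquadratic_decay_E[OF g] by metis
  have "norm (f (x, t) - g (x, t)) \<le> (C + D) * (cauchy x) * (cauchy t)" for x t
    unfolding distrib_right by (rule order_trans[OF norm_triangle_ineq4 add_mono[OF C(2) D(2)]])
  then show ?thesis
    using f g unfolding biquadratic_decay_def by auto
qed

lemma schwartz_dir_deriv:
  assumes "schwartz \<phi>" "e \<in> Basis"
  shows "schwartz (dir_deriv e \<phi>)"
  unfolding schwartz_def
proof (intro ballI)
  fix es :: "'a list" assume "es \<in> lists Basis"
  then have "es @ [e] \<in> lists Basis" using assms(2) by auto
  moreover have "foldr dir_deriv es (dir_deriv e \<phi>) = foldr dir_deriv (es @ [e]) \<phi>" by simp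
  ultimately show "(\<forall>p. foldr dir_deriv es (dir_deriv e \<phi>) differentiable (at p)) \<and>
     (\<forall>k::nat. \<exists>C. \<forall>p. norm p ^ k * norm (foldr dir_deriv es (dir_deriv e \<phi>) p) \<le> C)"
    using assms(1) unfolding schwartz_def by (metis (no_types, lifting))
qed

lemma schwartz_differentiable: "schwartz \<phi> \<Longrightarrow> \<phi> differentiable (at p)"
  unfolding schwartz_def by (metis foldr.simps(1) id_apply lists.Nil)

lemma schwartz_continuous: "schwartz \<phi> \<Longrightarrow> continuous_on UNIV \<phi>"
  by (intro continuous_at_imp_continuous_on ballI differentiable_imp_continuous_within schwartz_differentiable)

lemma schwartz_decay: "schwartz \<phi> \<Longrightarrow> \<exists>C. \<forall>p. norm p ^ k * norm (\<phi> p) \<le> C"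
  unfolding schwartz_def by (metis foldr.simps(1) id_apply lists.Nil)

lemma schwartz_biquadratic_decay:
  assumes "schwartz \<phi>"
  shows "biquadratic_decay \<phi>"
proof -
  obtain C0 where C0: "\<And>p. norm p ^ 0 * norm (\<phi> p) \<le> C0" using schwartz_decay[OF assms] by blast
  obtain C4 where C4: "\<And>p. norm p ^ 4 * norm (\<phi> p) \<le> C4" using schwartz_decay[OF assms] by blast
  have "norm (\<phi> (x, t)) \<le> (2 * C0 + 2 * C4) * (cauchy x) * (cauchy t)" for x t
  proof -
    have n2: "(norm (x, t))\<^sup>2 = x\<^sup>2 + t\<^sup>2" by (simp add: norm_Pair)
    have n4: "norm (x, t) ^ 4 = (x\<^sup>2 + t\<^sup>2)\<^sup>2" unfolding n2[symmetric] by (simp add: power_even_eq[symmetric] power2_eq_square numeral_eq_Suc)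
    have "(1 + x\<^sup>2) * (1 + t\<^sup>2) \<le> 2 + 2 * (x\<^sup>2 + t\<^sup>2)\<^sup>2"
    proof -
      define S where "S = x\<^sup>2 + t\<^sup>2"
      have "x\<^sup>2 * t\<^sup>2 \<le> S\<^sup>2" "0 \<le> S\<^sup>2" unfolding S_def by (simp_all add: power2_sum)
      moreover have "0 \<le> (S - 1)\<^sup>2" by simp
      moreover have "(S - 1)\<^sup>2 = S\<^sup>2 - 2 * S + 1" by (simp add: power2_diff)
      moreover have "(1 + x\<^sup>2) * (1 + t\<^sup>2) = 1 + S + x\<^sup>2 * t\<^sup>2" by (simp add: S_def algebra_simps)
      ultimately show ?thesis unfolding S_def[symmetric] by linarith
    qed
    then have "(1 + x\<^sup>2) * (1 + t\<^sup>2) * norm (\<phi> (x, t)) \<le> (2 + 2 * (x\<^sup>2 + t\<^sup>2)\<^sup>2) * norm (\<phi> (x, t))"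
      by (intro mult_right_mono) auto
    also have "\<dots> \<le> 2 * C0 + 2 * C4"
      using C0[of "(x, t)"] C4[of "(x, t)"] unfolding n4 by (simp add: algebra_simps)
    finally have "norm (\<phi> (x, t)) \<le> (2 * C0 + 2 * C4) / ((1 + x\<^sup>2) * (1 + t\<^sup>2))"
      by (subst pos_le_divide_eq) (auto simp: mult_ac add_pos_nonneg)
    then show ?thesis by simp
  qed
  then show ?thesis
    unfolding biquadratic_decay_def
    using borel_measurable_continuous_onI[OF schwartz_continuous[OF assms]] by blast
qed

lemmas schwartz_integrable = biquadratic_decay_integrable[OF schwartz_biquadratic_decay]
lemmas schwartz_measurable = biquadratic_decay_measurable[OF schwartz_biquadratic_decay]
lemmas schwartz_energy = biquadratic_decay_energy[OF schwartz_biquadratic_decay]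

text \<open>By translation invariance the integral of \<open>h (p + e) - h p\<close> vanishes. By the fundamental theorem
  of calculus and Fubini it is also the integral of \<open>k\<close>. This replaces integration by parts.\<close>

lemma integral_line_derivative_eq_0:
  fixes h k :: "'a::euclidean_space \<Rightarrow> complex"
  assumes h: "integrable lborel h" and k: "integrable lborel k" and cont: "continuous_on UNIV k"
    and deriv: "\<And>p s. ((\<lambda>s. h (p + s *\<^sub>R e)) has_vector_derivative k (p + s *\<^sub>R e)) (at s)"
  shows "(LINT p|lborel. k p) = 0"
proof -
  have [measurable]: "k \<in> borel_measurable borel" using k by auto
  let ?f = "\<lambda>(s::real) p. indicator {0..1} s *\<^sub>R k (p + s *\<^sub>R e)"
  have ik: "integrable lborel (\<lambda>p. k (p + s *\<^sub>R e))" for s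
    using integrable_lborel_affine[OF k, of 1 "s *\<^sub>R e"] by (simp add: add.commute)
  have tr: "(LINT p|lborel. g (p + s *\<^sub>R e)) = (LINT p|lborel. g p)" if "g \<in> borel_measurable borel" for s and g :: "'a \<Rightarrow> complex"
    using integral_lborel_affine[OF that, of 1 "s *\<^sub>R e"] by (simp add: add.commute)
  have trn: "(LINT p|lborel. norm (k (p + s *\<^sub>R e))) = (LINT p|lborel. norm (k p))" for s
  proof -
    have "complex_of_real (LINT p|lborel. norm (k (p + s *\<^sub>R e))) = complex_of_real (LINT p|lborel. norm (k p))"
      unfolding integral_complex_of_real[symmetric] by (rule tr[of "\<lambda>p. complex_of_real (norm (k p))"]) simp
    then show ?thesis by simp
  qed
  have i1: "integrable lborel (\<lambda>s::real. indicator {0..1} s * c)" for c :: real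
    by (intro integrable_mult_left integrable_real_indicator) auto
  have "integrable (lborel \<Otimes>\<^sub>M lborel) (\<lambda>(s, p). ?f s p)"
  proof (rule lborel_pair.Fubini_integrable)
    show "integrable lborel (\<lambda>s. LINT p|lborel. norm (case (s, p) of (s, p) \<Rightarrow> ?f s p))"
      by (simp add: trn i1)
    show "AE s in lborel. integrable lborel (\<lambda>p. case (s, p) of (s, p) \<Rightarrow> ?f s p)"
      using ik by simp
  qed measurable
  from lborel_pair.Fubini_integral[OF this]
  have "(LINT p|lborel. LINT s|lborel. ?f s p) = (LINT s|lborel. indicator {0..1::real} s *\<^sub>R (LINT p|lborel. k p))"
    by (simp add: tr)
  then have "(LINT p|lborel. k p) = (LINT p|lborel. LINT s|lborel. ?f s p)" by simp
  also have "\<dots> = (LINT p|lborel. h (p + 1 *\<^sub>R e) - h (p + 0 *\<^sub>R e))"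
  proof (rule integral_eqI)
    fix p
    have "((\<lambda>s. h (p + s *\<^sub>R e)) has_vector_derivative k (p + x *\<^sub>R e)) (at x within {0..1})" for x
      by (rule has_vector_derivative_at_within[OF deriv])
    moreover have "continuous_on {0..1} (\<lambda>s. k (p + s *\<^sub>R e))"
      by (rule continuous_on_compose2[OF cont]) (auto intro!: continuous_intros)
    ultimately show "(LINT s|lborel. ?f s p) = h (p + 1 *\<^sub>R e) - h (p + 0 *\<^sub>R e)"
      using integral_FTC_Icc[of 0 1 "\<lambda>s. h (p + s *\<^sub>R e)" "\<lambda>s. k (p + s *\<^sub>R e)"] by simp
  qed
  also have "\<dots> = (LINT p|lborel. h (p + 1 *\<^sub>R e)) - (LINT p|lborel. h (p + 0 *\<^sub>R e))"
    using integrable_lborel_affine[OF h, of 1 e] h by (intro Bochner_Integration.integral_diff) (auto simp: add.commute)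
  also have "\<dots> = 0" using tr[of h 1] h by simp
  finally show ?thesis by simp
qed

lemma fourier_dir_deriv:
  fixes \<phi> :: "real \<times> real \<Rightarrow> complex"
  assumes \<phi>: "schwartz \<phi>" and e: "e \<in> Basis"
  shows "fourier (dir_deriv e \<phi>) \<xi> = \<i> * of_real (\<xi> \<bullet> e) * fourier \<phi> \<xi>"
proof -
  have i: "integrable lborel \<phi>" "integrable lborel (dir_deriv e \<phi>)"
    by (intro biquadratic_decay_integrable schwartz_biquadratic_decay schwartz_dir_deriv \<phi> e)+
  let ?k = "\<lambda>p. cis (- (p \<bullet> \<xi>)) * dir_deriv e \<phi> p - \<i> * of_real (\<xi> \<bullet> e) * (cis (- (p \<bullet> \<xi>)) * \<phi> p)"
  have "(LINT p|lborel. ?k p) = 0"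
  proof (rule integral_line_derivative_eq_0)
    show "integrable lborel (\<lambda>p. cis (- (p \<bullet> \<xi>)) * \<phi> p)"
      by (rule fourier_integrand_integrable[OF i(1)])
    show "integrable lborel ?k"
      by (intro Bochner_Integration.integrable_diff integrable_mult_right fourier_integrand_integrable i)
    show "continuous_on UNIV ?k"
      by (intro continuous_intros schwartz_continuous schwartz_dir_deriv \<phi> e)
    fix p s
    have "(\<phi> has_derivative frechet_derivative \<phi> (at (p + s *\<^sub>R e))) (at (p + s *\<^sub>R e))"
      using schwartz_differentiable[OF \<phi>] by (simp add: frechet_derivative_works)
    moreover have "((\<lambda>s. p + s *\<^sub>R e) has_derivative (\<lambda>h. h *\<^sub>R e)) (at s)"
      by (auto intro!: derivative_eq_intros)
    ultimately have "((\<lambda>s. \<phi> (p + s *\<^sub>R e)) has_derivative (\<lambda>h. frechet_derivative \<phi> (at (p + s *\<^sub>R e)) (h *\<^sub>R e))) (at s)"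
      by (rule has_derivative_compose[rotated])
    then have d: "((\<lambda>s. \<phi> (p + s *\<^sub>R e)) has_vector_derivative dir_deriv e \<phi> (p + s *\<^sub>R e)) (at s)"
      unfolding has_vector_derivative_def dir_deriv_def
      by (simp add: linear_frechet_derivative[OF schwartz_differentiable[OF \<phi>]] linear_scale)
    have c: "((\<lambda>s. cis (- ((p + s *\<^sub>R e) \<bullet> \<xi>))) has_vector_derivative - \<i> * of_real (\<xi> \<bullet> e) * cis (- ((p + s *\<^sub>R e) \<bullet> \<xi>))) (at s)"
      unfolding has_vector_derivative_def
      by (auto intro!: derivative_eq_intros simp: scaleR_conv_of_real inner_commute algebra_simps)
    show "((\<lambda>s. cis (- ((p + s *\<^sub>R e) \<bullet> \<xi>)) * \<phi> (p + s *\<^sub>R e)) has_vector_derivative ?k (p + s *\<^sub>R e)) (at s)"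
      by (rule has_vector_derivative_eq_rhs[OF has_vector_derivative_mult[OF c d]]) (simp add: algebra_simps)
  qed
  then show ?thesis
    unfolding fourier_def
    by (subst (asm) Bochner_Integration.integral_diff) (auto intro!: integrable_mult_right fourier_integrand_integrable i)
qed

lemma fourier_schwartz_monomial_bound:
  assumes "schwartz \<phi>"
  shows "\<exists>C. \<forall>p. \<bar>fst p\<bar> ^ j * \<bar>snd p\<bar> ^ k * norm (fourier \<phi> p) \<le> C"
  using assms
proof (induction j arbitrary: \<phi>)
  case 0
  then show ?case
  proof (induction k arbitrary: \<phi>)
    case 0
    then show ?case using norm_fourier_le[of \<phi>] by auto
  next
    case (Suc k)
    have b: "(0, 1) \<in> (Basis :: (real \<times> real) set)" by (simp add: Basis_prod_def)
    from Suc.IH[OF schwartz_dir_deriv[OF Suc.prems b]] show ?case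
      by (simp add: fourier_dir_deriv[OF Suc.prems b] norm_mult mult_ac)
  qed
next
  case (Suc j)
  have b: "(1, 0) \<in> (Basis :: (real \<times> real) set)" by (simp add: Basis_prod_def)
  from Suc.IH[OF schwartz_dir_deriv[OF Suc.prems b]] show ?case
    by (simp add: fourier_dir_deriv[OF Suc.prems b] norm_mult mult_ac)
qed

lemma fourier_schwartz_decay:
  assumes "schwartz \<phi>"
  shows "\<exists>C. \<forall>p. (1 + (fst p)\<^sup>2) ^ j * (1 + (snd p)\<^sup>2) ^ k * norm (fourier \<phi> p) \<le> C"
proof -
  have pw: "(1 + x\<^sup>2) ^ n \<le> 2 ^ n * (1 + \<bar>x\<bar> ^ (2 * n))" for x :: real and n
  proof (cases "\<bar>x\<bar> \<le> 1")
    case True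
    then have "x\<^sup>2 \<le> 1" by (simp add: abs_square_le_1)
    then have "(1 + x\<^sup>2) ^ n \<le> 2 ^ n" by (intro power_mono) auto
    also have "\<dots> \<le> 2 ^ n * (1 + \<bar>x\<bar> ^ (2 * n))" by simp
    finally show ?thesis .
  next
    case False
    then have "1 \<le> x\<^sup>2" using one_le_power[of "\<bar>x\<bar>" 2] by simp
    then have "(1 + x\<^sup>2) ^ n \<le> (2 * x\<^sup>2) ^ n" by (intro power_mono) auto
    also have "\<dots> \<le> 2 ^ n * (1 + \<bar>x\<bar> ^ (2 * n))" by (simp add: power_mult_distrib power_mult)
    finally show ?thesis .
  qed
  obtain C where C: "\<And>i l p. \<bar>fst p\<bar> ^ i * \<bar>snd p\<bar> ^ l * norm (fourier \<phi> p) \<le> C i l"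
    using fourier_schwartz_monomial_bound[OF assms] by metis
  show ?thesis
  proof (intro exI allI)
    fix p :: "real \<times> real"
    let ?x = "\<bar>fst p\<bar> ^ (2 * j)" and ?y = "\<bar>snd p\<bar> ^ (2 * k)" and ?n = "norm (fourier \<phi> p)"
    have "(1 + (fst p)\<^sup>2) ^ j * (1 + (snd p)\<^sup>2) ^ k * ?n \<le> (2 ^ j * (1 + ?x)) * (2 ^ k * (1 + ?y)) * ?n"
      by (intro mult_right_mono mult_mono pw) auto
    also have "\<dots> = 2 ^ j * 2 ^ k * (?n + ?x * ?n + ?y * ?n + ?x * ?y * ?n)"
      by (simp add: algebra_simps)
    also have "\<dots> \<le> 2 ^ j * 2 ^ k * (C 0 0 + C (2*j) 0 + C 0 (2*k) + C (2*j) (2*k))"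
      using C[where p=p and i=0 and l=0] C[where p=p and i="2*j" and l=0] C[where p=p and i=0 and l="2*k"] C[where p=p and i="2*j" and l="2*k"]
      by (intro mult_left_mono add_mono) auto
    finally show "(1 + (fst p)\<^sup>2) ^ j * (1 + (snd p)\<^sup>2) ^ k * ?n \<le> 2 ^ j * 2 ^ k * (C 0 0 + C (2*j) 0 + C 0 (2*k) + C (2*j) (2*k))" .
  qed
qed

text \<open>Transforms of Schwartz functions absorb every polynomial weight. In particular the weighted norms
  of Schwartz functions are finite, so that smallness of \<open>L2_norm\<close> in the definition of the
  completion is not vacuous.\<close>

lemma multiplier_fourier_schwartz_decay:
  assumes \<phi>: "schwartz \<phi>" and m: "m \<in> borel_measurable borel"
    and bd: "\<And>p. norm (m p) \<le> A * (1 + (fst p)\<^sup>2) ^ j * (1 + (snd p)\<^sup>2) ^ k"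
  shows "biquadratic_decay (\<lambda>p. m p * fourier \<phi> p)"
proof -
  have [measurable]: "\<phi> \<in> borel_measurable borel"
    using \<phi> schwartz_biquadratic_decay biquadratic_decay_measurable by blast
  have A: "A \<ge> 0" using bd[of "(0,0)"] by (simp add: order_trans[OF norm_ge_zero])
  obtain C where C: "\<And>p. (1 + (fst p)\<^sup>2) ^ Suc j * (1 + (snd p)\<^sup>2) ^ Suc k * norm (fourier \<phi> p) \<le> C"
    using fourier_schwartz_decay[OF \<phi>] by blast
  have "norm (m (x, t) * fourier \<phi> (x, t)) \<le> (A * C) * (cauchy x) * (cauchy t)" for x t
  proof -
    have pos: "0 < (1 + x\<^sup>2) * (1 + t\<^sup>2)" by (intro mult_pos_pos) (auto simp: add_pos_nonneg)
    have "norm (m (x, t) * fourier \<phi> (x, t)) * ((1 + x\<^sup>2) * (1 + t\<^sup>2)) \<le>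
       (A * (1 + x\<^sup>2) ^ j * (1 + t\<^sup>2) ^ k * norm (fourier \<phi> (x, t))) * ((1 + x\<^sup>2) * (1 + t\<^sup>2))"
      unfolding norm_mult using bd[of "(x, t)"] pos by (intro mult_right_mono) auto
    also have "\<dots> = A * ((1 + x\<^sup>2) ^ Suc j * (1 + t\<^sup>2) ^ Suc k * norm (fourier \<phi> (x, t)))"
      by (simp add: mult_ac)
    also have "\<dots> \<le> A * C" using C[of "(x, t)"] A by (intro mult_left_mono) auto
    finally have "norm (m (x, t) * fourier \<phi> (x, t)) \<le> A * C / ((1 + x\<^sup>2) * (1 + t\<^sup>2))"
      using pos by (subst pos_le_divide_eq)
    then show ?thesis by simp
  qed
  then show ?thesis unfolding biquadratic_decay_def using m by auto
qed

section \<open>The Fourier transform of square-integrable functions\<close>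

lemma energy_lborel_prod:
  assumes [measurable]: "f \<in> borel_measurable borel"
  shows "sq_norm f = (\<integral>\<^sup>+x. sq_norm (\<lambda>y. f (x :: real, y :: real)) \<partial>lborel)"
    and "sq_norm f = (\<integral>\<^sup>+y. sq_norm (\<lambda>x. f (x, y)) \<partial>lborel)"
proof -
  show "sq_norm f = (\<integral>\<^sup>+x. sq_norm (\<lambda>y. f (x, y)) \<partial>lborel)"
    unfolding energy_def lborel_prod[symmetric] by (rule lborel.nn_integral_fst[symmetric]) (simp add: lborel_prod)
  show "sq_norm f = (\<integral>\<^sup>+y. sq_norm (\<lambda>x. f (x, y)) \<partial>lborel)"
    unfolding energy_def lborel_prod[symmetric] by (rule lborel_pair.nn_integral_snd[symmetric]) (simp add: lborel_prod)
qed

lemma fourier_x_measurable[measurable (raw)]: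
  assumes [measurable]: "f \<in> borel_measurable borel"
  shows "fourier_x f \<in> borel_measurable borel"
  unfolding fourier_x_def fourier_def split_beta' by measurable

lemma fourier_eq_iterated:
  fixes f :: "real \<times> real \<Rightarrow> complex"
  assumes f: "integrable lborel f"
  shows "integrable lborel (\<lambda>t. fourier_x f (\<xi>, t))"
    and "fourier f (\<xi>, \<tau>) = fourier (\<lambda>t. fourier_x f (\<xi>, t)) \<tau>"
proof -
  have [measurable]: "f \<in> borel_measurable borel" using f by auto
  have int: "integrable (lborel \<Otimes>\<^sub>M lborel) (\<lambda>(x, t). cis (- (x * \<xi>)) * f (x, t))"
    unfolding lborel_prod by (rule integrable_dominated[OF f]) (auto simp: norm_mult split_beta')
  from lborel_pair.integrable_snd[OF int]
  show "integrable lborel (\<lambda>t. fourier_x f (\<xi>, t))"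
    by (simp add: fourier_x_def fourier_def)
  have int2: "integrable (lborel \<Otimes>\<^sub>M lborel) (\<lambda>(x, t). cis (- ((x, t) \<bullet> (\<xi>, \<tau>))) * f (x, t))"
  proof -
    have "(\<lambda>(x, t). cis (- ((x, t) \<bullet> (\<xi>, \<tau>))) * f (x, t)) = (\<lambda>p. cis (- (p \<bullet> (\<xi>, \<tau>))) * f p)"
      by (auto simp: fun_eq_iff)
    then show ?thesis unfolding lborel_prod using fourier_integrand_integrable[OF f] by simp
  qed
  have "fourier f (\<xi>, \<tau>) = (LINT t|lborel. LINT x|lborel. cis (- ((x, t) \<bullet> (\<xi>, \<tau>))) * f (x, t))"
    unfolding fourier_def lborel_pair.integral_snd[OF int2] lborel_prod by (simp add: split_beta' inner_prod_def)
  also have "\<dots> = (LINT t|lborel. LINT x|lborel. cis (- (t * \<tau>)) * (cis (- (x * \<xi>)) * f (x, t)))"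
    by (simp add: cis_mult mult.assoc[symmetric] add.commute)
  also have "\<dots> = fourier (\<lambda>t. fourier_x f (\<xi>, t)) \<tau>"
    by (simp add: fourier_x_def fourier_def)
  finally show "fourier f (\<xi>, \<tau>) = fourier (\<lambda>t. fourier_x f (\<xi>, t)) \<tau>" .
qed

lemma biquadratic_decay_slice:
  assumes f: "biquadratic_decay f"
  shows "integrable lborel (\<lambda>x. f (x, t))"
proof -
  have [measurable]: "f \<in> borel_measurable borel" using biquadratic_decay_measurable[OF f] .
  obtain C where C: "C \<ge> 0" "\<And>x t. norm (f (x, t)) \<le> C * (cauchy x) * (cauchy t)"
    using biquadratic_decay_E[OF f] by metis
  show ?thesis
  proof (rule integrable_dominated)
    show "integrable lborel (\<lambda>x. C * (cauchy x))"
      by (intro integrable_mult_right integrable_Cauchy_density)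
    show "AE x in lborel. norm (f (x, t)) \<le> norm (C * (cauchy x))"
    proof (rule AE_I2)
      fix x :: real
      have "C * (cauchy x) * (cauchy t) \<le> C * (cauchy x) * 1"
        using C(1) by (intro mult_left_mono inverse_1_plus_square_le_1) auto
      with C(2)[of x t] show "norm (f (x, t)) \<le> norm (C * (cauchy x))"
        using C(1) by simp
    qed
  qed simp
qed

lemma fourier_x_diff:
  assumes "biquadratic_decay f" "biquadratic_decay g"
  shows "fourier_x (\<lambda>p. f p - g p) q = fourier_x f q - fourier_x g q"
  unfolding fourier_x_def by (simp add: split_beta' fourier_diff[OF assms[THEN biquadratic_decay_slice]])

lemma energy_fourier_x_le:
  assumes f: "biquadratic_decay f"
  shows "sq_norm (fourier_x f) \<le> ennreal (2 * pi) * sq_norm f"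
proof -
  have [measurable]: "f \<in> borel_measurable borel" using biquadratic_decay_measurable[OF f] .
  have m: "fourier_x f \<in> borel_measurable borel" by measurable
  have "sq_norm (fourier_x f) = (\<integral>\<^sup>+t. sq_norm (fourier (\<lambda>x. f (x, t))) \<partial>lborel)"
    unfolding energy_lborel_prod(2)[OF m] by (simp add: fourier_x_def)
  also have "\<dots> \<le> (\<integral>\<^sup>+t. ennreal (2 * pi) * sq_norm (\<lambda>x. f (x, t)) \<partial>lborel)"
    using Plancherel_le[OF biquadratic_decay_slice[OF f]] by (intro nn_integral_mono) simp
  also have "\<dots> = ennreal (2 * pi) * (\<integral>\<^sup>+t. sq_norm (\<lambda>x. f (x, t)) \<partial>lborel)"
    unfolding energy_def by (rule nn_integral_cmult) measurable
  finally show ?thesis by (simp add: energy_lborel_prod(2)[of f])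
qed

text \<open>Plancherel in the time variable alone, which leaves the spatial frequency fixed. Hence the
  frequency support of the partial transform controls that of the full transform.\<close>

lemma energy_fourier_le_fourier_x:
  fixes f :: "real \<times> real \<Rightarrow> complex"
  assumes f: "integrable lborel f" and S: "S \<in> sets borel"
  shows "sq_norm (\<lambda>p. indicator S (fst p) * fourier f p)
    \<le> ennreal (2 * pi) * sq_norm (\<lambda>p. indicator S (fst p) * fourier_x f p)"
proof -
  let ?e = "\<lambda>\<xi>. sq_norm (\<lambda>t. fourier_x f (\<xi>, t))" and ?e' = "\<lambda>\<xi>. sq_norm (fourier (\<lambda>t. fourier_x f (\<xi>, t)))"
  have [measurable]: "f \<in> borel_measurable borel" using f by auto
  note [measurable] = S
  have m: "(\<lambda>p. indicator S (fst p) * fourier f p) \<in> borel_measurable borel"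
    "(\<lambda>p. indicator S (fst p) * fourier_x f p) \<in> borel_measurable borel" by measurable
  have [measurable]: "fourier_x f \<in> borel_measurable (borel \<Otimes>\<^sub>M borel)"
    unfolding borel_prod by measurable
  have i: "sq_norm (\<lambda>y. indicator S x * g y) = indicator S x * sq_norm g" for x and g :: "real \<Rightarrow> complex"
    by (simp add: energy_def split: split_indicator)
  have "sq_norm (\<lambda>p. indicator S (fst p) * fourier f p) = (\<integral>\<^sup>+\<xi>. indicator S \<xi> * ?e' \<xi> \<partial>lborel)"
    unfolding energy_lborel_prod(1)[OF m(1)] by (simp add: i fourier_eq_iterated(2)[OF f])
  also have "\<dots> \<le> (\<integral>\<^sup>+\<xi>. ennreal (2 * pi) * (indicator S \<xi> * ?e \<xi>) \<partial>lborel)"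
  proof (rule nn_integral_mono)
    fix \<xi> :: real
    have "indicator S \<xi> * ?e' \<xi> \<le> indicator S \<xi> * (ennreal (2 * pi) * ?e \<xi>)"
      using Plancherel_le[OF fourier_eq_iterated(1)[OF f, of \<xi>]] by (intro mult_left_mono) auto
    then show "indicator S \<xi> * ?e' \<xi> \<le> ennreal (2 * pi) * (indicator S \<xi> * ?e \<xi>)"
      by (simp only: mult_ac)
  qed
  also have "\<dots> = ennreal (2 * pi) * (\<integral>\<^sup>+\<xi>. (indicator S \<xi> * ?e \<xi>) \<partial>lborel)"
    unfolding energy_def by (rule nn_integral_cmult) measurable
  also have "(\<integral>\<^sup>+\<xi>. (indicator S \<xi> * ?e \<xi>) \<partial>lborel) = sq_norm (\<lambda>p. indicator S (fst p) * fourier_x f p)"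
    unfolding energy_lborel_prod(1)[OF m(2)] by (simp add: i)
  finally show ?thesis .
qed

lemma ennreal_squeeze_0:
  fixes f g h :: "nat \<Rightarrow> ennreal"
  assumes "\<And>n. f n \<le> c * g n + d * h n" "c < \<infinity>" "d < \<infinity>" "g \<longlonglongrightarrow> 0" "h \<longlonglongrightarrow> 0"
  shows "f \<longlonglongrightarrow> 0"
proof (rule tendsto_sandwich[of "\<lambda>_. 0" f _ "\<lambda>n. c * g n + d * h n"])
  have "(\<lambda>n. c * g n + d * h n) \<longlonglongrightarrow> c * 0 + d * 0"
    using assms by (intro tendsto_add ennreal_tendsto_cmult) auto
  then show "(\<lambda>n. c * g n + d * h n) \<longlonglongrightarrow> 0" by simp
qed (use assms in auto)

text \<open>The extension by density does not depend on the approximating sequence: the transforms of two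
  sequences with the same limit differ by little. Completeness shows that the choice made in
  \<open>L2_ext\<close> is not void.\<close>

lemma L2_ext_tendsto:
  fixes u :: "real \<times> real \<Rightarrow> complex"
  assumes T: "\<And>\<phi>. schwartz \<phi> \<Longrightarrow> sq_integrable (T \<phi>)"
    and bd: "\<And>\<phi> \<psi>. schwartz \<phi> \<Longrightarrow> schwartz \<psi> \<Longrightarrow>
       sq_dist (T \<phi>) (T \<psi>) \<le> C * sq_dist \<phi> \<psi>" and C: "C < \<infinity>"
    and \<phi>: "\<And>n. schwartz (\<phi> n)" and lim: "L2_tendsto \<phi> u"
  shows "L2_tendsto (\<lambda>n. T (\<phi> n)) (L2_ext T u)"
proof -
  have [measurable]: "T \<psi> \<in> borel_measurable borel" if "schwartz \<psi>" for \<psi>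
    using T[OF that] by (auto simp: sq_integrable_iff)
  have [measurable]: "\<psi> \<in> borel_measurable borel" if "schwartz \<psi>" for \<psi> :: "real \<times> real \<Rightarrow> complex"
    using schwartz_measurable[OF that] .
  have u: "sq_integrable u" and um[measurable]: "u \<in> borel_measurable borel"
    using lim by (auto simp: L2_tendsto_iff sq_integrable_iff)
  have bd2: "sq_dist (T \<psi>1) (T \<psi>2) \<le> (C * 2) * sq_dist \<psi>1 u + (C * 2) * sq_dist \<psi>2 u"
    if s: "schwartz \<psi>1" "schwartz \<psi>2" for \<psi>1 \<psi>2
  proof -
    have "sq_dist (T \<psi>1) (T \<psi>2) \<le> C * sq_dist \<psi>1 \<psi>2" by (rule bd[OF s])
    also have "\<dots> \<le> C * (2 * sq_dist \<psi>1 u + 2 * sq_dist u \<psi>2)"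
      using s by (intro mult_left_mono energy_triangle) auto
    also have "\<dots> = (C * 2) * sq_dist \<psi>1 u + (C * 2) * sq_dist \<psi>2 u"
      by (simp add: distrib_left mult.assoc energy_minus_commute[of _ u])
    finally show ?thesis .
  qed
  have lim0: "(\<lambda>n. sq_dist (\<phi> n) u) \<longlonglongrightarrow> 0" using lim by (auto simp: L2_tendsto_iff)
  have C2: "C * 2 < \<infinity>" using C by (simp add: ennreal_mult_less_top)
  have "\<exists>U\<in>borel_measurable lborel. (\<lambda>n. sq_dist (T (\<phi> n)) U) \<longlonglongrightarrow> 0"
  proof (rule energy_complete)
    show "T (\<phi> n) \<in> borel_measurable lborel" for n using \<phi>[of n] by simp
    fix e :: ennreal assume "e > 0"
    then obtain e' where e': "0 < e'" "e' < e" using dense by blast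
    have "(\<lambda>n. (C * 2) * sq_dist (\<phi> n) u) \<longlonglongrightarrow> 0"
      by (rule ennreal_squeeze_0[OF _ C2 C2 lim0 lim0]) simp
    moreover have e2: "0 < e' / 2" using e' by (simp add: ennreal_zero_less_divide)
    ultimately have "\<forall>\<^sub>F n in sequentially. (C * 2) * sq_dist (\<phi> n) u < e' / 2"
      by (rule order_tendstoD(2))
    then obtain N where N: "\<And>n. n \<ge> N \<Longrightarrow> (C * 2) * sq_dist (\<phi> n) u < e' / 2"
      unfolding eventually_sequentially by blast
    have "sq_dist (T (\<phi> m)) (T (\<phi> n)) < e" if mn: "m \<ge> N" "n \<ge> N" for m n
    proof -
      have "sq_dist (T (\<phi> m)) (T (\<phi> n)) \<le> e' / 2 + e' / 2"
        by (rule order_trans[OF bd2[OF \<phi> \<phi>] add_mono[OF less_imp_le[OF N[OF mn(1)]] less_imp_le[OF N[OF mn(2)]]]])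
      also have "\<dots> = e'" by (simp add: mult_2[symmetric] ennreal_times_divide) (simp add: mult.commute ennreal_mult_divide_eq)
      finally show ?thesis using e' by simp
    qed
    then show "\<exists>N. \<forall>m\<ge>N. \<forall>n\<ge>N. sq_dist (T (\<phi> m)) (T (\<phi> n)) < e" by blast
  qed
  then obtain U where U[measurable]: "U \<in> borel_measurable borel" and limU: "(\<lambda>n. sq_dist (T (\<phi> n)) U) \<longlonglongrightarrow> 0"
    by auto
  have "sq_integrable U"
  proof -
    obtain n where n: "sq_dist (T (\<phi> n)) U < 1"
      using order_tendstoD(2)[OF limU, of 1] by (auto simp: eventually_sequentially)
    have "sq_norm (\<lambda>x. U x - 0) \<le> 2 * sq_dist U (T (\<phi> n)) + 2 * sq_norm (\<lambda>x. T (\<phi> n) x - 0)"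
      using \<phi>[of n] by (intro energy_triangle) auto
    also have "\<dots> < \<infinity>"
      using n T[OF \<phi>, of n] less_trans[OF n, of \<infinity>]
      by (auto simp: sq_integrable_iff energy_minus_commute[of _ U] ennreal_mult_less_top)
    finally show ?thesis by (simp add: sq_integrable_iff)
  qed
  then have "\<exists>U \<phi>. (\<forall>n. schwartz (\<phi> n)) \<and> L2_tendsto \<phi> u \<and> L2_tendsto (\<lambda>n. T (\<phi> n)) U"
    using \<phi> lim limU T[OF \<phi>] by (intro exI[of _ U] exI[of _ \<phi>]) (auto simp: L2_tendsto_iff)
  from someI_ex[OF this] obtain \<psi> where \<psi>: "\<And>n. schwartz (\<psi> n)" "L2_tendsto \<psi> u" "L2_tendsto (\<lambda>n. T (\<psi> n)) (L2_ext T u)"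
    unfolding L2_ext_def by blast
  have Lm: "L2_ext T u \<in> borel_measurable borel" and Ls: "sq_integrable (L2_ext T u)"
    using \<psi>(3) by (auto simp: L2_tendsto_iff sq_integrable_iff)
  have l1: "(\<lambda>n. sq_dist (T (\<phi> n)) (T (\<psi> n))) \<longlonglongrightarrow> 0"
    by (rule ennreal_squeeze_0[OF bd2[OF \<phi> \<psi>(1)] C2 C2 lim0]) (use \<psi>(2) in \<open>auto simp: L2_tendsto_iff\<close>)
  have l2: "(\<lambda>n. sq_dist (T (\<psi> n)) (L2_ext T u)) \<longlonglongrightarrow> 0"
    using \<psi>(3) by (auto simp: L2_tendsto_iff)
  have tri: "sq_dist (T (\<phi> n)) (L2_ext T u) \<le> 2 * sq_dist (T (\<phi> n)) (T (\<psi> n)) + 2 * sq_dist (T (\<psi> n)) (L2_ext T u)" for n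
    using \<phi>[of n] \<psi>(1)[of n] Lm by (intro energy_triangle) auto
  have "(\<lambda>n. sq_dist (T (\<phi> n)) (L2_ext T u)) \<longlonglongrightarrow> 0"
    by (rule ennreal_squeeze_0[OF tri _ _ l1 l2]) simp_all
  then show ?thesis using T[OF \<phi>] Ls by (auto simp: L2_tendsto_iff)
qed

lemma fourier_diff_energy_le:
  assumes "schwartz \<phi>" "schwartz \<psi>"
  shows "sq_dist (fourier \<phi>) (fourier \<psi>) \<le> ennreal ((2 * pi)\<^sup>2) * sq_norm (\<lambda>p. \<phi> p - (\<psi> :: real \<times> real \<Rightarrow> complex) p)"
proof -
  note bd = assms[THEN schwartz_biquadratic_decay]
  have "fourier (\<lambda>p. \<phi> p - \<psi> p) = (\<lambda>p. fourier \<phi> p - fourier \<psi> p)"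
    by (simp add: fun_eq_iff fourier_diff bd[THEN biquadratic_decay_integrable])
  then show ?thesis
    using Plancherel_le_plane[OF biquadratic_decay_integrable[OF biquadratic_decay_diff[OF bd]]] by simp
qed

lemma fourier_x_diff_energy_le:
  assumes "schwartz \<phi>" "schwartz \<psi>"
  shows "sq_dist (fourier_x \<phi>) (fourier_x \<psi>) \<le> ennreal (2 * pi) * sq_dist \<phi> \<psi>"
proof -
  note bd = assms[THEN schwartz_biquadratic_decay]
  have "fourier_x (\<lambda>p. \<phi> p - \<psi> p) = (\<lambda>p. fourier_x \<phi> p - fourier_x \<psi> p)"
    using fourier_x_diff[OF bd] by (simp add: fun_eq_iff)
  then show ?thesis using energy_fourier_x_le[OF biquadratic_decay_diff[OF bd]] by simp
qed

lemma fourier_schwartz_sq_integrable: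
  assumes "schwartz \<phi>" shows "sq_integrable (fourier (\<phi> :: real \<times> real \<Rightarrow> complex))"
proof -
  note bd = schwartz_biquadratic_decay[OF assms]
  have "sq_norm (fourier \<phi>) < \<infinity>"
    by (rule le_less_trans[OF Plancherel_le[OF biquadratic_decay_integrable[OF bd]]])
       (use biquadratic_decay_energy[OF bd] in \<open>simp add: ennreal_mult_less_top\<close>)
  then show ?thesis using biquadratic_decay_measurable[OF bd] by (simp add: sq_integrable_iff)
qed

lemma fourier_x_schwartz_sq_integrable:
  assumes "schwartz \<phi>" shows "sq_integrable (fourier_x \<phi>)"
proof -
  note bd = schwartz_biquadratic_decay[OF assms]
  have "sq_norm (fourier_x \<phi>) < \<infinity>"
    by (rule le_less_trans[OF energy_fourier_x_le[OF bd]])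
       (use biquadratic_decay_energy[OF bd] in \<open>simp add: ennreal_mult_less_top\<close>)
  then show ?thesis using biquadratic_decay_measurable[OF bd] by (simp add: sq_integrable_iff)
qed

lemma L2_fourier_tendsto:
  assumes "\<And>n. schwartz (\<phi> n)" "L2_tendsto \<phi> (u :: real \<times> real \<Rightarrow> complex)"
  shows "L2_tendsto (\<lambda>n. fourier (\<phi> n)) (L2_ext fourier u)"
  by (rule L2_ext_tendsto[where T=fourier, OF fourier_schwartz_sq_integrable fourier_diff_energy_le]) (use assms in auto)

lemma L2_fourier_x_tendsto:
  assumes "\<And>n. schwartz (\<phi> n)" "L2_tendsto \<phi> u"
  shows "L2_tendsto (\<lambda>n. fourier_x (\<phi> n)) (L2_ext fourier_x u)"
  by (rule L2_ext_tendsto[where T=fourier_x, OF fourier_x_schwartz_sq_integrable fourier_x_diff_energy_le]) (use assms in auto)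

text \<open>By Lindelof's theorem, countably many of the open null sets cover the complement of the support.\<close>

lemma AE_in_ess_support: "AE p in lborel. W p \<noteq> 0 \<longrightarrow> p \<in> ess_support W"
proof -
  define \<F> where "\<F> = {S. open S \<and> (AE q in lborel. q \<in> S \<longrightarrow> W q = 0)}"
  obtain \<F>' where F: "\<F>' \<subseteq> \<F>" "countable \<F>'" "\<Union>\<F>' = \<Union>\<F>"
    using Lindelof[of \<F>] unfolding \<F>_def by blast
  have "AE q in lborel. \<forall>S\<in>\<F>'. q \<in> S \<longrightarrow> W q = 0"
    using F(1,2) by (subst AE_ball_countable) (auto simp: \<F>_def)
  then show ?thesis
  proof eventually_elim
    case (elim q)
    have "- ess_support W = \<Union>\<F>" unfolding ess_support_def \<F>_def by blast
    then have "q \<in> ess_support W" if "q \<notin> \<Union>\<F>'" using that F(3) by auto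
    moreover have "W q = 0" if "q \<in> \<Union>\<F>'" using that elim by auto
    ultimately show ?case by auto
  qed
qed

text \<open>The support condition is stated for the partial transform; the estimates use it for the full one.\<close>

lemma AE_fourier_support:
  assumes \<phi>: "\<And>n. schwartz (\<phi> n)" and lim: "L2_tendsto \<phi> u"
  shows "AE p in lborel. L2_ext fourier u p \<noteq> 0 \<longrightarrow> fst p \<in> closure (x_frequencies u)"
proof -
  let ?U = "L2_ext fourier u" and ?W = "L2_ext fourier_x u"
  define S where "S = - closure (x_frequencies u)"
  have S[measurable]: "S \<in> sets borel" unfolding S_def by simp
  have [measurable]: "\<phi> n \<in> borel_measurable borel" for n
    using schwartz_measurable[OF \<phi>] .
  note U = L2_fourier_tendsto[OF \<phi> lim, unfolded L2_tendsto_iff]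
  note W = L2_fourier_x_tendsto[OF \<phi> lim, unfolded L2_tendsto_iff]
  have [measurable]: "?U \<in> borel_measurable borel" "?W \<in> borel_measurable borel"
    using U W by (auto simp: sq_integrable_iff)
  have W0: "AE p in lborel. indicator S (fst p) * ?W p = 0"
    using AE_in_ess_support[of ?W]
  proof eventually_elim
    case (elim p)
    have "fst p \<in> closure (x_frequencies u)" if "?W p \<noteq> 0"
    proof -
      from elim that have "p \<in> ess_support ?W" by simp
      then have "fst p \<in> x_frequencies u" unfolding x_frequencies_def by (rule imageI)
      then show ?thesis by (rule subsetD[OF closure_subset])
    qed
    then show ?case by (auto simp: S_def indicator_def)
  qed
  have ind: "sq_norm (\<lambda>p. indicator S (fst p) * f p) \<le> sq_norm f" for f :: "real \<times> real \<Rightarrow> complex"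
    by (intro energy_mono) (auto simp: norm_mult split: split_indicator)
  have bd: "sq_norm (\<lambda>p. indicator S (fst p) * ?U p) \<le>
     2 * sq_dist (fourier (\<phi> n)) ?U + (2 * ennreal (2 * pi)) * sq_dist (fourier_x (\<phi> n)) ?W" for n
  proof -
    have "sq_norm (\<lambda>p. indicator S (fst p) * ?U p - 0) \<le> 2 * sq_norm (\<lambda>p. indicator S (fst p) * ?U p - indicator S (fst p) * fourier (\<phi> n) p)
       + 2 * sq_norm (\<lambda>p. indicator S (fst p) * fourier (\<phi> n) p - 0)"
      by (rule energy_triangle) auto
    also have "sq_norm (\<lambda>p. indicator S (fst p) * ?U p - indicator S (fst p) * fourier (\<phi> n) p) \<le> sq_dist (fourier (\<phi> n)) ?U"
      unfolding right_diff_distrib[symmetric] energy_minus_commute[of _ "fourier (\<phi> n)"] by (rule ind)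
    also have "sq_norm (\<lambda>p. indicator S (fst p) * fourier (\<phi> n) p - 0) \<le> ennreal (2 * pi) * sq_norm (\<lambda>p. indicator S (fst p) * fourier_x (\<phi> n) p)"
      using energy_fourier_le_fourier_x[OF schwartz_integrable[OF \<phi>] S] by simp
    also have "sq_norm (\<lambda>p. indicator S (fst p) * fourier_x (\<phi> n) p) = sq_norm (\<lambda>p. indicator S (fst p) * (fourier_x (\<phi> n) p - ?W p))"
      by (rule energy_cong_AE) (use W0 in eventually_elim, simp add: right_diff_distrib)
    also have "\<dots> \<le> sq_dist (fourier_x (\<phi> n)) ?W" by (rule ind)
    finally show ?thesis by (simp add: mult.assoc mult_left_mono add_mono)
  qed
  have "(\<lambda>n::nat. sq_norm (\<lambda>p. indicator S (fst p) * ?U p)) \<longlonglongrightarrow> 0"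
    by (rule ennreal_squeeze_0[OF bd]) (use U W in \<open>auto simp: ennreal_mult_less_top\<close>)
  then have "sq_norm (\<lambda>p. indicator S (fst p) * ?U p) = 0"
    by (simp add: LIMSEQ_const_iff)
  then have "AE p in lborel. indicator S (fst p) * ?U p = 0"
    by (subst (asm) energy_zero_iff) auto
  then show ?thesis
    by eventually_elim (auto simp: S_def indicator_def)
qed

lemma weighted_measurable:
  assumes [measurable]: "\<sigma> \<in> borel_measurable borel" "U \<in> borel_measurable borel"
  shows "weighted \<sigma> b U \<in> borel_measurable borel"
  unfolding weighted_def by measurable

text \<open>The Cauchy condition bounds the weighted distance between the members of the sequence and one
  fixed member; Fatou's lemma carries the bound over to the limit.\<close>

lemma weighted_sq_integrable:
  assumes u: "u \<in> bourgain_space \<sigma> b"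
    and m[measurable]: "\<sigma> \<in> borel_measurable borel"
    and fin: "\<And>\<phi>. schwartz \<phi> \<Longrightarrow> sq_integrable (weighted \<sigma> b (fourier \<phi>))"
  shows "sq_integrable (weighted \<sigma> b (L2_ext fourier u))"
proof -
  let ?U = "L2_ext fourier u"
  from u obtain \<phi> where \<phi>: "\<And>n. schwartz (\<phi> n)" "L2_tendsto \<phi> u"
    and cauchy: "\<And>e. e > 0 \<Longrightarrow> \<exists>N. \<forall>m\<ge>N. \<forall>n\<ge>N. L2_norm (weighted \<sigma> b (fourier (\<lambda>p. \<phi> m p - \<phi> n p))) < e"
    unfolding bourgain_space_def by blast
  let ?W = "\<lambda>n. weighted \<sigma> b (fourier (\<phi> n))"
  have [measurable]: "\<phi> n \<in> borel_measurable borel" for n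
    using schwartz_measurable[OF \<phi>(1)] .
  note U = L2_fourier_tendsto[OF \<phi>, unfolded L2_tendsto_iff]
  have [measurable]: "?U \<in> borel_measurable borel"
    using U by (auto simp: sq_integrable_iff)
  obtain N where N: "\<And>n. n \<ge> N \<Longrightarrow> L2_norm (weighted \<sigma> b (fourier (\<lambda>p. \<phi> n p - \<phi> N p))) < 1"
    using cauchy[of 1] by auto
  have le1: "sq_dist (?W n) (?W N) \<le> 1" if "n \<ge> N" for n
  proof -
    have eq: "weighted \<sigma> b (fourier (\<lambda>p. \<phi> n p - \<phi> N p)) = (\<lambda>p. ?W n p - ?W N p)"
      by (simp add: fun_eq_iff weighted_def right_diff_distrib fourier_diff schwartz_integrable[OF \<phi>(1)])
    have "sq_integrable (\<lambda>p. ?W n p - ?W N p)"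
      by (intro sq_integrable_diff fin \<phi>)
    from energy_eq_L2_norm[OF this] N[OF that, unfolded eq]
    show ?thesis by (simp add: abs_square_le_1 L2_norm_def)
  qed
  have "\<exists>r::nat\<Rightarrow>nat. strict_mono r \<and> (AE p in lborel. (\<lambda>n. fourier (\<phi> (r n)) p) \<longlonglongrightarrow> ?U p)"
  proof (rule energy_AE_subseq)
    show "sq_dist (fourier (\<phi> n)) ?U < \<infinity>" for n
      using sq_integrable_diff[of "fourier (\<phi> n)" ?U] U by (simp add: sq_integrable_iff)
  qed (use U in auto)
  then obtain r :: "nat \<Rightarrow> nat" where r: "strict_mono r" "AE p in lborel. (\<lambda>n. fourier (\<phi> (r n)) p) \<longlonglongrightarrow> ?U p" by blast
  have [measurable]: "weighted \<sigma> b ?U \<in> borel_measurable borel" "\<And>n. weighted \<sigma> b (fourier (\<phi> n)) \<in> borel_measurable borel"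
    by (rule weighted_measurable; simp)+
  have le: "sq_dist (weighted \<sigma> b ?U) (?W N) \<le> 1"
  proof (rule energy_Fatou)
    show "AE p in lborel. (\<lambda>n. ?W (r n) p - ?W N p) \<longlonglongrightarrow> weighted \<sigma> b ?U p - ?W N p"
      using r(2) by eventually_elim (auto simp: weighted_def intro!: tendsto_intros)
    show "\<forall>\<^sub>F n in sequentially. sq_norm (\<lambda>p. ?W (r n) p - ?W N p) \<le> 1"
      using seq_suble[OF r(1)] by (intro eventually_sequentiallyI[of N] le1) (rule le_trans)
  qed simp
  have "sq_norm (\<lambda>p. weighted \<sigma> b ?U p - 0) \<le> 2 * sq_dist (weighted \<sigma> b ?U) (?W N) + 2 * sq_norm (\<lambda>p. ?W N p - 0)"
    by (rule energy_triangle) auto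
  also have "\<dots> \<le> 2 * 1 + 2 * sq_norm (?W N)"
    unfolding diff_zero by (intro add_mono mult_left_mono le) auto
  also have "\<dots> < \<infinity>"
    using fin[OF \<phi>(1), of N] by (auto simp: sq_integrable_iff ennreal_mult_less_top)
  finally show ?thesis by (simp add: sq_integrable_iff)
qed

lemma weighted_fourier_schwartz:
  assumes \<phi>: "schwartz \<phi>" and m: "\<sigma> \<in> borel_measurable borel" and b: "b \<ge> 0"
    and bd: "\<And>p. 1 + (\<sigma> p)\<^sup>2 \<le> 3 * (1 + (fst p)\<^sup>2) ^ 3 * (1 + (snd p)\<^sup>2)"
  shows "sq_integrable (weighted \<sigma> b (fourier \<phi>))"
proof -
  define N where "N = nat \<lceil>b\<rceil>"
  have "biquadratic_decay (\<lambda>p. of_real (japanese (\<sigma> p) powr b) * fourier \<phi> p)"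
  proof (rule multiplier_fourier_schwartz_decay[OF \<phi>])
    fix p :: "real \<times> real"
    have "japanese (\<sigma> p) powr b \<le> (1 + (\<sigma> p)\<^sup>2) powr (real N)"
      unfolding japanese_powr using b by (intro powr_mono) (auto simp: N_def, linarith)
    also have "\<dots> = (1 + (\<sigma> p)\<^sup>2) ^ N" by (intro powr_realpow) (simp add: add_pos_nonneg)
    also have "\<dots> \<le> (3 * (1 + (fst p)\<^sup>2) ^ 3 * (1 + (snd p)\<^sup>2)) ^ N"
      by (intro power_mono bd) auto
    also have "\<dots> = 3 ^ N * (1 + (fst p)\<^sup>2) ^ (3 * N) * (1 + (snd p)\<^sup>2) ^ N"
      by (simp add: power_mult_distrib power_mult)
    finally show "norm (complex_of_real (japanese (\<sigma> p) powr b)) \<le> 3 ^ N * (1 + (fst p)\<^sup>2) ^ (3 * N) * (1 + (snd p)\<^sup>2) ^ N"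
      by simp
  qed (use m in measurable)
  then show ?thesis
    unfolding sq_integrable_iff weighted_def[abs_def]
    using biquadratic_decay_energy biquadratic_decay_measurable by auto
qed

lemma schroedinger_phase_bound: "1 + (schroedinger_phase p)\<^sup>2 \<le> 3 * (1 + (fst p)\<^sup>2) ^ 3 * (1 + (snd p)\<^sup>2)"
  and airy_phase_bound: "1 + (airy_phase p)\<^sup>2 \<le> 3 * (1 + (fst p)\<^sup>2) ^ 3 * (1 + (snd p)\<^sup>2)"
proof -
  obtain x t where p: "p = (x, t)" by (cases p)
  define y s where "y = x\<^sup>2" and "s = t\<^sup>2"
  have ys: "0 \<le> y" "0 \<le> s" by (auto simp: y_def s_def)
  have sq: "(a + c)\<^sup>2 \<le> 2 * a\<^sup>2 + 2 * c\<^sup>2" for a c :: real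
    using sum_squares_bound[of a c] by (simp add: power2_sum)
  have cube: "(1 + y) ^ 3 = 1 + 3 * y + 3 * y\<^sup>2 + y ^ 3"
    by (simp add: power3_eq_cube power2_eq_square algebra_simps)
  have nn: "0 \<le> y\<^sup>2" "0 \<le> y ^ 3" "0 \<le> y * s" "0 \<le> y\<^sup>2 * s" "0 \<le> y ^ 3 * s" using ys by auto
  have exp: "3 * (1 + y) ^ 3 * (1 + s) = 3 + 9 * y + 9 * y\<^sup>2 + 3 * y ^ 3 + 3 * s + 9 * (y * s) + 9 * (y\<^sup>2 * s) + 3 * (y ^ 3 * s)"
    unfolding cube by (simp add: algebra_simps)
  have "1 + (t + x\<^sup>2)\<^sup>2 \<le> 1 + (2 * s + 2 * y\<^sup>2)"
    using sq[of t "x\<^sup>2"] by (simp add: y_def s_def)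
  also have "\<dots> \<le> 3 * (1 + y) ^ 3 * (1 + s)" unfolding exp using nn ys by linarith
  finally show "1 + (schroedinger_phase p)\<^sup>2 \<le> 3 * (1 + (fst p)\<^sup>2) ^ 3 * (1 + (snd p)\<^sup>2)"
    by (simp add: p schroedinger_phase_def y_def s_def)
  have "(x ^ 3)\<^sup>2 = y ^ 3" by (simp add: y_def power_mult[symmetric] mult.commute)
  then have "1 + (t - x ^ 3)\<^sup>2 \<le> 1 + (2 * s + 2 * y ^ 3)"
    using sq[of t "- (x ^ 3)"] by (simp add: s_def)
  also have "\<dots> \<le> 3 * (1 + y) ^ 3 * (1 + s)" unfolding exp using nn ys by linarith
  finally show "1 + (airy_phase p)\<^sup>2 \<le> 3 * (1 + (fst p)\<^sup>2) ^ 3 * (1 + (snd p)\<^sup>2)"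
    by (simp add: p airy_phase_def y_def s_def)
qed

lemma schroedinger_phase_eq: "schroedinger_phase p = snd p + (fst p)\<^sup>2"
  by (cases p) (simp add: schroedinger_phase_def)

lemma airy_phase_eq: "airy_phase p = snd p - fst p ^ 3"
  by (cases p) (simp add: airy_phase_def)

lemma schroedinger_phase_measurable[measurable]: "schroedinger_phase \<in> borel_measurable borel"
  unfolding schroedinger_phase_eq[abs_def] by measurable

lemma airy_phase_measurable[measurable]: "airy_phase \<in> borel_measurable borel"
  unfolding airy_phase_eq[abs_def] by measurable

lemma transform_of_bourgain_space:
  assumes u: "u \<in> bourgain_space \<sigma> b" and b: "b > 1/2" and \<sigma>: "\<sigma> = schroedinger_phase \<or> \<sigma> = airy_phase"
  shows "L2_ext fourier u \<in> borel_measurable borel" "sq_norm (L2_ext fourier u) < \<infinity>"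
    "sq_integrable (weighted \<sigma> b (L2_ext fourier u))"
proof -
  obtain \<phi> where \<phi>: "\<And>n. schwartz (\<phi> n)" "L2_tendsto \<phi> u" using u unfolding bourgain_space_def by blast
  from L2_fourier_tendsto[OF \<phi>]
  show "L2_ext fourier u \<in> borel_measurable borel" "sq_norm (L2_ext fourier u) < \<infinity>"
    by (auto simp: L2_tendsto_iff sq_integrable_iff)
  show "sq_integrable (weighted \<sigma> b (L2_ext fourier u))"
    using \<sigma> b by (intro weighted_sq_integrable[OF u])
      (auto intro!: weighted_fourier_schwartz schroedinger_phase_bound airy_phase_bound)
qed

section \<open>The phase functions as changes of variables\<close>

text \<open>Only an inequality holds, because the image of \<open>S\<close> under \<open>h\<close> may be a proper subset of the line.\<close>

lemma nn_integral_substitution_le: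
  fixes h h' k :: "real \<Rightarrow> real"
  assumes S: "S \<in> sets borel" and deriv: "\<And>x. x \<in> S \<Longrightarrow> (h has_field_derivative h' x) (at x)"
    and inj: "inj_on h S" and k[measurable]: "k \<in> borel_measurable borel" and k0: "\<And>x. 0 \<le> k x"
  shows "(\<integral>\<^sup>+x. ennreal (indicator S x * (\<bar>h' x\<bar> * k (h x))) \<partial>lborel) \<le> (\<integral>\<^sup>+x. ennreal (k x) \<partial>lborel)"
proof (cases "(\<integral>\<^sup>+x. ennreal (k x) \<partial>lborel) = \<infinity>")
  case True then show ?thesis by simp
next
  case False
  then have int: "integrable lborel k"
    using k0 by (intro integrableI_bounded) (auto simp: top.not_eq_extremum)
  then have "integrable lebesgue k" by (simp add: integrable_completion)
  then have abs: "k absolutely_integrable_on UNIV" by (simp add: set_integrable_def)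
  have Sl: "S \<in> sets lebesgue" using S by simp
  have d: "(h has_field_derivative h' x) (at x within S)" if "x \<in> S" for x
    using deriv[OF that] by (rule has_field_derivative_at_within)
  have "h differentiable_on S"
    unfolding differentiable_on_def differentiable_def using d has_field_derivative_imp_has_derivative by blast
  then have im: "h ` S \<in> sets lebesgue"
    by (intro differentiable_image_in_sets_lebesgue Sl) auto
  have abs': "k absolutely_integrable_on (h ` S)"
    by (rule set_integrable_subset[OF abs im]) simp
  have ch: "(\<lambda>x. \<bar>h' x\<bar> * k (h x)) absolutely_integrable_on S"
    "integral S (\<lambda>x. \<bar>h' x\<bar> * k (h x)) = integral (h ` S) k"
    using has_absolute_integral_change_of_variables_1'[OF Sl d inj, of k "integral (h ` S) k"] abs' by auto
  have "((\<lambda>x. \<bar>h' x\<bar> * k (h x)) has_integral integral (h ` S) k) S"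
    using ch by (metis absolutely_integrable_on_def integrable_integral)
  then have "(\<integral>\<^sup>+x. ennreal (indicator S x * (\<bar>h' x\<bar> * k (h x))) \<partial>lborel) = ennreal (integral (h ` S) k)"
    using k0 by (intro nn_integral_has_integral_lebesgue) auto
  also have "\<dots> \<le> ennreal (integral UNIV k)"
    by (intro ennreal_leI integral_subset_le) (use abs abs' k0 in \<open>auto simp: absolutely_integrable_on_def\<close>)
  also have "integral UNIV k = integral\<^sup>L lborel k"
    using has_integral_integral_lborel[OF int] by (rule integral_unique)
  also have "ennreal \<dots> = (\<integral>\<^sup>+x. ennreal (k x) \<partial>lborel)"
    using int k0 by (simp add: nn_integral_eq_integral)
  finally show ?thesis .
qed

text \<open>The integral of the weight, to which all changes of variables reduce.\<close>

definition japanese_mass :: "real \<Rightarrow> ennreal" where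
  "japanese_mass b = (\<integral>\<^sup>+s. ennreal (japanese s powr (- 2 * b)) \<partial>lborel)"

lemma sum_squares_pos_of_ne:
  fixes x y :: real assumes "x \<noteq> y" shows "x\<^sup>2 + x * y + y\<^sup>2 > 0"
proof -
  have "0 < 3 * (x + y)\<^sup>2 + (x - y)\<^sup>2" using assms by (intro add_nonneg_pos) auto
  also have "\<dots> = 4 * (x\<^sup>2 + x * y + y\<^sup>2)" by (simp add: power2_eq_square algebra_simps)
  finally show ?thesis by (rule zero_less_mult_pos) simp
qed

text \<open>The Jacobian \<open>3 \<xi>\<^sup>2\<close> of the cubic phase absorbs the factor \<open>\<xi>\<^sup>2\<close>.\<close>

lemma airy_phase_integral_le:
  "(\<integral>\<^sup>+\<xi>. ennreal (\<xi>\<^sup>2 * japanese (\<tau> - \<xi> ^ 3) powr (- 2 * b)) \<partial>lborel) \<le> japanese_mass b"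
proof -
  have "inj_on (\<lambda>\<xi>. \<tau> - \<xi> ^ 3) (UNIV :: real set)"
  proof (rule inj_onI, rule ccontr)
    fix x y :: real assume eq: "\<tau> - x ^ 3 = \<tau> - y ^ 3" and ne: "x \<noteq> y"
    have "(x - y) * (x\<^sup>2 + x * y + y\<^sup>2) = x ^ 3 - y ^ 3"
      by (simp add: power2_eq_square power3_eq_cube algebra_simps)
    then show False using eq ne sum_squares_pos_of_ne[OF ne] by simp
  qed
  then have "(\<integral>\<^sup>+\<xi>. ennreal (indicator UNIV \<xi> * (\<bar>- 3 * \<xi>\<^sup>2\<bar> * (\<lambda>s. japanese s powr (- 2 * b)) (\<tau> - \<xi> ^ 3))) \<partial>lborel)
      \<le> (\<integral>\<^sup>+s. ennreal ((\<lambda>s. japanese s powr (- 2 * b)) s) \<partial>lborel)"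
    by (intro nn_integral_substitution_le) (auto intro!: derivative_eq_intros)
  moreover have "(\<integral>\<^sup>+\<xi>. ennreal (\<xi>\<^sup>2 * japanese (\<tau> - \<xi> ^ 3) powr (- 2 * b)) \<partial>lborel)
     \<le> (\<integral>\<^sup>+\<xi>. ennreal (indicator UNIV \<xi> * (\<bar>- 3 * \<xi>\<^sup>2\<bar> * (\<lambda>s. japanese s powr (- 2 * b)) (\<tau> - \<xi> ^ 3))) \<partial>lborel)"
    by (intro nn_integral_mono ennreal_leI) (auto intro!: mult_right_mono)
  ultimately show ?thesis unfolding japanese_mass_def by simp
qed

text \<open>The heart of the matter. In the region \<open>\<bar>\<xi> - \<eta>\<bar> \<le> \<eta>\<^sup>2\<close> the phase is a change of variables on each
  half-line, with Jacobian at least \<open>\<eta>\<^sup>2\<close>. The negative and the positive frequencies contribute one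
  mass each.\<close>

lemma resonance_integral_le:
  "(\<integral>\<^sup>+\<eta>. ennreal (indicator {\<eta>. \<bar>\<xi> - \<eta>\<bar> \<le> \<eta>\<^sup>2} \<eta> * (\<eta>\<^sup>2 * japanese (c - \<eta> ^ 3 + (\<xi> - \<eta>)\<^sup>2) powr (- 2 * b))) \<partial>lborel) \<le> 2 * japanese_mass b"
proof -
  define h where "h \<eta> = c - \<eta> ^ 3 + (\<xi> - \<eta>)\<^sup>2" for \<eta>
  define h' where "h' \<eta> = - 3 * \<eta>\<^sup>2 - 2 * (\<xi> - \<eta>)" for \<eta>
  define k where "k s = japanese s powr (- 2 * b)" for s
  define P where "P = {\<eta>. 0 < \<eta> \<and> \<bar>\<xi> - \<eta>\<bar> \<le> \<eta>\<^sup>2}"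
  define N where "N = {\<eta>. \<eta> < 0 \<and> \<bar>\<xi> - \<eta>\<bar> \<le> \<eta>\<^sup>2}"
  let ?g = "\<lambda>S \<eta>. ennreal (indicator S \<eta> * (\<bar>h' \<eta>\<bar> * k (h \<eta>)))"
  have [measurable]: "k \<in> borel_measurable borel" unfolding k_def by measurable
  have meas: "P \<in> sets borel" "N \<in> sets borel" unfolding P_def N_def by measurable
  have deriv: "(h has_field_derivative h' x) (at x)" for x
    unfolding h_def h'_def by (auto intro!: derivative_eq_intros)
  have h'_ge: "\<eta>\<^sup>2 \<le> \<bar>h' \<eta>\<bar>" if "\<bar>\<xi> - \<eta>\<bar> \<le> \<eta>\<^sup>2" for \<eta>
  proof -
    have "- (\<xi> - \<eta>) \<le> \<eta>\<^sup>2" using that by (rule abs_le_D2)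
    then have "h' \<eta> \<le> - (\<eta>\<^sup>2)" unfolding h'_def by (simp add: algebra_simps)
    then show ?thesis using abs_ge_minus_self[of "h' \<eta>"] by linarith
  qed
  \<comment> \<open>two frequencies of the same sign in the region give different values of the phase\<close>
  have ne: "h x \<noteq> h y" if "x \<noteq> y" "0 < x * y" "\<bar>\<xi> - x\<bar> \<le> x\<^sup>2" "\<bar>\<xi> - y\<bar> \<le> y\<^sup>2" for x y
  proof
    assume "h x = h y"
    moreover have "h x - h y = - (x - y) * (x\<^sup>2 + x * y + y\<^sup>2 + (\<xi> - x) + (\<xi> - y))"
      unfolding h_def by (simp add: power2_eq_square power3_eq_cube algebra_simps)
    ultimately have "x\<^sup>2 + x * y + y\<^sup>2 + (\<xi> - x) + (\<xi> - y) = 0" using that(1) by simp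
    with that(2-4) show False by linarith
  qed
  have "x = y" if "x \<in> P" "y \<in> P" "h x = h y" for x y
    using that ne[of x y] by (auto simp: P_def zero_less_mult_iff)
  then have "inj_on h P" by (rule inj_onI)
  moreover have "x = y" if "x \<in> N" "y \<in> N" "h x = h y" for x y
    using that ne[of x y] by (auto simp: N_def zero_less_mult_iff)
  then have "inj_on h N" by (rule inj_onI)
  ultimately have le: "(\<integral>\<^sup>+\<eta>. ?g P \<eta> \<partial>lborel) \<le> japanese_mass b"
    "(\<integral>\<^sup>+\<eta>. ?g N \<eta> \<partial>lborel) \<le> japanese_mass b"
    unfolding japanese_mass_def k_def[symmetric]
    by (intro nn_integral_substitution_le meas deriv; simp add: k_def)+
  have [measurable]: "h \<in> borel_measurable borel" "h' \<in> borel_measurable borel" unfolding h_def h'_def by measurable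
  note [measurable] = meas
  have "(\<integral>\<^sup>+\<eta>. ennreal (indicator {\<eta>. \<bar>\<xi> - \<eta>\<bar> \<le> \<eta>\<^sup>2} \<eta> * (\<eta>\<^sup>2 * k (h \<eta>))) \<partial>lborel) \<le>
     (\<integral>\<^sup>+\<eta>. ?g P \<eta> + ?g N \<eta> \<partial>lborel)"
  proof (rule nn_integral_mono)
    fix \<eta> :: real
    consider "\<eta> = 0" | "\<bar>\<xi> - \<eta>\<bar> > \<eta>\<^sup>2" | "\<bar>\<xi> - \<eta>\<bar> \<le> \<eta>\<^sup>2" "\<eta> > 0" | "\<bar>\<xi> - \<eta>\<bar> \<le> \<eta>\<^sup>2" "\<eta> < 0" by linarith
    then show "ennreal (indicator {\<eta>. \<bar>\<xi> - \<eta>\<bar> \<le> \<eta>\<^sup>2} \<eta> * (\<eta>\<^sup>2 * k (h \<eta>))) \<le>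
       ?g P \<eta> + ?g N \<eta>"
    proof cases
      case 3
      then have "\<eta>\<^sup>2 \<le> \<bar>h' \<eta>\<bar>" by (intro h'_ge)
      then have "\<eta>\<^sup>2 * k (h \<eta>) \<le> \<bar>h' \<eta>\<bar> * k (h \<eta>)" by (rule mult_right_mono) (simp add: k_def)
      with 3 show ?thesis by (simp add: P_def N_def ennreal_leI)
    next
      case 4
      then have "\<eta>\<^sup>2 \<le> \<bar>h' \<eta>\<bar>" by (intro h'_ge)
      then have "\<eta>\<^sup>2 * k (h \<eta>) \<le> \<bar>h' \<eta>\<bar> * k (h \<eta>)" by (rule mult_right_mono) (simp add: k_def)
      with 4 show ?thesis by (simp add: P_def N_def ennreal_leI)
    qed simp_all
  qed
  also have "\<dots> = (\<integral>\<^sup>+\<eta>. ?g P \<eta> \<partial>lborel) + (\<integral>\<^sup>+\<eta>. ?g N \<eta> \<partial>lborel)"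
    by (rule nn_integral_add) measurable
  also have "\<dots> \<le> 2 * japanese_mass b"
    unfolding mult_2 by (rule add_mono[OF le])
  finally show ?thesis unfolding k_def h_def .
qed

section \<open>Smoothing and bilinear estimates on the Fourier side\<close>

text \<open>If \<open>f\<close> is not integrable, its integral is 0 by convention and the inequality is trivial.\<close>

lemma norm_integral_Cauchy_Schwarz:
  fixes f :: "'a \<Rightarrow> complex"
  assumes le: "\<And>x. ennreal (norm (f x)) \<le> A x * B x"
    and [measurable]: "A \<in> borel_measurable M" "B \<in> borel_measurable M"
  shows "ennreal ((norm (LINT x|M. f x))\<^sup>2) \<le> (\<integral>\<^sup>+x. (A x)\<^sup>2 \<partial>M) * (\<integral>\<^sup>+x. (B x)\<^sup>2 \<partial>M)"
proof (cases "integrable M f")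
  case True
  have "ennreal (norm (LINT x|M. f x)) \<le> (\<integral>\<^sup>+x. ennreal (norm (f x)) \<partial>M)"
    by (rule integral_norm_bound_ennreal[OF True])
  also have "\<dots> \<le> (\<integral>\<^sup>+x. A x * B x \<partial>M)" by (intro nn_integral_mono le)
  finally have "(ennreal (norm (LINT x|M. f x)))\<^sup>2 \<le> (\<integral>\<^sup>+x. A x * B x \<partial>M)\<^sup>2"
    by (rule power_mono) simp
  also have "\<dots> \<le> (\<integral>\<^sup>+x. (A x)\<^sup>2 \<partial>M) * (\<integral>\<^sup>+x. (B x)\<^sup>2 \<partial>M)"
    by (rule Cauchy_Schwarz_nn_integral) measurable
  finally show ?thesis by (simp add: ennreal_power)
qed (simp add: not_integrable_integral_eq)

lemma weighted_factor:
  "norm (U p) = japanese (\<sigma> p) powr (- b) * norm (weighted \<sigma> b U p)"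
proof -
  have "japanese (\<sigma> p) powr (- b) * japanese (\<sigma> p) powr b = 1"
    using japanese_ge_1[of "\<sigma> p"] by (simp add: powr_add[symmetric])
  then show ?thesis by (simp add: weighted_def norm_mult mult.assoc[symmetric])
qed

lemma japanese_powr_square: "(ennreal (japanese s powr (- b)))\<^sup>2 = ennreal (japanese s powr (- 2 * b))"
  by (simp add: ennreal_power) (simp add: power2_eq_square powr_add[symmetric])

abbreviation "X_energy b U \<equiv> sq_norm (weighted schroedinger_phase b U)"
abbreviation "Y_energy b V \<equiv> sq_norm (weighted airy_phase b V)"

abbreviation Dx_multiplier :: "(real \<times> real \<Rightarrow> complex) \<Rightarrow> real \<times> real \<Rightarrow> complex" where
  "Dx_multiplier g \<equiv> (\<lambda>q. of_real \<bar>fst q\<bar> * g q)"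

text \<open>For fixed \<open>x\<close>, Plancherel in time and Cauchy--Schwarz in \<open>\<xi>\<close> reduce the claim to
  \<open>airy_phase_integral_le\<close>. The bound does not depend on \<open>x\<close>.\<close>

lemma Kato_smoothing_slice:
  fixes g :: "real \<times> real \<Rightarrow> complex"
  assumes [measurable]: "g \<in> borel_measurable borel"
    and int: "integrable lborel (Dx_multiplier g)"
  shows "sq_norm (\<lambda>t. fourier (Dx_multiplier g) (x, t))
    \<le> ennreal (2 * pi) * (japanese_mass b * Y_energy b g)"
proof -
  let ?H = "\<lambda>q. of_real \<bar>fst q\<bar> * g q"
  have [measurable]: "weighted airy_phase b g \<in> borel_measurable borel" by (rule weighted_measurable) measurable
  have "sq_norm (\<lambda>t. fourier ?H (x, t)) \<le> ennreal (2 * pi) * sq_norm (\<lambda>\<tau>. fourier_x ?H (x, \<tau>))"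
    using Plancherel_le[OF fourier_eq_iterated(1)[OF int, of x]] unfolding fourier_eq_iterated(2)[OF int] by simp
  also have "sq_norm (\<lambda>\<tau>. fourier_x ?H (x, \<tau>)) \<le> (\<integral>\<^sup>+\<tau>. japanese_mass b * sq_norm (\<lambda>\<xi>. weighted airy_phase b g (\<xi>, \<tau>)) \<partial>lborel)"
    unfolding energy_def[of lborel "\<lambda>\<tau>. fourier_x ?H (x, \<tau>)"]
  proof (rule nn_integral_mono)
    fix \<tau> :: real
    have "ennreal ((norm (LINT \<xi>|lborel. cis (- (\<xi> \<bullet> x)) * ?H (\<xi>, \<tau>)))\<^sup>2) \<le>
       (\<integral>\<^sup>+\<xi>. (ennreal (\<bar>\<xi>\<bar> * japanese (\<tau> - \<xi> ^ 3) powr (- b)))\<^sup>2 \<partial>lborel) * (\<integral>\<^sup>+\<xi>. (ennreal (norm (weighted airy_phase b g (\<xi>, \<tau>))))\<^sup>2 \<partial>lborel)"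
    proof (rule norm_integral_Cauchy_Schwarz)
      fix \<xi> :: real
      show "ennreal (norm (cis (- (\<xi> \<bullet> x)) * ?H (\<xi>, \<tau>))) \<le> ennreal (\<bar>\<xi>\<bar> * japanese (\<tau> - \<xi> ^ 3) powr (- b)) * ennreal (norm (weighted airy_phase b g (\<xi>, \<tau>)))"
        using weighted_factor[of g "(\<xi>, \<tau>)" airy_phase b]
        by (simp add: norm_mult ennreal_mult[symmetric] airy_phase_eq mult_ac)
    qed measurable
    also have "(\<integral>\<^sup>+\<xi>. (ennreal (\<bar>\<xi>\<bar> * japanese (\<tau> - \<xi> ^ 3) powr (- b)))\<^sup>2 \<partial>lborel) = (\<integral>\<^sup>+\<xi>. ennreal (\<xi>\<^sup>2 * japanese (\<tau> - \<xi> ^ 3) powr (- 2 * b)) \<partial>lborel)"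
      by (intro nn_integral_cong) (simp add: ennreal_mult power_mult_distrib japanese_powr_square[simplified] del: ennreal_power, simp add: ennreal_power)
    also have "\<dots> \<le> japanese_mass b" by (rule airy_phase_integral_le)
    also have "(\<integral>\<^sup>+\<xi>. (ennreal (norm (weighted airy_phase b g (\<xi>, \<tau>))))\<^sup>2 \<partial>lborel) = sq_norm (\<lambda>\<xi>. weighted airy_phase b g (\<xi>, \<tau>))"
      unfolding energy_def by (simp add: ennreal_power)
    finally show "ennreal ((norm (fourier_x ?H (x, \<tau>)))\<^sup>2) \<le> japanese_mass b * sq_norm (\<lambda>\<xi>. weighted airy_phase b g (\<xi>, \<tau>))"
      by (simp add: fourier_x_def fourier_def mult_right_mono)
  qed
  also have "\<dots> = japanese_mass b * Y_energy b g"
    unfolding energy_lborel_prod(2)[OF \<open>weighted airy_phase b g \<in> _\<close>] unfolding energy_def by (rule nn_integral_cmult) measurable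
  finally show ?thesis by (simp add: mult_left_mono)
qed

lemma convolution_theorem:
  fixes f g :: "'a::euclidean_space \<Rightarrow> complex"
  assumes f: "integrable lborel f" and g: "integrable lborel g"
  shows "integrable lborel (\<lambda>r. LINT q|lborel. f (r - q) * g q)"
    and "fourier (\<lambda>r. LINT q|lborel. f (r - q) * g q) p = fourier f p * fourier g p"
proof -
  let ?c = "\<lambda>s. cis (- (s \<bullet> p))"
  have [measurable]: "f \<in> borel_measurable borel" "g \<in> borel_measurable borel" using f g by auto
  have shift: "integrable lborel (\<lambda>r. h (r - q))" if "integrable lborel h" for h :: "'a \<Rightarrow> complex" and q
    using integrable_lborel_affine[OF that, of 1 "- q"] by simp
  have shift_eq: "(LINT r|lborel. h (r - q)) = (LINT r|lborel. h r)" if "h \<in> borel_measurable borel" for h :: "'a \<Rightarrow> complex" and q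
    using integral_lborel_affine[OF that, of 1 "- q"] by simp
  have nshift: "(LINT r|lborel. norm (f (r - q))) = (LINT r|lborel. norm (f r))" for q
  proof -
    have "complex_of_real (LINT r|lborel. norm (f (r - q))) = complex_of_real (LINT r|lborel. norm (f r))"
      unfolding integral_complex_of_real[symmetric] by (rule shift_eq[of "\<lambda>r. complex_of_real (norm (f r))"]) simp
    then show ?thesis by simp
  qed
  have int: "integrable (lborel \<Otimes>\<^sub>M lborel) (\<lambda>(q, r). f (r - q) * g q)"
  proof (rule lborel_pair.Fubini_integrable)
    show "integrable lborel (\<lambda>q. LINT r|lborel. norm (case (q, r) of (q, r) \<Rightarrow> f (r - q) * g q))"
      using g by (simp add: norm_mult nshift)
    show "AE q in lborel. integrable lborel (\<lambda>r. case (q, r) of (q, r) \<Rightarrow> f (r - q) * g q)"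
      using shift[OF f] by simp
  qed measurable
  from lborel_pair.integrable_snd[OF int]
  show "integrable lborel (\<lambda>r. LINT q|lborel. f (r - q) * g q)" .
  have int2: "integrable (lborel \<Otimes>\<^sub>M lborel) (\<lambda>(q, r). ?c r * (f (r - q) * g q))"
    by (rule integrable_dominated[OF int]) (auto simp: norm_mult split_beta')
  have "fourier (\<lambda>r. LINT q|lborel. f (r - q) * g q) p = (LINT r|lborel. LINT q|lborel. ?c r * (f (r - q) * g q))"
    unfolding fourier_def by simp
  also have "\<dots> = (LINT q|lborel. LINT r|lborel. ?c r * (f (r - q) * g q))"
    by (rule lborel_pair.Fubini_integral[OF int2])
  also have "\<dots> = (LINT q|lborel. fourier f p * (?c q * g q))"
  proof (rule integral_eqI)
    fix q :: 'a
    have "(LINT r|lborel. ?c r * (f (r - q) * g q)) = (LINT r|lborel. (\<lambda>s. ?c s * f s) (r - q) * (?c q * g q))"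
    proof (rule integral_eqI)
      fix r
      have "?c r = ?c (r - q) * ?c q"
        by (simp add: cis_mult inner_diff_left)
      then show "?c r * (f (r - q) * g q) = (\<lambda>s. ?c s * f s) (r - q) * (?c q * g q)"
        by simp
    qed
    also have "\<dots> = (LINT r|lborel. (\<lambda>s. ?c s * f s) (r - q)) * (?c q * g q)"
      by (rule integral_mult_left_zero)
    also have "(LINT r|lborel. (\<lambda>s. ?c s * f s) (r - q)) = fourier f p"
      unfolding fourier_def by (rule shift_eq) measurable
    finally show "(LINT r|lborel. ?c r * (f (r - q) * g q)) = fourier f p * (?c q * g q)" .
  qed
  also have "\<dots> = fourier f p * fourier g p" unfolding fourier_def by simp
  finally show "fourier (\<lambda>r. LINT q|lborel. f (r - q) * g q) p = fourier f p * fourier g p" .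
qed

text \<open>The kernel that Cauchy--Schwarz leaves behind, at the output frequency \<open>p\<close>.\<close>

lemma bilinear_weight_integral_le:
  "(\<integral>\<^sup>+q. (ennreal (indicator {q. \<bar>fst p - fst q\<bar> \<le> (fst q)\<^sup>2} q * (\<bar>fst q\<bar> *
       (japanese (schroedinger_phase (p - q)) powr (- b) * japanese (airy_phase q) powr (- b)))))\<^sup>2 \<partial>lborel)
    \<le> 2 * (japanese_mass b)\<^sup>2"
proof -
  obtain \<xi> \<tau> where p: "p = (\<xi>, \<tau>)" by (cases p)
  let ?I = "\<lambda>\<eta>. indicator {\<eta>. \<bar>\<xi> - \<eta>\<bar> \<le> \<eta>\<^sup>2} \<eta> :: real"
  let ?j = "\<lambda>s. japanese s powr (- 2 * b)"
  let ?k = "\<lambda>l \<eta>. ennreal (?I \<eta> * (\<eta>\<^sup>2 * (?j (\<tau> - l - \<eta> ^ 3 + (\<xi> - \<eta>)\<^sup>2) * ?j l)))"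
  have eq: "(ennreal (indicator {q. \<bar>fst p - fst q\<bar> \<le> (fst q)\<^sup>2} q * (\<bar>fst q\<bar> *
       (japanese (schroedinger_phase (p - q)) powr (- b) * japanese (airy_phase q) powr (- b)))))\<^sup>2
     = ennreal (?I (fst q) * ((fst q)\<^sup>2 * (?j (\<tau> - snd q + (\<xi> - fst q)\<^sup>2) * ?j (snd q - fst q ^ 3))))" for q
  proof -
    have sq: "(japanese s powr (- b))\<^sup>2 = ?j s" for s
      by (simp add: power2_eq_square powr_add[symmetric])
    show ?thesis
      unfolding p by (subst ennreal_power)
        (auto simp: power_mult_distrib sq schroedinger_phase_eq airy_phase_eq indicator_def)
  qed
  have "(\<integral>\<^sup>+q. ennreal (?I (fst q) * ((fst q)\<^sup>2 * (?j (\<tau> - snd q + (\<xi> - fst q)\<^sup>2) * ?j (snd q - fst q ^ 3)))) \<partial>lborel)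
     = (\<integral>\<^sup>+\<eta>. \<integral>\<^sup>+s. ennreal (?I \<eta> * (\<eta>\<^sup>2 * (?j (\<tau> - s + (\<xi> - \<eta>)\<^sup>2) * ?j (s - \<eta> ^ 3)))) \<partial>lborel \<partial>lborel)"
    unfolding lborel_prod[symmetric] by (subst lborel.nn_integral_fst[symmetric]) simp_all
  \<comment> \<open>shift by the phase of the second factor, so that its weight no longer depends on the frequency\<close>
  also have "\<dots> = (\<integral>\<^sup>+\<eta>. \<integral>\<^sup>+l. ?k l \<eta> \<partial>lborel \<partial>lborel)"
  proof (rule nn_integral_cong)
    fix \<eta> :: real
    show "(\<integral>\<^sup>+s. ennreal (?I \<eta> * (\<eta>\<^sup>2 * (?j (\<tau> - s + (\<xi> - \<eta>)\<^sup>2) * ?j (s - \<eta> ^ 3)))) \<partial>lborel)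
      = (\<integral>\<^sup>+l. ?k l \<eta> \<partial>lborel)"
      by (subst nn_integral_lborel_affine[where c=1 and t="\<eta> ^ 3"]) (simp_all add: algebra_simps)
  qed
  also have "\<dots> = (\<integral>\<^sup>+l. \<integral>\<^sup>+\<eta>. ?k l \<eta> \<partial>lborel \<partial>lborel)"
    by (rule lborel_pair.Fubini'[symmetric]) measurable
  also have "\<dots> \<le> (\<integral>\<^sup>+l. ennreal (?j l) * (2 * japanese_mass b) \<partial>lborel)"
  proof (rule nn_integral_mono)
    fix l :: real
    have "(\<integral>\<^sup>+\<eta>. ?k l \<eta> \<partial>lborel)
      = (\<integral>\<^sup>+\<eta>. ennreal (?j l) * ennreal (?I \<eta> * (\<eta>\<^sup>2 * ?j (\<tau> - l - \<eta> ^ 3 + (\<xi> - \<eta>)\<^sup>2))) \<partial>lborel)"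
      by (intro nn_integral_cong) (simp add: ennreal_mult[symmetric] mult_ac)
    also have "\<dots> = ennreal (?j l) * (\<integral>\<^sup>+\<eta>. ennreal (?I \<eta> * (\<eta>\<^sup>2 * ?j (\<tau> - l - \<eta> ^ 3 + (\<xi> - \<eta>)\<^sup>2))) \<partial>lborel)"
      by (rule nn_integral_cmult) measurable
    also have "\<dots> \<le> ennreal (?j l) * (2 * japanese_mass b)"
      by (intro mult_left_mono resonance_integral_le) simp
    finally show "(\<integral>\<^sup>+\<eta>. ?k l \<eta> \<partial>lborel) \<le> ennreal (?j l) * (2 * japanese_mass b)" .
  qed
  also have "\<dots> = japanese_mass b * (2 * japanese_mass b)"
    unfolding japanese_mass_def by (rule nn_integral_multc) measurable
  also have "\<dots> = 2 * (japanese_mass b)\<^sup>2" by (simp add: power2_eq_square mult_ac)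
  finally show ?thesis unfolding eq .
qed

lemma nn_integral_tensor_shift:
  fixes A B :: "'a::euclidean_space \<Rightarrow> ennreal"
  assumes [measurable]: "A \<in> borel_measurable borel" "B \<in> borel_measurable borel"
  shows "(\<integral>\<^sup>+p. \<integral>\<^sup>+q. A (p - q) * B q \<partial>lborel \<partial>lborel) = (\<integral>\<^sup>+p. A p \<partial>lborel) * (\<integral>\<^sup>+q. B q \<partial>lborel)"
proof -
  have "(\<integral>\<^sup>+p. \<integral>\<^sup>+q. A (p - q) * B q \<partial>lborel \<partial>lborel) = (\<integral>\<^sup>+q. \<integral>\<^sup>+p. A (p - q) * B q \<partial>lborel \<partial>lborel)"
    by (rule lborel_pair.Fubini'[symmetric]) measurable
  also have "\<dots> = (\<integral>\<^sup>+q. (\<integral>\<^sup>+p. A p \<partial>lborel) * B q \<partial>lborel)"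
  proof (rule nn_integral_cong)
    fix q :: 'a
    have "(\<integral>\<^sup>+p. A (p - q) * B q \<partial>lborel) = (\<integral>\<^sup>+p. A (p - q) \<partial>lborel) * B q"
      by (rule nn_integral_multc) measurable
    also have "(\<integral>\<^sup>+p. A (p - q) \<partial>lborel) = (\<integral>\<^sup>+p. A p \<partial>lborel)"
      by (subst (2) nn_integral_lborel_affine[where c=1 and t="- q"]) simp_all
    finally show "(\<integral>\<^sup>+p. A (p - q) * B q \<partial>lborel) = (\<integral>\<^sup>+p. A p \<partial>lborel) * B q" .
  qed
  also have "\<dots> = (\<integral>\<^sup>+p. A p \<partial>lborel) * (\<integral>\<^sup>+q. B q \<partial>lborel)"
    by (rule nn_integral_cmult) measurable
  finally show ?thesis .
qed

text \<open>Cauchy--Schwarz in \<open>q\<close> separates the kernel from the weighted factors; the integral of the latter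
  over \<open>p\<close> and \<open>q\<close> is the product of their energies.\<close>

lemma energy_convolution_le:
  fixes f g :: "real \<times> real \<Rightarrow> complex"
  assumes [measurable]: "f \<in> borel_measurable borel" "g \<in> borel_measurable borel"
    and supp: "\<And>p q. f p \<noteq> 0 \<Longrightarrow> g q \<noteq> 0 \<Longrightarrow> \<bar>fst p\<bar> \<le> (fst q)\<^sup>2"
  shows "sq_norm (\<lambda>p. LINT q|lborel. f (p - q) * (of_real \<bar>fst q\<bar> * g q))
    \<le> 2 * (japanese_mass b)\<^sup>2 * (X_energy b f * Y_energy b g)"
proof -
  let ?Q = "\<lambda>p q. f (p - q) * (of_real \<bar>fst q\<bar> * g q)"
  let ?A = "\<lambda>p q. ennreal (norm (weighted schroedinger_phase b f (p - q))) * ennreal (norm (weighted airy_phase b g q))"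
  let ?F = "weighted schroedinger_phase b f" and ?G = "weighted airy_phase b g"
  have [measurable]: "?F \<in> borel_measurable borel" "?G \<in> borel_measurable borel"
    by (rule weighted_measurable; simp)+
  have sq: "(ennreal x * ennreal y)\<^sup>2 = ennreal (x\<^sup>2) * ennreal (y\<^sup>2)" if "0 \<le> x" "0 \<le> y" for x y
    using that by (simp add: power_mult_distrib ennreal_power)
  have "sq_norm (\<lambda>p. LINT q|lborel. ?Q p q)
     \<le> (\<integral>\<^sup>+p. (\<integral>\<^sup>+q. (?A p q)\<^sup>2 \<partial>lborel) * (2 * (japanese_mass b)\<^sup>2) \<partial>lborel)"
    unfolding energy_def[of lborel "\<lambda>p. LINT q|lborel. ?Q p q"]
  proof (rule nn_integral_mono)
    fix p :: "real \<times> real"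
    let ?B = "\<lambda>q. ennreal (indicator {q. \<bar>fst p - fst q\<bar> \<le> (fst q)\<^sup>2} q * (\<bar>fst q\<bar> *
       (japanese (schroedinger_phase (p - q)) powr (- b) * japanese (airy_phase q) powr (- b))))"
    have "ennreal ((norm (LINT q|lborel. ?Q p q))\<^sup>2)
      \<le> (\<integral>\<^sup>+q. (?A p q)\<^sup>2 \<partial>lborel) * (\<integral>\<^sup>+q. (?B q)\<^sup>2 \<partial>lborel)"
    proof (rule norm_integral_Cauchy_Schwarz)
      fix q :: "real \<times> real"
      show "ennreal (norm (?Q p q)) \<le> ?A p q * ?B q"
      proof (cases "f (p - q) = 0 \<or> g q = 0")
        case False
        then have "\<bar>fst p - fst q\<bar> \<le> (fst q)\<^sup>2" using supp[of "p - q" q] by simp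
        then show ?thesis
          unfolding norm_mult weighted_factor[of f "p - q" schroedinger_phase b] weighted_factor[of g q airy_phase b]
          by (simp add: ennreal_mult[symmetric] mult_ac)
      qed auto
    qed measurable
    also have "\<dots> \<le> (\<integral>\<^sup>+q. (?A p q)\<^sup>2 \<partial>lborel) * (2 * (japanese_mass b)\<^sup>2)"
      by (intro mult_left_mono bilinear_weight_integral_le) simp
    finally show "ennreal ((norm (LINT q|lborel. ?Q p q))\<^sup>2)
      \<le> (\<integral>\<^sup>+q. (?A p q)\<^sup>2 \<partial>lborel) * (2 * (japanese_mass b)\<^sup>2)" .
  qed
  also have "\<dots> = (\<integral>\<^sup>+p. \<integral>\<^sup>+q. ennreal ((norm (?F (p - q)))\<^sup>2) * ennreal ((norm (?G q))\<^sup>2) \<partial>lborel \<partial>lborel) * (2 * (japanese_mass b)\<^sup>2)"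
    by (subst nn_integral_multc) (simp_all add: sq)
  also have "\<dots> = sq_norm ?F * sq_norm ?G * (2 * (japanese_mass b)\<^sup>2)"
    unfolding energy_def by (subst nn_integral_tensor_shift) simp_all
  finally show ?thesis by (simp add: mult_ac)
qed

lemma bilinear_estimate:
  fixes f g :: "real \<times> real \<Rightarrow> complex"
  assumes f: "integrable lborel f" and g: "integrable lborel (Dx_multiplier g)"
    and [measurable]: "g \<in> borel_measurable borel"
    and supp: "\<And>p q. f p \<noteq> 0 \<Longrightarrow> g q \<noteq> 0 \<Longrightarrow> \<bar>fst p\<bar> \<le> (fst q)\<^sup>2"
  shows "sq_norm (\<lambda>p. fourier f p * fourier (Dx_multiplier g) p)
    \<le> ennreal ((2 * pi)\<^sup>2) * (2 * (japanese_mass b)\<^sup>2 *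
        (X_energy b f * Y_energy b g))"
proof -
  have "f \<in> borel_measurable borel" using f by auto
  have "sq_norm (\<lambda>p. fourier f p * fourier (Dx_multiplier g) p)
    = sq_norm (fourier (\<lambda>p. LINT q|lborel. f (p - q) * (of_real \<bar>fst q\<bar> * g q)))"
    unfolding convolution_theorem(2)[OF f g, symmetric] ..
  also have "\<dots> \<le> ennreal ((2 * pi)\<^sup>2) * sq_norm (\<lambda>p. LINT q|lborel. f (p - q) * (of_real \<bar>fst q\<bar> * g q))"
    by (rule Plancherel_le_plane[OF convolution_theorem(1)[OF f g]])
  also have "\<dots> \<le> ennreal ((2 * pi)\<^sup>2) * (2 * (japanese_mass b)\<^sup>2 *
        (X_energy b f * Y_energy b g))"
    by (intro mult_left_mono energy_convolution_le) (use supp \<open>f \<in> _\<close> in auto)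
  finally show ?thesis .
qed

section \<open>Inversion and truncation in frequency\<close>

text \<open>Written as a conjugate, so that its absolute value is that of a Fourier transform at the same point,
  and not at the reflected one.\<close>

definition inverse_fourier :: "(real \<times> real \<Rightarrow> complex) \<Rightarrow> real \<times> real \<Rightarrow> complex" where
  "inverse_fourier h p = of_real (1 / (2 * pi)\<^sup>2) * cnj (fourier (\<lambda>q. cnj (h q)) p)"

lemma inverse_fourier_measurable[measurable (raw)]:
  assumes [measurable]: "h \<in> borel_measurable borel"
  shows "inverse_fourier h \<in> borel_measurable borel"
  unfolding inverse_fourier_def[abs_def] by measurable

lemma Parseval_plane:
  fixes f g :: "real \<times> real \<Rightarrow> complex"
  assumes "schwartz f" "integrable lborel g" "sq_norm g < \<infinity>"
  shows "(LINT \<xi>|lborel. fourier f \<xi> * cnj (fourier g \<xi>)) = of_real ((2 * pi)\<^sup>2) * (LINT x|lborel. f x * cnj (g x))"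
proof -
  have d: "DIM(real \<times> real) = 2" by simp
  obtain B where "\<And>p. norm (f p) \<le> B"
    using biquadratic_decay_bounded[OF schwartz_biquadratic_decay[OF assms(1)]] by metis
  then show ?thesis
    using Parseval[OF schwartz_integrable[OF assms(1)] schwartz_continuous[OF assms(1)] _ assms(2,3)]
    unfolding d by blast
qed

lemma energy_inverse_fourier_le:
  assumes h: "integrable lborel h"
  shows "sq_norm (inverse_fourier h) \<le> ennreal (1 / (2 * pi)\<^sup>2) * sq_norm h"
proof -
  have [measurable]: "h \<in> borel_measurable borel" using h by auto
  have "sq_norm (inverse_fourier h) = ennreal ((1 / (2 * pi)\<^sup>2)\<^sup>2) * sq_norm (fourier (\<lambda>q. cnj (h q)))"
    unfolding inverse_fourier_def[abs_def] by (subst energy_cmult) (simp_all add: energy_cnj norm_divide norm_power)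
  also have "\<dots> \<le> ennreal ((1 / (2 * pi)\<^sup>2)\<^sup>2) * (ennreal ((2 * pi)\<^sup>2) * sq_norm (\<lambda>q. cnj (h q)))"
    by (intro mult_left_mono Plancherel_le_plane integrable_cnj h) simp
  also have "\<dots> = ennreal ((1 / (2 * pi)\<^sup>2)\<^sup>2 * (2 * pi)\<^sup>2) * sq_norm h"
    by (subst ennreal_mult) (simp_all add: energy_cnj mult.assoc)
  also have "(1 / (2 * pi)\<^sup>2)\<^sup>2 * (2 * pi)\<^sup>2 = 1 / (2 * pi)\<^sup>2"
    by (simp add: power2_eq_square)
  finally show ?thesis .
qed

lemma energy_eq_integral:
  assumes [measurable]: "f \<in> borel_measurable M" and "energy M f < \<infinity>"
  shows "integrable M (\<lambda>x. (norm (f x))\<^sup>2)" "energy M f = ennreal (LINT x|M. (norm (f x))\<^sup>2)"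
proof -
  show i: "integrable M (\<lambda>x. (norm (f x))\<^sup>2)"
    using assms unfolding energy_def by (intro integrableI_bounded) auto
  show "energy M f = ennreal (LINT x|M. (norm (f x))\<^sup>2)"
    unfolding energy_def by (rule nn_integral_eq_integral[OF i]) simp
qed

lemma integral_norm_diff_square:
  fixes f g :: "'a \<Rightarrow> complex"
  assumes [measurable]: "f \<in> borel_measurable M" "g \<in> borel_measurable M"
    and fin: "energy M f < \<infinity>" "energy M g < \<infinity>"
  shows "(LINT x|M. (norm (f x - g x))\<^sup>2) =
    (LINT x|M. (norm (f x))\<^sup>2) + (LINT x|M. (norm (g x))\<^sup>2) - 2 * Re (LINT x|M. f x * cnj (g x))"
proof -
  have i: "integrable M (\<lambda>x. f x * cnj (g x))"
    using fin by (intro integrable_mult_energy) (auto simp: energy_cnj)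
  have "(norm (f x - g x))\<^sup>2 = (norm (f x))\<^sup>2 + (norm (g x))\<^sup>2 - 2 * Re (f x * cnj (g x))" for x
    by (simp add: cmod_power2 power2_diff algebra_simps)
  then have "(LINT x|M. (norm (f x - g x))\<^sup>2) = (LINT x|M. (norm (f x))\<^sup>2 + (norm (g x))\<^sup>2 - 2 * Re (f x * cnj (g x)))"
    by simp
  also have "\<dots> = (LINT x|M. (norm (f x))\<^sup>2) + (LINT x|M. (norm (g x))\<^sup>2) - (LINT x|M. 2 * Re (f x * cnj (g x)))"
    using energy_eq_integral(1)[OF _ fin(1)] energy_eq_integral(1)[OF _ fin(2)] i
    by (subst Bochner_Integration.integral_diff) (auto intro!: integrable_Re simp: Bochner_Integration.integral_add simp del: complex_cnj Re_complex_of_real times_complex.sel)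
  also have "(LINT x|M. 2 * Re (f x * cnj (g x))) = 2 * Re (LINT x|M. f x * cnj (g x))"
    by (simp only: integral_mult_right_zero integral_Re[OF i])
  finally show ?thesis .
qed

text \<open>Expand the square. The mixed term is moved to the Fourier side by Fubini, the term of \<open>\<phi>\<close> by
  Parseval, and that of \<open>h\<close> by the inequality. Thus the inverse transform of \<open>h\<close> is compared with
  \<open>\<phi>\<close> without an inversion formula.\<close>

lemma energy_inverse_fourier_diff_le:
  assumes h: "integrable lborel h" and h2: "sq_norm h < \<infinity>" and \<phi>: "schwartz \<phi>"
  shows "sq_dist (inverse_fourier h) \<phi> \<le> ennreal (1 / (2 * pi)\<^sup>2) * sq_dist h (fourier \<phi>)"
proof -
  define \<kappa> where "\<kappa> = (2 * pi)\<^sup>2"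
  have \<kappa>: "\<kappa> > 0" by (simp add: \<kappa>_def)
  note bd = schwartz_biquadratic_decay[OF \<phi>]
  note i\<phi> = biquadratic_decay_integrable[OF bd] and e\<phi> = biquadratic_decay_energy[OF bd]
  have [measurable]: "h \<in> borel_measurable borel" "\<phi> \<in> borel_measurable borel" using h i\<phi> by auto
  have eF: "sq_norm (fourier \<phi>) < \<infinity>" using fourier_schwartz_sq_integrable[OF \<phi>] by (simp add: sq_integrable_iff)
  have ea: "sq_norm (inverse_fourier h) < \<infinity>"
    by (rule le_less_trans[OF energy_inverse_fourier_le[OF h]]) (use h2 in \<open>simp add: ennreal_mult_less_top\<close>)
  have "ennreal (LINT p|lborel. (norm (inverse_fourier h p))\<^sup>2) \<le> ennreal (1 / \<kappa> * (LINT p|lborel. (norm (h p))\<^sup>2))"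
    using energy_inverse_fourier_le[OF h, folded \<kappa>_def] \<kappa>
    by (simp add: energy_eq_integral(2)[OF _ ea] energy_eq_integral(2)[OF _ h2] ennreal_mult[symmetric])
  then have 1: "(LINT p|lborel. (norm (inverse_fourier h p))\<^sup>2) \<le> 1 / \<kappa> * (LINT p|lborel. (norm (h p))\<^sup>2)"
    using \<kappa> by (subst (asm) ennreal_le_iff) auto
  have "complex_of_real (LINT p|lborel. (norm (fourier \<phi> p))\<^sup>2) = of_real \<kappa> * complex_of_real (LINT p|lborel. (norm (\<phi> p))\<^sup>2)"
    unfolding integral_complex_of_real[symmetric] complex_norm_square \<kappa>_def by (rule Parseval_plane[OF \<phi> i\<phi> e\<phi>])
  then have "(LINT p|lborel. (norm (fourier \<phi> p))\<^sup>2) = \<kappa> * (LINT p|lborel. (norm (\<phi> p))\<^sup>2)"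
    unfolding of_real_mult[symmetric] of_real_eq_iff .
  then have 2: "(LINT p|lborel. (norm (\<phi> p))\<^sup>2) = 1 / \<kappa> * (LINT p|lborel. (norm (fourier \<phi> p))\<^sup>2)"
    using \<kappa> by simp
  have "(LINT p|lborel. inverse_fourier h p * cnj (\<phi> p)) = (LINT p|lborel. of_real (1 / \<kappa>) * cnj (fourier (\<lambda>q. cnj (h q)) p * \<phi> p))"
    by (simp add: inverse_fourier_def \<kappa>_def mult_ac)
  also have "\<dots> = of_real (1 / \<kappa>) * cnj (LINT p|lborel. fourier (\<lambda>q. cnj (h q)) p * \<phi> p)"
    unfolding Bochner_Integration.integral_cnj[symmetric] by (rule integral_mult_right_zero)
  also have "(LINT p|lborel. fourier (\<lambda>q. cnj (h q)) p * \<phi> p) = (LINT p|lborel. cnj (h p) * fourier \<phi> p)"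
    by (rule fourier_mult_exchange[OF integrable_cnj[OF h] i\<phi>])
  also have "cnj \<dots> = (LINT p|lborel. h p * cnj (fourier \<phi> p))"
    unfolding Bochner_Integration.integral_cnj[symmetric] by simp
  finally have 3: "Re (LINT p|lborel. inverse_fourier h p * cnj (\<phi> p)) = 1 / \<kappa> * Re (LINT p|lborel. h p * cnj (fourier \<phi> p))"
    by simp
  have fin1: "sq_dist (inverse_fourier h) \<phi> < \<infinity>" "sq_dist h (fourier \<phi>) < \<infinity>"
    using sq_integrable_diff[of "inverse_fourier h" \<phi>] sq_integrable_diff[of h "fourier \<phi>"] ea e\<phi> h2 eF
    by (auto simp: sq_integrable_iff)
  have "(LINT p|lborel. (norm (inverse_fourier h p - \<phi> p))\<^sup>2) \<le> 1 / \<kappa> * (LINT p|lborel. (norm (h p - fourier \<phi> p))\<^sup>2)"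
  proof -
    have "(LINT p|lborel. (norm (inverse_fourier h p - \<phi> p))\<^sup>2) =
        (LINT p|lborel. (norm (inverse_fourier h p))\<^sup>2) + (LINT p|lborel. (norm (\<phi> p))\<^sup>2) - 2 * Re (LINT p|lborel. inverse_fourier h p * cnj (\<phi> p))"
      by (rule integral_norm_diff_square[OF _ _ ea e\<phi>]) auto
    moreover have "(LINT p|lborel. (norm (h p - fourier \<phi> p))\<^sup>2) =
        (LINT p|lborel. (norm (h p))\<^sup>2) + (LINT p|lborel. (norm (fourier \<phi> p))\<^sup>2) - 2 * Re (LINT p|lborel. h p * cnj (fourier \<phi> p))"
      by (rule integral_norm_diff_square[OF _ _ h2 eF]) auto
    ultimately show ?thesis
      using 1 unfolding 2 3 by (simp add: diff_divide_distrib add_divide_distrib)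
  qed
  then have "ennreal (LINT p|lborel. (norm (inverse_fourier h p - \<phi> p))\<^sup>2) \<le> ennreal (1 / \<kappa>) * ennreal (LINT p|lborel. (norm (h p - fourier \<phi> p))\<^sup>2)"
    using \<kappa> by (subst ennreal_mult[symmetric]) (auto intro: ennreal_leI)
  then show ?thesis
    unfolding \<kappa>_def using fin1 by (simp add: energy_eq_integral(2))
qed

lemma inverse_fourier_tendsto:
  assumes \<phi>: "\<And>n. schwartz (\<phi> n)" and lim: "L2_tendsto \<phi> u"
    and h: "\<And>n. integrable lborel (h n)" "\<And>n. sq_norm (h n) < \<infinity>"
    and hlim: "(\<lambda>n. sq_dist (h n) (L2_ext fourier u)) \<longlonglongrightarrow> 0"
  shows "(\<lambda>n. sq_dist (inverse_fourier (h n)) u) \<longlonglongrightarrow> 0"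
proof -
  let ?U = "L2_ext fourier u"
  note U = L2_fourier_tendsto[OF \<phi> lim, unfolded L2_tendsto_iff]
  have [measurable]: "u \<in> borel_measurable borel" "?U \<in> borel_measurable borel"
    using lim U by (auto simp: L2_tendsto_iff sq_integrable_iff)
  have [measurable]: "\<phi> n \<in> borel_measurable borel" "h n \<in> borel_measurable borel" for n
    using schwartz_measurable[OF \<phi>] h(1)[of n] by auto
  have tri1: "sq_dist (h n) (fourier (\<phi> n)) \<le> 2 * sq_dist (h n) ?U + 2 * sq_dist (fourier (\<phi> n)) ?U" for n
    using energy_triangle[of "h n" lborel ?U "fourier (\<phi> n)"] by (simp add: energy_minus_commute[of _ ?U])
  have l1: "(\<lambda>n. sq_dist (h n) (fourier (\<phi> n))) \<longlonglongrightarrow> 0"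
    by (rule ennreal_squeeze_0[OF tri1 _ _ hlim]) (use U in simp_all)
  have tri2: "sq_dist (inverse_fourier (h n)) u \<le> (2 * ennreal (1 / (2 * pi)\<^sup>2)) * sq_dist (h n) (fourier (\<phi> n)) + 2 * sq_dist (\<phi> n) u" for n
  proof -
    have "sq_dist (inverse_fourier (h n)) u \<le> 2 * sq_dist (inverse_fourier (h n)) (\<phi> n) + 2 * sq_dist (\<phi> n) u"
      by (rule energy_triangle) auto
    also have "sq_dist (inverse_fourier (h n)) (\<phi> n) \<le> ennreal (1 / (2 * pi)\<^sup>2) * sq_dist (h n) (fourier (\<phi> n))"
      by (rule energy_inverse_fourier_diff_le[OF h \<phi>])
    finally show ?thesis by (simp add: mult.assoc mult_left_mono add_mono)
  qed
  show ?thesis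
    by (rule ennreal_squeeze_0[OF tri2 _ _ l1]) (use lim in \<open>simp_all add: L2_tendsto_iff ennreal_mult_less_top\<close>)
qed

lemma integral_mult_L2_tendsto:
  fixes f :: "nat \<Rightarrow> 'a \<Rightarrow> complex"
  assumes [measurable]: "\<And>n. f n \<in> borel_measurable M" "f' \<in> borel_measurable M" "g \<in> borel_measurable M"
    and fin: "\<And>n. energy M (f n) < \<infinity>" "energy M f' < \<infinity>" "energy M g < \<infinity>"
    and lim: "(\<lambda>n. energy M (\<lambda>x. f n x - f' x)) \<longlonglongrightarrow> 0"
  shows "(\<lambda>n. LINT x|M. f n x * g x) \<longlonglongrightarrow> (LINT x|M. f' x * g x)"
proof -
  have bd: "ennreal ((norm ((LINT x|M. f n x * g x) - (LINT x|M. f' x * g x)))\<^sup>2) \<le> energy M g * energy M (\<lambda>x. f n x - f' x) + 0 * 0" for n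
  proof -
    have "(LINT x|M. f n x * g x) - (LINT x|M. f' x * g x) = (LINT x|M. (f n x - f' x) * g x)"
      using fin by (subst Bochner_Integration.integral_diff[symmetric]) (auto intro!: integrable_mult_energy simp: left_diff_distrib)
    moreover have "ennreal ((norm (LINT x|M. (f n x - f' x) * g x))\<^sup>2) \<le> (\<integral>\<^sup>+x. (ennreal (norm (f n x - f' x)))\<^sup>2 \<partial>M) * (\<integral>\<^sup>+x. (ennreal (norm (g x)))\<^sup>2 \<partial>M)"
      by (rule norm_integral_Cauchy_Schwarz) (auto simp: norm_mult ennreal_mult)
    ultimately show ?thesis by (simp add: energy_def ennreal_power mult.commute)
  qed
  have "(\<lambda>n. ennreal ((norm ((LINT x|M. f n x * g x) - (LINT x|M. f' x * g x)))\<^sup>2)) \<longlonglongrightarrow> 0"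
    by (rule ennreal_squeeze_0[OF bd fin(3) _ lim tendsto_const]) simp
  then have "(\<lambda>n. (norm ((LINT x|M. f n x * g x) - (LINT x|M. f' x * g x)))\<^sup>2) \<longlonglongrightarrow> 0"
    by (subst (asm) tendsto_ennreal_iff[of _ _ 0, simplified]) auto
  from tendsto_real_sqrt[OF this] show ?thesis
    by (simp add: tendsto_norm_zero_iff LIM_zero_iff)
qed

text \<open>Restriction to a bounded set of frequencies. If \<open>U\<close> lives on \<open>A\<close> almost
  everywhere, cutting off to \<open>A\<close> only changes a null set, but the support condition holds everywhere.\<close>

definition truncate :: "real set \<Rightarrow> nat \<Rightarrow> (real \<times> real \<Rightarrow> complex) \<Rightarrow> real \<times> real \<Rightarrow> complex" where
  "truncate A n U p = indicator {p. fst p \<in> A \<and> \<bar>fst p\<bar> \<le> n \<and> \<bar>snd p\<bar> \<le> n} p * U p"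

lemma truncate_measurable:
  assumes "closed A" and [measurable]: "U \<in> borel_measurable borel"
  shows "truncate A n U \<in> borel_measurable borel"
proof -
  have [measurable]: "A \<in> sets borel" using assms(1) by simp
  show ?thesis unfolding truncate_def[abs_def] by measurable
qed

lemma truncate_weighted: "weighted \<sigma> b (truncate A n U) = truncate A n (weighted \<sigma> b U)"
  by (simp add: fun_eq_iff weighted_def truncate_def)

lemma truncate_cnj: "(\<lambda>q. cnj (truncate A n U q)) = truncate A n (\<lambda>q. cnj (U q))"
  by (simp add: fun_eq_iff truncate_def indicator_def)

lemma energy_truncate_le: "energy M (truncate A n U) \<le> energy M U"
  unfolding truncate_def by (intro energy_mono) (auto simp: norm_mult split: split_indicator)

lemma truncate_integrable:
  assumes A: "closed A" and U[measurable]: "U \<in> borel_measurable borel" and fin: "sq_norm U < \<infinity>"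
  shows "integrable lborel (truncate A n U)" "integrable lborel (Dx_multiplier (truncate A n U))"
    "sq_norm (Dx_multiplier (truncate A n U)) < \<infinity>"
proof -
  have [measurable]: "truncate A n U \<in> borel_measurable borel" by (rule truncate_measurable[OF A U])
  let ?box = "indicator (cbox (- real n, - real n) (real n, real n)) :: real \<times> real \<Rightarrow> complex"
  have eB: "sq_norm ?box < \<infinity>"
  proof -
    have "ennreal ((norm (?box x))\<^sup>2) = indicator (cbox (- real n, - real n) (real n, real n)) x" for x
      by (simp split: split_indicator)
    then have "sq_norm ?box = emeasure lborel (cbox (- real n, - real n) (real n, real n))"
      unfolding energy_def by (simp only: nn_integral_indicator sets_lborel borel_closed closed_cbox)
    also have "\<dots> < \<infinity>" by (rule emeasure_lborel_cbox_finite)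
    finally show ?thesis .
  qed
  have eT: "sq_norm (truncate A n U) < \<infinity>" using energy_truncate_le fin by (rule le_less_trans)
  have zero: "truncate A n U q = truncate A n U q * ?box q" for q
    by (cases q) (auto simp: truncate_def indicator_def)
  have "integrable lborel (\<lambda>q. truncate A n U q * ?box q)"
    by (intro integrable_mult_energy eT eB) auto
  then show i: "integrable lborel (truncate A n U)" using zero by simp
  have le: "norm (of_real \<bar>fst q\<bar> * truncate A n U q) \<le> norm (of_real (real n) * truncate A n U q)" for q
    by (auto simp: truncate_def norm_mult indicator_def intro!: mult_right_mono)
  show "integrable lborel (Dx_multiplier (truncate A n U))"
    by (rule integrable_dominated[OF integrable_mult_right[OF i, of "of_real (real n)"]]) (use le in auto)
  have "sq_norm (Dx_multiplier (truncate A n U)) \<le> sq_norm (\<lambda>q. of_real (real n) * truncate A n U q)"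
    using le by (intro energy_mono) auto
  also have "\<dots> < \<infinity>" using eT by (subst energy_cmult) (auto simp: ennreal_mult_less_top)
  finally show "sq_norm (Dx_multiplier (truncate A n U)) < \<infinity>" .
qed

lemma truncate_tendsto:
  assumes A: "closed A" and U[measurable]: "U \<in> borel_measurable borel" and fin: "sq_norm U < \<infinity>"
    and supp: "AE p in lborel. U p \<noteq> 0 \<longrightarrow> fst p \<in> A"
  shows "(\<lambda>n. sq_dist (truncate A n U) U) \<longlonglongrightarrow> 0"
proof -
  have [measurable]: "truncate A n U \<in> borel_measurable borel" for n by (rule truncate_measurable[OF A U])
  have "(\<lambda>n. \<integral>\<^sup>+p. ennreal ((norm (truncate A n U p - U p))\<^sup>2) \<partial>lborel) \<longlonglongrightarrow> (\<integral>\<^sup>+p. (0::ennreal) \<partial>(lborel :: (real \<times> real) measure))"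
  proof (rule nn_integral_dominated_convergence)
    show "AE p in lborel. ennreal ((norm (truncate A n U p - U p))\<^sup>2) \<le> ennreal ((norm (U p))\<^sup>2)" for n
      by (auto simp: truncate_def indicator_def)
    show "AE p in lborel. (\<lambda>n. ennreal ((norm (truncate A n U p - U p))\<^sup>2)) \<longlonglongrightarrow> 0"
      using supp
    proof eventually_elim
      case (elim p)
      have "\<forall>\<^sub>F n in sequentially. ennreal ((norm (truncate A n U p - U p))\<^sup>2) = 0"
      proof (rule eventually_sequentiallyI)
        fix n assume "nat \<lceil>max \<bar>fst p\<bar> \<bar>snd p\<bar>\<rceil> \<le> n"
        then have "\<bar>fst p\<bar> \<le> real n \<and> \<bar>snd p\<bar> \<le> real n" by linarith
        then show "ennreal ((norm (truncate A n U p - U p))\<^sup>2) = 0"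
          using elim by (cases "U p = 0") (auto simp: truncate_def)
      qed
      then show ?case by (rule tendsto_eventually)
    qed
  qed (use fin in \<open>auto simp: energy_def\<close>)
  then show ?thesis by (simp add: energy_def)
qed

lemma L2_tendsto_Cauchy:
  assumes [measurable]: "\<And>n. f n \<in> borel_measurable M" "g \<in> borel_measurable M"
    and lim: "(\<lambda>n. energy M (\<lambda>x. f n x - g x)) \<longlonglongrightarrow> 0" and e: "e > 0"
  shows "\<exists>N. \<forall>m\<ge>N. \<forall>n\<ge>N. energy M (\<lambda>x. f m x - f n x) < e"
proof -
  have "(\<lambda>n. 4 * energy M (\<lambda>x. f n x - g x)) \<longlonglongrightarrow> 4 * 0"
    by (intro ennreal_tendsto_cmult lim) simp
  then have "\<forall>\<^sub>F n in sequentially. 4 * energy M (\<lambda>x. f n x - g x) < e"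
    using e by (intro order_tendstoD(2)) auto
  then obtain N where N: "\<And>n. n \<ge> N \<Longrightarrow> 4 * energy M (\<lambda>x. f n x - g x) < e"
    unfolding eventually_sequentially by blast
  have "energy M (\<lambda>x. f m x - f n x) < e" if mn: "m \<ge> N" "n \<ge> N" for m n
  proof -
    let ?a = "energy M (\<lambda>x. f m x - g x)" and ?b = "energy M (\<lambda>x. f n x - g x)"
    have "energy M (\<lambda>x. f m x - f n x) \<le> 2 * ?a + 2 * ?b"
      using energy_triangle[of "f m" M g "f n"] by (simp add: energy_minus_commute[of _ g])
    also have "\<dots> \<le> 2 * max ?a ?b + 2 * max ?a ?b" by (intro add_mono mult_left_mono) auto
    also have "\<dots> = 4 * max ?a ?b" by (simp add: distrib_right[symmetric])
    also have "\<dots> < e" using N[OF mn(1)] N[OF mn(2)] by (simp add: max_def)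
    finally show ?thesis .
  qed
  then show ?thesis by blast
qed

text \<open>Division by \<open>\<langle>x\<rangle>\<close> turns the bound on all time slices into a bound in \<open>L\<^sup>2\<close> of the plane, where
  completeness is available.\<close>

lemma Kato_smoothing:
  fixes g :: "real \<times> real \<Rightarrow> complex"
  assumes g[measurable]: "g \<in> borel_measurable borel"
    and int: "integrable lborel (Dx_multiplier g)"
  shows "sq_norm (\<lambda>p. of_real (1 / sqrt (1 + (fst p)\<^sup>2)) * fourier (Dx_multiplier g) p)
    \<le> japanese_mass 1 * (ennreal (2 * pi) * (japanese_mass b * Y_energy b g))"
proof -
  let ?H = "\<lambda>q. of_real \<bar>fst q\<bar> * g q"
  let ?C = "ennreal (2 * pi) * (japanese_mass b * Y_energy b g)"
  have m: "(\<lambda>p. of_real (1 / sqrt (1 + (fst p)\<^sup>2)) * fourier ?H p) \<in> borel_measurable borel" by measurable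
  have [measurable]: "fourier ?H \<in> borel_measurable (borel \<Otimes>\<^sub>M borel)"
    unfolding borel_prod by measurable
  have m2: "(\<lambda>t. fourier ?H (x, t)) \<in> borel_measurable lborel" for x by measurable
  have "sq_norm (\<lambda>p. of_real (1 / sqrt (1 + (fst p)\<^sup>2)) * fourier ?H p)
     = (\<integral>\<^sup>+x. ennreal (japanese x powr (- 2 * 1)) * sq_norm (\<lambda>t. fourier ?H (x, t)) \<partial>lborel)"
    unfolding energy_lborel_prod(1)[OF m]
  proof (rule nn_integral_cong)
    fix x :: real
    have "(norm (complex_of_real (1 / sqrt (1 + x\<^sup>2))))\<^sup>2 = japanese x powr (- 2 * 1)"
      by (simp add: japanese_powr powr_minus power_divide divide_simps norm_divide add_nonneg_nonneg)
    then show "sq_norm (\<lambda>t. of_real (1 / sqrt (1 + (fst (x, t))\<^sup>2)) * fourier ?H (x, t)) = ennreal (japanese x powr (- 2 * 1)) * sq_norm (\<lambda>t. fourier ?H (x, t))"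
      unfolding fst_conv energy_cmult[OF m2] by simp
  qed
  also have "\<dots> \<le> (\<integral>\<^sup>+x. ennreal (japanese x powr (- 2 * 1)) * ?C \<partial>lborel)"
    by (intro nn_integral_mono mult_left_mono Kato_smoothing_slice int) auto
  also have "\<dots> = japanese_mass 1 * ?C"
    unfolding japanese_mass_def[of 1] by (rule nn_integral_multc) measurable
  finally show ?thesis .
qed

section \<open>Construction of the derivative\<close>

lemma energy_abs_fst_schwartz:
  fixes \<phi> :: "real \<times> real \<Rightarrow> complex"
  assumes "schwartz \<phi>"
  shows "sq_norm (Dx_multiplier \<phi>) < \<infinity>"
proof -
  obtain C where C: "C \<ge> 0" "\<And>x t. norm (\<phi> (x, t)) \<le> C * (cauchy x) * (cauchy t)"
    using biquadratic_decay_E[OF schwartz_biquadratic_decay[OF assms]] by metis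
  let ?d = "\<lambda>x::real. cauchy x"
  let ?g = "\<lambda>p. complex_of_real (C\<^sup>2) * (complex_of_real (?d (fst p)) * complex_of_real (?d (snd p)))"
  have "integrable lborel ?g"
    by (intro integrable_mult_right integrable_pair_mult(1) integrable_of_real integrable_Cauchy_density)
  then have fin: "(\<integral>\<^sup>+p. ennreal (norm (?g p)) \<partial>lborel) < \<infinity>" by (simp add: integrable_iff_bounded)
  have "(norm (complex_of_real \<bar>fst p\<bar> * \<phi> p))\<^sup>2 \<le> norm (?g p)" for p
  proof -
    obtain x t where p: "p = (x, t)" by (cases p)
    have d: "0 \<le> ?d x" "0 \<le> ?d t" "?d t \<le> 1" "x\<^sup>2 * ?d x \<le> 1"
      using inverse_1_plus_square_le_1[of t] by (auto simp: divide_le_eq add_pos_nonneg add_nonneg_nonneg)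
    have "(norm (\<phi> (x, t)))\<^sup>2 \<le> (C * ?d x * ?d t)\<^sup>2" by (intro power_mono C(2)) simp
    then have "x\<^sup>2 * (norm (\<phi> (x, t)))\<^sup>2 \<le> x\<^sup>2 * (C * ?d x * ?d t)\<^sup>2" by (rule mult_left_mono) simp
    also have "\<dots> = C\<^sup>2 * (?d x * ?d t) * ((x\<^sup>2 * ?d x) * ?d t)" by (simp add: power2_eq_square mult_ac)
    also have "\<dots> \<le> C\<^sup>2 * (?d x * ?d t) * (1 * 1)"
      using d by (intro mult_left_mono[OF mult_mono]) auto
    also have "\<dots> = norm (?g p)" unfolding p norm_mult norm_of_real using d by simp
    finally show ?thesis by (simp add: p norm_mult power_mult_distrib)
  qed
  then have "sq_norm (Dx_multiplier \<phi>) \<le> (\<integral>\<^sup>+p. ennreal (norm (?g p)) \<partial>lborel)"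
    unfolding energy_def by (intro nn_integral_mono ennreal_leI)
  then show ?thesis using fin by (rule le_less_trans)
qed

lemma weighted_cnj: "norm (weighted \<sigma> b (\<lambda>q. cnj (U q)) p) = norm (weighted \<sigma> b U p)"
  by (simp add: weighted_def norm_mult)

text \<open>The factor \<open>1 / \<langle>x\<rangle>\<close>.\<close>

definition damping :: "real \<times> real \<Rightarrow> complex" where
  "damping p = of_real (1 / sqrt (1 + (fst p)\<^sup>2))"

lemma damping_nonzero: "damping p \<noteq> 0"
  unfolding damping_def using sum_power2_gt_zero_iff[of 1 "fst p"] by auto

lemma damping_measurable[measurable]: "damping \<in> borel_measurable borel"
  unfolding damping_def[abs_def] by measurable

definition Dx_approx :: "real set \<Rightarrow> (real \<times> real \<Rightarrow> complex) \<Rightarrow> nat \<Rightarrow> real \<times> real \<Rightarrow> complex" where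
  "Dx_approx B v n = inverse_fourier (Dx_multiplier (truncate B n (L2_ext fourier v)))"

text \<open>The damped approximations of the derivative form a Cauchy sequence by the smoothing estimate. Its
  limit, with the damping removed, satisfies the defining identity of \<open>is_Dx\<close>, which for the
  approximations is Parseval's identity.\<close>

lemma Dx_exists:
  assumes v: "v \<in> Y_space b" and b: "b > 1/2"
    and B: "closed B" "AE p in lborel. L2_ext fourier v p \<noteq> 0 \<longrightarrow> fst p \<in> B"
  obtains w where "w \<in> borel_measurable borel" "is_Dx v w"
    "(\<lambda>n. sq_norm (\<lambda>p. damping p * Dx_approx B v n p - damping p * w p)) \<longlonglongrightarrow> 0"
    "\<And>n. sq_norm (\<lambda>p. damping p * Dx_approx B v n p - damping p * w p) < \<infinity>"
proof -
  let ?V = "L2_ext fourier v"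
  let ?G = "weighted airy_phase b ?V"
  define H where "H n q = complex_of_real \<bar>fst q\<bar> * truncate B n ?V q" for n and q :: "real \<times> real"
  note s0 = damping_nonzero
  note Vm[measurable] = transform_of_bourgain_space(1)[OF v b disjI2[OF refl]]
  note eV = transform_of_bourgain_space(2)[OF v b disjI2[OF refl]]
  have Gm[measurable]: "?G \<in> borel_measurable borel" and eG: "sq_norm ?G < \<infinity>"
    using transform_of_bourgain_space(3)[OF v b disjI2[OF refl]] by (auto simp: sq_integrable_iff)
  have [measurable]: "truncate B n ?V \<in> borel_measurable borel" "truncate B n ?G \<in> borel_measurable borel" for n
    by (rule truncate_measurable[OF B(1)]; measurable)+
  have H: "integrable lborel (H n)" "sq_norm (H n) < \<infinity>" for n
    unfolding H_def[abs_def] by (rule truncate_integrable[OF B(1) Vm eV])+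
  have [measurable]: "H n \<in> borel_measurable borel" for n using H(1)[of n] by auto
  have suppG: "AE p in lborel. ?G p \<noteq> 0 \<longrightarrow> fst p \<in> B"
    using B(2) by eventually_elim (auto simp: weighted_def)
  define C where "C = ennreal ((1 / (2 * pi)\<^sup>2)\<^sup>2) * (japanese_mass 1 * (ennreal (2 * pi) * japanese_mass b))"
  have J: "japanese_mass b < \<infinity>" "japanese_mass 1 < \<infinity>"
    using japanese_nn_integral_finite[OF b] japanese_nn_integral_finite[of 1] unfolding japanese_mass_def by simp_all
  then have C: "C < \<infinity>" by (simp add: C_def ennreal_mult_less_top)
  \<comment> \<open>applied below to a truncation and to the difference of two truncations\<close>
  have smoothing: "sq_norm (\<lambda>p. damping p * inverse_fourier (Dx_multiplier g) p) \<le> C * Y_energy b g"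
    if [measurable]: "g \<in> borel_measurable borel" and int: "integrable lborel (Dx_multiplier g)" for g
  proof -
    have int': "integrable lborel (Dx_multiplier (\<lambda>q. cnj (g q)))" using integrable_cnj[OF int] by simp
    have "sq_norm (\<lambda>p. damping p * inverse_fourier (Dx_multiplier g) p)
       = sq_norm (\<lambda>p. of_real (1 / (2 * pi)\<^sup>2) * (damping p * fourier (Dx_multiplier (\<lambda>q. cnj (g q))) p))"
      by (simp add: energy_def inverse_fourier_def norm_mult norm_divide mult_ac)
    also have "\<dots> = ennreal ((1 / (2 * pi)\<^sup>2)\<^sup>2) * sq_norm (\<lambda>p. damping p * fourier (Dx_multiplier (\<lambda>q. cnj (g q))) p)"
      by (subst energy_cmult) (simp_all add: norm_divide norm_power)
    also have "\<dots> \<le> ennreal ((1 / (2 * pi)\<^sup>2)\<^sup>2) * (japanese_mass 1 * (ennreal (2 * pi) * (japanese_mass b * Y_energy b (\<lambda>q. cnj (g q)))))"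
      unfolding damping_def by (intro mult_left_mono Kato_smoothing int') auto
    also have "Y_energy b (\<lambda>q. cnj (g q)) = Y_energy b g"
      unfolding energy_def weighted_cnj ..
    finally show ?thesis by (simp add: C_def mult_ac)
  qed
  let ?w = "\<lambda>n p. damping p * inverse_fourier (H n) p"
  have wm[measurable]: "?w n \<in> borel_measurable borel" for n by measurable
  have we: "sq_norm (?w n) < \<infinity>" for n
  proof -
    have "sq_norm (?w n) \<le> C * Y_energy b (truncate B n ?V)"
      unfolding H_def by (rule smoothing) (use H(1)[of n] in \<open>simp_all add: H_def[abs_def]\<close>)
    also have "\<dots> \<le> C * sq_norm ?G"
      unfolding truncate_weighted by (intro mult_left_mono energy_truncate_le) simp
    also have "\<dots> < \<infinity>" using C eG by (simp add: ennreal_mult_less_top)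
    finally show ?thesis .
  qed
  have wdiff: "sq_dist (?w m) (?w n) \<le> C * sq_dist (truncate B m ?G) (truncate B n ?G)" for m n
  proof -
    let ?g = "\<lambda>q. truncate B m ?V q - truncate B n ?V q"
    have Hd: "(Dx_multiplier ?g) = (\<lambda>q. H m q - H n q)"
      by (simp add: fun_eq_iff H_def right_diff_distrib)
    have "inverse_fourier (\<lambda>q. H m q - H n q) p = inverse_fourier (H m) p - inverse_fourier (H n) p" for p
      using fourier_diff[OF integrable_cnj[OF H(1)[of m]] integrable_cnj[OF H(1)[of n]], of p]
      by (simp add: inverse_fourier_def right_diff_distrib)
    then have "sq_dist (?w m) (?w n) = sq_norm (\<lambda>p. damping p * inverse_fourier (Dx_multiplier ?g) p)"
      unfolding Hd by (simp add: right_diff_distrib)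
    also have "\<dots> \<le> C * Y_energy b ?g"
      by (rule smoothing) (use H(1) in \<open>auto simp: Hd\<close>)
    also have "weighted airy_phase b ?g = (\<lambda>p. truncate B m ?G p - truncate B n ?G p)"
      unfolding truncate_weighted[symmetric] by (simp add: fun_eq_iff weighted_def right_diff_distrib)
    finally show ?thesis .
  qed
  note tG = truncate_tendsto[OF B(1) Gm eG suppG]
  have "\<exists>w'\<in>borel_measurable lborel. (\<lambda>n. sq_norm (\<lambda>p. ?w n p - w' p)) \<longlonglongrightarrow> 0"
  proof (rule energy_complete)
    show "?w n \<in> borel_measurable lborel" for n using wm[of n] by simp
    fix e :: ennreal assume e: "e > 0"
    have m: "(\<lambda>p. sqrt (enn2real C) * truncate B n ?G p) \<in> borel_measurable lborel" "(\<lambda>p. sqrt (enn2real C) * ?G p) \<in> borel_measurable lborel" for n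
      by measurable
    have sc: "sq_norm (\<lambda>p. sqrt (enn2real C) * f p - sqrt (enn2real C) * g p) = C * sq_dist f g"
      if "(\<lambda>p. f p - g p) \<in> borel_measurable lborel" for f g :: "real \<times> real \<Rightarrow> complex"
      unfolding right_diff_distrib[symmetric] energy_cmult[OF that] using C by simp
    have "(\<lambda>n. C * sq_dist (truncate B n ?G) ?G) \<longlonglongrightarrow> C * 0"
      by (intro ennreal_tendsto_cmult tG) (use C in simp)
    then have "(\<lambda>n. sq_norm (\<lambda>p. sqrt (enn2real C) * truncate B n ?G p - sqrt (enn2real C) * ?G p)) \<longlonglongrightarrow> 0"
      by (subst sc) simp_all
    from L2_tendsto_Cauchy[OF m this e]
    have "\<exists>N. \<forall>m\<ge>N. \<forall>n\<ge>N. C * sq_dist (truncate B m ?G) (truncate B n ?G) < e"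
      by (subst (asm) sc) simp_all
    then show "\<exists>N. \<forall>m\<ge>N. \<forall>n\<ge>N. sq_dist (?w m) (?w n) < e"
      using wdiff by (meson le_less_trans)
  qed
  then obtain w' where w'[measurable]: "w' \<in> borel_measurable borel" and lim: "(\<lambda>n. sq_norm (\<lambda>p. ?w n p - w' p)) \<longlonglongrightarrow> 0"
    by auto
  have ew': "sq_norm w' < \<infinity>"
  proof -
    have "\<forall>\<^sub>F n in sequentially. sq_norm (\<lambda>p. ?w n p - w' p) < 1"
      using lim by (intro order_tendstoD(2)) auto
    then obtain n where n: "sq_norm (\<lambda>p. ?w n p - w' p) < 1" by (auto simp: eventually_sequentially)
    have "sq_norm (\<lambda>p. w' p - 0) \<le> 2 * sq_norm (\<lambda>p. w' p - ?w n p) + 2 * sq_norm (\<lambda>p. ?w n p - 0)"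
      by (rule energy_triangle) auto
    also have "\<dots> < \<infinity>"
      using we[of n] less_trans[OF n ennreal_one_less_top] by (simp add: energy_minus_commute[of _ w'] ennreal_mult_less_top)
    finally show ?thesis by simp
  qed
  define w where "w p = w' p / damping p" for p
  have sw: "damping p * w p = w' p" for p using s0[of p] by (simp add: w_def)
  have wm'[measurable]: "w \<in> borel_measurable borel" unfolding w_def[abs_def] by measurable
  have "is_Dx v w"
    unfolding is_Dx_def
  proof (intro conjI allI impI)
    show "w \<in> borel_measurable lborel" by simp
    fix \<phi> :: "real \<times> real \<Rightarrow> complex" assume \<phi>: "schwartz \<phi>"
    have [measurable]: "\<phi> \<in> borel_measurable borel"
      using schwartz_measurable[OF \<phi>] .
    let ?F = "\<lambda>p. fourier \<phi> p / damping p"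
    have "biquadratic_decay (\<lambda>p. of_real (sqrt (1 + (fst p)\<^sup>2)) * fourier \<phi> p)"
    proof (rule multiplier_fourier_schwartz_decay[OF \<phi>, where A=1 and j=1 and k=0])
      fix p :: "real \<times> real"
      have "sqrt (1 + (fst p)\<^sup>2) \<le> 1 + (fst p)\<^sup>2"
        by (rule real_le_lsqrt) (use self_le_power[of "1 + (fst p)\<^sup>2" 2] in auto)
      then show "norm (complex_of_real (sqrt (1 + (fst p)\<^sup>2))) \<le> 1 * (1 + (fst p)\<^sup>2) ^ 1 * (1 + (snd p)\<^sup>2) ^ 0"
        by simp
    qed measurable
    moreover have "(\<lambda>p. of_real (sqrt (1 + (fst p)\<^sup>2)) * fourier \<phi> p) = ?F"
      by (simp add: fun_eq_iff damping_def mult.commute)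
    ultimately have F: "sq_norm ?F < \<infinity>" using biquadratic_decay_energy by metis
    have wF: "w p * fourier \<phi> p = w' p * ?F p" for p using s0[of p] by (simp add: w_def)
    show "integrable lborel (\<lambda>p. w p * fourier \<phi> p)"
      unfolding wF by (intro integrable_mult_energy ew' F) auto
    have l1: "(\<lambda>n. LINT p|lborel. ?w n p * ?F p) \<longlonglongrightarrow> (LINT p|lborel. w' p * ?F p)"
      by (rule integral_mult_L2_tendsto[OF _ _ _ we ew' F lim]) auto
    have "(LINT p|lborel. ?w n p * ?F p) = (LINT p|lborel. truncate B n ?V p * (of_real \<bar>fst p\<bar> * \<phi> p))" for n
    proof -
      have "(LINT p|lborel. ?w n p * ?F p) = (LINT p|lborel. of_real (1 / (2 * pi)\<^sup>2) * (fourier \<phi> p * cnj (fourier (\<lambda>q. cnj (H n q)) p)))"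
        using s0 by (intro Bochner_Integration.integral_cong) (simp_all add: inverse_fourier_def mult_ac)
      also have "\<dots> = of_real (1 / (2 * pi)\<^sup>2) * (LINT p|lborel. fourier \<phi> p * cnj (fourier (\<lambda>q. cnj (H n q)) p))"
        by (rule integral_mult_right_zero)
      also have "(LINT p|lborel. fourier \<phi> p * cnj (fourier (\<lambda>q. cnj (H n q)) p)) = of_real ((2 * pi)\<^sup>2) * (LINT p|lborel. \<phi> p * cnj (cnj (H n p)))"
        by (rule Parseval_plane[OF \<phi> integrable_cnj[OF H(1)]]) (simp add: energy_cnj H(2)[simplified])
      also have "of_real (1 / (2 * pi)\<^sup>2) * (of_real ((2 * pi)\<^sup>2) * (LINT p|lborel. \<phi> p * cnj (cnj (H n p)))) = (LINT p|lborel. \<phi> p * H n p)"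
        by (simp add: mult.assoc[symmetric] of_real_mult[symmetric] del: of_real_mult of_real_power of_real_divide)
      also have "\<dots> = (LINT p|lborel. truncate B n ?V p * (of_real \<bar>fst p\<bar> * \<phi> p))"
        by (simp add: H_def mult_ac)
      finally show ?thesis .
    qed
    moreover have "(\<lambda>n. LINT p|lborel. truncate B n ?V p * (of_real \<bar>fst p\<bar> * \<phi> p)) \<longlonglongrightarrow> (LINT p|lborel. ?V p * (of_real \<bar>fst p\<bar> * \<phi> p))"
    proof (rule integral_mult_L2_tendsto)
      show "sq_norm (truncate B n ?V) < \<infinity>" for n
        using energy_truncate_le eV by (rule le_less_trans)
      show "sq_norm (Dx_multiplier \<phi>) < \<infinity>"
        by (rule energy_abs_fst_schwartz[OF \<phi>])
    qed (use eV truncate_tendsto[OF B(1) Vm eV B(2)] in auto)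
    ultimately have "(LINT p|lborel. w' p * ?F p) = (LINT p|lborel. ?V p * (of_real \<bar>fst p\<bar> * \<phi> p))"
      using l1 LIMSEQ_unique by auto
    then show "(LINT p|lborel. w p * fourier \<phi> p) = (LINT p|lborel. of_real \<bar>fst p\<bar> * ?V p * \<phi> p)"
      unfolding wF by (simp add: mult_ac)
  qed
  moreover have fin: "sq_norm (\<lambda>p. ?w n p - w' p) < \<infinity>" for n
    using sq_integrable_diff[of "?w n" w'] we ew' by (simp add: sq_integrable_iff)
  moreover have eq: "(\<lambda>p. damping p * Dx_approx B v n p - damping p * w p) = (\<lambda>p. ?w n p - w' p)" for n
    unfolding Dx_approx_def sw H_def[abs_def] ..
  ultimately show thesis
    using lim wm' that[of w] unfolding eq by blast
qed

section \<open>The product estimate\<close>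

text \<open>\<open>bilinear_estimate\<close> is applied to the conjugates of the truncations, because \<open>inverse_fourier\<close> is a
  conjugated Fourier transform.\<close>

lemma bilinear_estimate_truncated:
  assumes A: "closed A" and B: "closed B" and AB: "\<And>a b. a \<in> A \<Longrightarrow> b \<in> B \<Longrightarrow> \<bar>a\<bar> \<le> b\<^sup>2"
    and U[measurable]: "U \<in> borel_measurable borel" and eU: "sq_norm U < \<infinity>"
    and V[measurable]: "V \<in> borel_measurable borel" and eV: "sq_norm V < \<infinity>"
  shows "sq_norm (\<lambda>p. inverse_fourier (truncate A n U) p * inverse_fourier (Dx_multiplier (truncate B n V)) p)
    \<le> ennreal ((1 / (2 * pi) ^ 4)\<^sup>2) * (ennreal ((2 * pi)\<^sup>2) * (2 * (japanese_mass b)\<^sup>2 *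
        (X_energy b U * Y_energy b V)))"
proof -
  let ?f = "truncate A n (\<lambda>q. cnj (U q))" and ?g = "truncate B n (\<lambda>q. cnj (V q))"
  have eU': "sq_norm (\<lambda>q. cnj (U q)) < \<infinity>" and eV': "sq_norm (\<lambda>q. cnj (V q)) < \<infinity>"
    using eU eV by (simp_all add: energy_cnj)
  have i: "integrable lborel ?f" "integrable lborel (Dx_multiplier ?g)"
    by (rule truncate_integrable[OF A _ eU'], measurable) (rule truncate_integrable[OF B _ eV'], measurable)
  have [measurable]: "?g \<in> borel_measurable borel" by (rule truncate_measurable[OF B]) measurable
  have [measurable]: "fourier ?f \<in> borel_measurable borel" "fourier (Dx_multiplier ?g) \<in> borel_measurable borel"
    using i by auto
  have "sq_norm (\<lambda>p. inverse_fourier (truncate A n U) p * inverse_fourier (Dx_multiplier (truncate B n V)) p)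
     = sq_norm (\<lambda>p. of_real (1 / (2 * pi) ^ 4) * (fourier ?f p * fourier (Dx_multiplier ?g) p))"
  proof -
    have "(\<lambda>q. cnj (of_real \<bar>fst q\<bar> * truncate B n V q)) = (Dx_multiplier ?g)"
      unfolding truncate_cnj[symmetric] by simp
    moreover have "(2 * pi) ^ 4 = (2 * pi)\<^sup>2 * (2 * pi)\<^sup>2" by (simp add: power2_eq_square numeral_eq_Suc)
    ultimately show ?thesis
      unfolding energy_def inverse_fourier_def truncate_cnj by (simp add: norm_mult norm_divide norm_power mult_ac)
  qed
  also have "\<dots> = ennreal ((1 / (2 * pi) ^ 4)\<^sup>2) * sq_norm (\<lambda>p. fourier ?f p * fourier (Dx_multiplier ?g) p)"
    by (subst energy_cmult) (simp_all add: norm_divide norm_power)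
  also have "\<dots> \<le> ennreal ((1 / (2 * pi) ^ 4)\<^sup>2) * (ennreal ((2 * pi)\<^sup>2) * (2 * (japanese_mass b)\<^sup>2 *
        (X_energy b ?f * Y_energy b ?g)))"
  proof (intro mult_left_mono bilinear_estimate i)
    show "?g \<in> borel_measurable borel" by measurable
    show "\<bar>fst p\<bar> \<le> (fst q)\<^sup>2" if "?f p \<noteq> 0" "?g q \<noteq> 0" for p q
      using that AB by (auto simp: truncate_def indicator_def split: if_splits)
  qed auto
  also have "\<dots> \<le> ennreal ((1 / (2 * pi) ^ 4)\<^sup>2) * (ennreal ((2 * pi)\<^sup>2) * (2 * (japanese_mass b)\<^sup>2 *
        (X_energy b U * Y_energy b V)))"
  proof -
    have "sq_norm (weighted \<sigma> b (truncate S n (\<lambda>q. cnj (W q)))) \<le> sq_norm (weighted \<sigma> b W)" for \<sigma> S W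
    proof -
      have "sq_norm (weighted \<sigma> b (truncate S n (\<lambda>q. cnj (W q)))) \<le> sq_norm (weighted \<sigma> b (\<lambda>q. cnj (W q)))"
        unfolding truncate_weighted by (rule energy_truncate_le)
      then show ?thesis unfolding energy_def weighted_cnj .
    qed
    then show ?thesis by (intro mult_left_mono mult_mono) auto
  qed
  finally show ?thesis .
qed

definition bilinear_constant :: "real \<Rightarrow> ennreal" where
  "bilinear_constant b = ennreal ((1 / (2 * pi) ^ 4)\<^sup>2) * (ennreal ((2 * pi)\<^sup>2) * (2 * (japanese_mass b)\<^sup>2))"

lemma bilinear_constant_finite:
  assumes "b > 1/2" shows "bilinear_constant b < \<infinity>"
  using japanese_nn_integral_finite[OF assms]
  by (simp add: bilinear_constant_def ennreal_mult_less_top japanese_mass_def power2_eq_square)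

text \<open>The truncated products obey a uniform bound and converge almost everywhere along a subsequence:
  the first factors in \<open>L\<^sup>2\<close>, the second ones in \<open>L\<^sup>2\<close> after damping.\<close>

lemma product_estimate:
  assumes b: "b > 1/2" and u: "u \<in> X_space b" and v: "v \<in> Y_space b"
    and freq: "\<And>\<xi>1 \<xi>2. \<xi>1 \<in> x_frequencies u \<Longrightarrow> \<xi>2 \<in> x_frequencies v \<Longrightarrow> \<bar>\<xi>1\<bar> \<le> \<xi>2\<^sup>2"
  obtains w where "u \<in> borel_measurable borel" "w \<in> borel_measurable borel" "is_Dx v w"
    "sq_norm (\<lambda>p. u p * w p) \<le> ennreal ((sqrt (enn2real (bilinear_constant b)) * X_norm b u * Y_norm b v)\<^sup>2)"
proof -
  let ?D = "bilinear_constant b"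
  let ?U = "L2_ext fourier u" and ?V = "L2_ext fourier v"
  let ?F = "weighted schroedinger_phase b ?U" and ?G = "weighted airy_phase b ?V"
  define A where "A = closure (x_frequencies u)"
  define B where "B = closure (x_frequencies v)"
  have A: "closed A" and B: "closed B" by (simp_all add: A_def B_def)
  \<comment> \<open>the support condition is closed in each of the two frequencies, so it passes to the closures\<close>
  have AB: "\<bar>a\<bar> \<le> c\<^sup>2" if "a \<in> A" "c \<in> B" for a c
  proof -
    have "A \<subseteq> {a. \<bar>a\<bar> \<le> c\<^sup>2}" if "c \<in> x_frequencies v" for c
      unfolding A_def using freq that
      by (intro closure_minimal closed_Collect_le continuous_intros) auto
    then have "B \<subseteq> {c. \<bar>a\<bar> \<le> c\<^sup>2}"
      unfolding B_def using that(1)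
      by (intro closure_minimal closed_Collect_le continuous_intros) auto
    then show ?thesis using that(2) by auto
  qed
  obtain \<phi> where \<phi>: "\<And>n. schwartz (\<phi> n)" "L2_tendsto \<phi> u"
    using u unfolding bourgain_space_def by blast
  obtain \<psi> where \<psi>: "\<And>n. schwartz (\<psi> n)" "L2_tendsto \<psi> v"
    using v unfolding bourgain_space_def by blast
  have um[measurable]: "u \<in> borel_measurable borel" and eu: "sq_norm u < \<infinity>"
    using \<phi>(2) by (auto simp: L2_tendsto_iff sq_integrable_iff)
  note U = transform_of_bourgain_space[OF u b disjI1[OF refl]] and V = transform_of_bourgain_space[OF v b disjI2[OF refl]]
  note Um[measurable] = U(1) and Vm[measurable] = V(1)
  note eU = U(2) and F = U(3) and eV = V(2) and G = V(3)
  note suppU = AE_fourier_support[OF \<phi>, folded A_def]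
  note suppV = AE_fourier_support[OF \<psi>, folded B_def]
  define un where "un n = inverse_fourier (truncate A n ?U)" for n
  let ?wn = "Dx_approx B v"
  have [measurable]: "truncate A n ?U \<in> borel_measurable borel" "truncate B n ?V \<in> borel_measurable borel" for n
    by (rule truncate_measurable; simp add: A B)+
  have [measurable]: "un n \<in> borel_measurable borel" "?wn n \<in> borel_measurable borel" for n
    unfolding un_def Dx_approx_def by measurable
  obtain w where wm[measurable]: "w \<in> borel_measurable borel" and Dx: "is_Dx v w"
    and wlim: "(\<lambda>n. sq_norm (\<lambda>p. damping p * ?wn n p - damping p * w p)) \<longlonglongrightarrow> 0"
    and wfin: "\<And>n. sq_norm (\<lambda>p. damping p * ?wn n p - damping p * w p) < \<infinity>"
    using Dx_exists[OF v b B suppV] by blast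
  have trunc: "integrable lborel (truncate A n ?U)" "sq_norm (truncate A n ?U) < \<infinity>" for n
    by (rule truncate_integrable[OF A Um eU]) (rule le_less_trans[OF energy_truncate_le eU])
  have ulim: "(\<lambda>n. sq_dist (un n) u) \<longlonglongrightarrow> 0"
    unfolding un_def by (rule inverse_fourier_tendsto[OF \<phi> trunc truncate_tendsto[OF A Um eU suppU]])
  have ufin: "sq_dist (un n) u < \<infinity>" for n
  proof -
    have "sq_norm (un n) < \<infinity>" unfolding un_def
      by (rule le_less_trans[OF energy_inverse_fourier_le[OF trunc(1)]]) (use trunc(2) in \<open>simp add: ennreal_mult_less_top\<close>)
    then show ?thesis using sq_integrable_diff[of "un n" u] eu by (simp add: sq_integrable_iff)
  qed
  have "\<exists>r::nat\<Rightarrow>nat. strict_mono r \<and> (AE p in lborel. (\<lambda>n. un (r n) p) \<longlonglongrightarrow> u p)"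
    by (rule energy_AE_subseq[OF _ _ ufin ulim]) auto
  then obtain r :: "nat \<Rightarrow> nat" where r: "strict_mono r" "AE p in lborel. (\<lambda>n. un (r n) p) \<longlonglongrightarrow> u p" by blast
  have "\<exists>r'::nat\<Rightarrow>nat. strict_mono r' \<and> (AE p in lborel. (\<lambda>n. damping p * ?wn (r (r' n)) p) \<longlonglongrightarrow> damping p * w p)"
  proof (rule energy_AE_subseq)
    show "(\<lambda>n. sq_norm (\<lambda>p. damping p * ?wn (r n) p - damping p * w p)) \<longlonglongrightarrow> 0"
      using LIMSEQ_subseq_LIMSEQ[OF wlim r(1)] by (simp add: o_def)
  qed (use wfin in auto)
  then obtain r' :: "nat \<Rightarrow> nat" where r': "strict_mono r'" "AE p in lborel. (\<lambda>n. damping p * ?wn (r (r' n)) p) \<longlonglongrightarrow> damping p * w p" by blast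
  have prod_le: "sq_norm (\<lambda>p. un n p * ?wn n p) \<le> ?D * (sq_norm ?F * sq_norm ?G)" for n
    unfolding un_def Dx_approx_def bilinear_constant_def
    using bilinear_estimate_truncated[OF A B AB Um eU Vm eV, of n b] by (simp add: mult.assoc)
  have le: "sq_norm (\<lambda>p. u p * w p) \<le> ?D * (sq_norm ?F * sq_norm ?G)"
  proof (rule energy_Fatou)
    show "AE p in lborel. (\<lambda>n. un (r (r' n)) p * ?wn (r (r' n)) p) \<longlonglongrightarrow> u p * w p"
      using r(2) r'(2)
    proof eventually_elim
      case (elim p)
      have "(\<lambda>n. damping p * ?wn (r (r' n)) p / damping p) \<longlonglongrightarrow> damping p * w p / damping p"
        by (intro tendsto_intros elim(2) damping_nonzero)
      then have "(\<lambda>n. ?wn (r (r' n)) p) \<longlonglongrightarrow> w p" using damping_nonzero[of p] by simp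
      moreover have "(\<lambda>n. un (r (r' n)) p) \<longlonglongrightarrow> u p"
        using LIMSEQ_subseq_LIMSEQ[OF elim(1) r'(1)] by (simp add: o_def)
      ultimately show ?case by (intro tendsto_mult)
    qed
  qed (use prod_le in auto)
  have XY: "sq_norm ?F = ennreal ((X_norm b u)\<^sup>2)" "sq_norm ?G = ennreal ((Y_norm b v)\<^sup>2)"
    unfolding bourgain_norm_def by (rule energy_eq_L2_norm[OF F], rule energy_eq_L2_norm[OF G])
  have le': "sq_norm (\<lambda>p. u p * w p) \<le> ennreal ((sqrt (enn2real ?D) * X_norm b u * Y_norm b v)\<^sup>2)"
  proof -
    have "?D = ennreal (enn2real ?D)" using bilinear_constant_finite[OF b] by simp
    then have "?D * (sq_norm ?F * sq_norm ?G) = ennreal (enn2real ?D) * (ennreal ((X_norm b u)\<^sup>2) * ennreal ((Y_norm b v)\<^sup>2))"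
      unfolding XY by simp
    also have "\<dots> = ennreal (enn2real ?D * ((X_norm b u)\<^sup>2 * (Y_norm b v)\<^sup>2))"
      by (simp add: ennreal_mult)
    also have "enn2real ?D * ((X_norm b u)\<^sup>2 * (Y_norm b v)\<^sup>2) = (sqrt (enn2real ?D) * X_norm b u * Y_norm b v)\<^sup>2"
      by (simp add: power_mult_distrib)
    finally show ?thesis using le by simp
  qed
  show thesis by (rule that[OF um wm Dx le'])
qed

lemma L2_norm_le_of_energy_le:
  assumes "f \<in> borel_measurable borel" "sq_norm f \<le> ennreal (c\<^sup>2)" "0 \<le> c"
  shows "sq_integrable f" "L2_norm f \<le> c"
proof -
  have "sq_norm f < \<infinity>" by (rule le_less_trans[OF assms(2)]) simp
  then show s: "sq_integrable f" using assms(1) by (simp add: sq_integrable_iff)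
  have "ennreal ((L2_norm f)\<^sup>2) \<le> ennreal (c\<^sup>2)"
    using assms(2) unfolding energy_eq_L2_norm[OF s] .
  then have "(L2_norm f)\<^sup>2 \<le> c\<^sup>2" by (subst (asm) ennreal_le_iff) simp_all
  then show "L2_norm f \<le> c" using assms(3) by (rule power2_le_imp_le)
qed

lemma product_estimates:
  assumes b: "b > 1/2" and u: "u \<in> X_space b" and v: "v \<in> Y_space b"
    and freq: "\<And>\<xi>1 \<xi>2. \<xi>1 \<in> x_frequencies u \<Longrightarrow> \<xi>2 \<in> x_frequencies v \<Longrightarrow> \<bar>\<xi>1\<bar> \<le> \<xi>2\<^sup>2"
  defines "c \<equiv> sqrt (enn2real (bilinear_constant b))"
  shows "\<exists>w. is_Dx v w \<and>
    sq_integrable (\<lambda>p. u p * w p) \<and> L2_norm (\<lambda>p. u p * w p) \<le> c * X_norm b u * Y_norm b v \<and>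
    sq_integrable (\<lambda>p. cnj (u p) * w p) \<and> L2_norm (\<lambda>p. cnj (u p) * w p) \<le> c * X_norm b u * Y_norm b v"
proof -
  obtain w where [measurable]: "u \<in> borel_measurable borel" "w \<in> borel_measurable borel" and Dx: "is_Dx v w"
    and le: "sq_norm (\<lambda>p. u p * w p) \<le> ennreal ((c * X_norm b u * Y_norm b v)\<^sup>2)"
    using product_estimate[OF b u v freq] unfolding c_def by blast
  have nonneg: "0 \<le> c * X_norm b u * Y_norm b v"
    unfolding bourgain_norm_def L2_norm_def c_def by (intro mult_nonneg_nonneg) (auto intro!: integral_nonneg_AE)
  have "sq_norm (\<lambda>p. cnj (u p) * w p) = sq_norm (\<lambda>p. u p * w p)"
    by (simp add: energy_def norm_mult)
  with le have le': "sq_norm (\<lambda>p. cnj (u p) * w p) \<le> ennreal ((c * X_norm b u * Y_norm b v)\<^sup>2)"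
    by simp
  show ?thesis
    using Dx L2_norm_le_of_energy_le[OF _ le nonneg] L2_norm_le_of_energy_le[OF _ le' nonneg]
    by (intro exI[of _ w]) simp
qed

theorem lemma1p3:
  shows "\<exists>K::real. K \<ge> 1 \<and> (\<forall>b::real. b > 1/2 \<longrightarrow> (\<exists>c::real. \<forall>u v.
    u \<in> X_space b \<longrightarrow> v \<in> Y_space b \<longrightarrow>
    (\<forall>\<xi>1 \<in> x_frequencies u. \<forall>\<xi>2 \<in> x_frequencies v. \<bar>\<xi>2\<bar>\<^sup>2 \<ge> K * \<bar>\<xi>1\<bar>) \<longrightarrow>
    (\<exists>w. is_Dx v w \<and>
      sq_integrable (\<lambda>p. u p * w p) \<and>
      L2_norm (\<lambda>p. u p * w p) \<le> c * X_norm b u * Y_norm b v \<and>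
      sq_integrable (\<lambda>p. cnj (u p) * w p) \<and>
      L2_norm (\<lambda>p. cnj (u p) * w p) \<le> c * X_norm b u * Y_norm b v)))"
  by (rule exI[of _ 1], rule conjI, simp, intro allI impI, rule exI, intro allI impI, rule product_estimates) auto

end
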